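(* A positive integer $n$ is $\lambda$-practical if and only if every integer $m$ with $1 \le m \le n$ can be written in the form $m = \sum_{d \mid n} \lambda(d)\, m_d$, where each $m_d$ is an integer with $0 \le m_d \le \frac{\varphi(d)}{\lambda(d)}$.
   Context: For a prime $p$, a positive integer $n$ is $p$-practical if $x^n-1$ has a divisor in $\mathbb{F}_p[x]$ of every degree $1,\dots,n$; $n$ is $\lambda$-practical if it is $p$-practical for every prime $p$. $\lambda(d)$ denotes the Carmichael function, the exponent of the group $(\mathbb{Z}/d\mathbb{Z})^\times$ (with $\lambda(1)=1$), and $\varphi$ is Euler's totient function. *)

theory Defs
  imports
    Complex_Main
    "HOL-Number_Theory.Residues"
    "HOL-Number_Theory.Residue_Primitive_Roots"
    "HOL-Algebra.Polynomial_Divisibility"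
begin

text \<open>
  The field with \<open>p\<close> elements is \<^term>\<open>residue_ring (int p)\<close>, so that \<open>p\<close> is an ordinary
  variable that can be quantified over. Elements of \<^const>\<open>poly_ring\<close> are coefficient lists
  starting with the leading coefficient; the zero polynomial \<open>[]\<close> has degree 0.
\<close>

abbreviation Fp_poly_ring :: "nat \<Rightarrow> int list ring" where
  "Fp_poly_ring p \<equiv> poly_ring (residue_ring (int p))"

definition X_pow_minus_1 :: "nat \<Rightarrow> nat \<Rightarrow> int list" where
  "X_pow_minus_1 p n =
     (X\<^bsub>residue_ring (int p)\<^esub> [^]\<^bsub>Fp_poly_ring p\<^esub> n)
       \<ominus>\<^bsub>Fp_poly_ring p\<^esub> \<one>\<^bsub>Fp_poly_ring p\<^esub>"

definition p_practical :: "nat \<Rightarrow> nat \<Rightarrow> bool" where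
  "p_practical p n \<longleftrightarrow>
     (\<forall>k\<in>{1..n}. \<exists>f\<in>carrier (Fp_poly_ring p).
        f pdivides\<^bsub>residue_ring (int p)\<^esub> X_pow_minus_1 p n \<and> Polynomials.degree f = k)"

definition lambda_practical :: "nat \<Rightarrow> bool" where
  "lambda_practical n \<longleftrightarrow> (\<forall>p::nat. Factorial_Ring.prime p \<longrightarrow> p_practical p n)"

end

theory Submission
  imports Defs "HOL-Number_Theory.Prime_Powers" "HOL-Computational_Algebra.Squarefree"
begin

text \<open>
  Let \<open>p\<close> be a prime not dividing \<open>n\<close>. Modulo an irreducible factor of \<open>X\<^sup>n - 1\<close> over the field with
  \<open>p\<close> elements, the class of \<open>X\<close> has some multiplicative order \<open>d\<close> dividing \<open>n\<close>, and the factor then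
  has degree \<open>ord d p\<close>. Comparing the degrees of \<open>X\<^sup>e - 1\<close> for all \<open>e\<close> dividing \<open>n\<close> shows that the
  factors belonging to \<open>d\<close> have total degree \<open>totient d\<close>. As \<open>X\<^sup>n - 1\<close> is squarefree, the degrees of
  its divisors are exactly the sums of \<open>ord d p * c d\<close> with \<open>c d \<le> totient d div ord d p\<close>.

  Since \<open>ord d p\<close> divides \<open>Carmichael d\<close>, factors can be grouped into blocks of degree \<open>Carmichael d\<close>;
  if \<open>n = p\<^sup>j n'\<close>, then \<open>X\<^sup>n - 1\<close> is the \<open>p\<^sup>j\<close>-th power of \<open>X\<^bsup>n'\<^esup> - 1\<close> and the same grouping works.
  Conversely, some \<open>a\<close> satisfies \<open>ord d a = Carmichael d\<close> for all \<open>d\<close> dividing \<open>n\<close> at once, and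
  Dirichlet's theorem yields a prime \<open>p\<close> congruent to \<open>a\<close> modulo \<open>n\<close>, for which no grouping is needed.

  Dirichlet's theorem is proved by Mertens-type estimates for the partial sums of
  \<open>\<chi> n * mangoldt n / n\<close>. If \<open>L(1, \<chi>) = 0\<close>, such a sum is \<open>- ln N + O(1)\<close>, so by orthogonality and
  positivity at most one non-principal character can vanish at 1. It would have to be real, and real
  characters are excluded by Monsky's argument with the Lambert series of \<open>\<chi>\<close>.
\<close>

section \<open>Dirichlet characters\<close>

text \<open>Since \<open>ord d p\<close> always divides \<open>Carmichael d\<close>, a prime with
  \<open>ord d p = Carmichael d\<close> for all \<open>d\<close> dividing \<open>n\<close> gives the
  coarsest supply of degrees; every other prime only refines it. One such prime therefore carries
  the whole necessity direction. The obstacle is its existence: a suitable residue class comes from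
  the Chinese remainder theorem, but a prime inside it requires Dirichlet's theorem for arbitrary
  classes. To stay with finite sums, L(1, \<chi>) is taken as the limit of its conditionally
  convergent series, with explicit error 2k/(M+1) after M terms; neither other arguments s nor
  logarithms of L-functions occur. Why at most one character can vanish: if v non-principal
  characters do, the real parts of all the Mertens sums add up to (1 - v) ln N + O(1), while
  orthogonality makes this total nonnegative. A vanishing non-real character would bring along its
  conjugate, so that v would be at least 2.\<close>

definition dirichlet_chars :: "nat \<Rightarrow> (nat \<Rightarrow> complex) set" where
  "dirichlet_chars k = {\<chi>. (\<forall>n. \<chi> n = 0 \<longleftrightarrow> \<not> coprime n k) \<and> (\<forall>m n. \<chi> (m * n) = \<chi> m * \<chi> n) \<and>
     (\<forall>m n. [m = n] (mod k) \<longrightarrow> \<chi> m = \<chi> n)}"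

definition principal_char :: "nat \<Rightarrow> nat \<Rightarrow> complex" where
  "principal_char k n = (if coprime n k then 1 else 0)"

lemma principal_char_in [simp]: "principal_char k \<in> dirichlet_chars k"
  unfolding dirichlet_chars_def principal_char_def by (auto dest: cong_imp_coprime cong_sym)

context
  fixes k :: nat and \<chi> :: "nat \<Rightarrow> complex"
  assumes k: "k > 0" and \<chi>: "\<chi> \<in> dirichlet_chars k"
begin

lemma char_eq_0_iff: "\<chi> n = 0 \<longleftrightarrow> \<not> coprime n k"
  using \<chi> unfolding dirichlet_chars_def by auto

lemma char_mult: "\<chi> (m * n) = \<chi> m * \<chi> n"
  using \<chi> unfolding dirichlet_chars_def by auto

lemma char_cong: "[m = n] (mod k) \<Longrightarrow> \<chi> m = \<chi> n"
  using \<chi> unfolding dirichlet_chars_def by blast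

text \<open>The normalisation is hidden in the zero condition: \<chi> 1 is idempotent and
  nonzero.\<close>

lemma char_1: "\<chi> (Suc 0) = 1"
  using char_mult[of 1 1] char_eq_0_iff[of 1] by simp

lemma char_power: "\<chi> (n ^ j) = \<chi> n ^ j"
  by (induction j) (auto simp: char_mult char_1)

lemma char_root_of_unity: "coprime n k \<Longrightarrow> \<chi> n ^ totient k = 1"
  using euler_theorem[of n k] char_cong[of "n ^ totient k" 1] by (simp add: char_power char_1)

lemma norm_char_coprime: "coprime n k \<Longrightarrow> norm (\<chi> n) = 1"
  using char_root_of_unity[of n] k
  by (metis power_eq_1_iff totient_gt_0_iff neq0_conv)

lemma norm_char_le_1: "norm (\<chi> n) \<le> 1"
  using norm_char_coprime[of n] char_eq_0_iff[of n] by (cases "coprime n k") auto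

lemma cnj_char_in: "(\<lambda>n. cnj (\<chi> n)) \<in> dirichlet_chars k"
  using \<chi> unfolding dirichlet_chars_def by auto

text \<open>Multiplication by a unit \<open>a\<close> with \<open>\<chi> a \<noteq> 1\<close>
  permutes the residues, so the sum equals \<open>\<chi> a\<close> times itself.\<close>

lemma sum_char_mod_eq_0:
  assumes "\<chi> \<noteq> principal_char k"
  shows "(\<Sum>n<k. \<chi> n) = 0"
proof -
  obtain a where a: "\<chi> a \<noteq> principal_char k a" using assms by auto
  have cop: "coprime a k" "\<chi> a \<noteq> 1"
    using a char_eq_0_iff[of a] by (auto simp: principal_char_def split: if_splits)
  have inj: "inj_on (\<lambda>n. a * n mod k) {..<k}"
  proof (rule inj_onI)
    fix x y assume xy: "x \<in> {..<k}" "y \<in> {..<k}" "a * x mod k = a * y mod k"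
    hence "[a * x = a * y] (mod k)" by (simp add: cong_def)
    hence "[x = y] (mod k)" using cop(1) by (simp add: cong_mult_lcancel_nat)
    thus "x = y" using xy by (simp add: cong_def)
  qed
  have "(\<lambda>n. a * n mod k) ` {..<k} = {..<k}"
    by (rule endo_inj_surj[OF _ _ inj]) (use k in auto)
  hence "(\<Sum>n<k. \<chi> n) = (\<Sum>n<k. \<chi> (a * n mod k))"
    using sum.reindex[OF inj, of \<chi>] by simp
  also have "\<dots> = (\<Sum>n<k. \<chi> (a * n))" by (intro sum.cong char_cong) (auto simp: cong_def)
  also have "\<dots> = \<chi> a * (\<Sum>n<k. \<chi> n)" by (simp add: char_mult sum_distrib_left)
  finally show ?thesis using cop(2) by simp
qed

text \<open>Full periods cancel; the induction strips one period at a time until fewer than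
  \<open>k\<close> terms of norm at most 1 remain.\<close>

lemma norm_sum_char_less:
  assumes "\<chi> \<noteq> principal_char k"
  shows "norm (\<Sum>n<N. \<chi> n) \<le> k"
proof (induction N rule: less_induct)
  case (less N)
  show ?case
  proof (cases "N < k")
    case True
    have "norm (\<Sum>n<N. \<chi> n) \<le> (\<Sum>n<N. 1)" by (rule sum_norm_le) (simp add: norm_char_le_1)
    thus ?thesis using True by simp
  next
    case False
    then obtain M where M: "N = k + M" using le_Suc_ex not_le by blast
    have "(\<Sum>n<N. \<chi> n) = (\<Sum>n<k. \<chi> n) + (\<Sum>n<M. \<chi> (k + n))"
      unfolding M by (induction M) auto
    also have "(\<Sum>n<M. \<chi> (k + n)) = (\<Sum>n<M. \<chi> n)"
      by (intro sum.cong char_cong) (auto simp: cong_def)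
    finally show ?thesis using less[of M] M k sum_char_mod_eq_0[OF assms] by simp
  qed
qed

text \<open>The factor 2 comes from subtracting two initial segments. Uniformity in both endpoints
  is what Abel summation asks for.\<close>

lemma norm_sum_char_le:
  assumes "\<chi> \<noteq> principal_char k"
  shows "norm (\<Sum>n=m..N. \<chi> n) \<le> 2 * k"
proof (cases "m \<le> N")
  case True
  have "(\<Sum>n<Suc N. \<chi> n) = sum \<chi> ({..<m} \<union> {m..N})"
    by (simp only: ivl_disj_un_one(4)[OF True] lessThan_Suc_atMost)
  also have "\<dots> = (\<Sum>n<m. \<chi> n) + (\<Sum>n=m..N. \<chi> n)"
    by (rule sum.union_disjoint) auto
  finally have "(\<Sum>n<Suc N. \<chi> n) = (\<Sum>n<m. \<chi> n) + (\<Sum>n=m..N. \<chi> n)" .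
  hence "(\<Sum>n=m..N. \<chi> n) = (\<Sum>n<Suc N. \<chi> n) - (\<Sum>n<m. \<chi> n)" by simp
  also have "norm \<dots> \<le> real k + real k"
    by (rule order.trans[OF norm_triangle_ineq4]) (intro add_mono norm_sum_char_less assms)
  finally show ?thesis by simp
qed auto

end

text \<open>A character is determined on one period, where its values are 0 or roots of unity of
  order dividing \<open>totient k\<close>.\<close>

lemma finite_dirichlet_chars:
  assumes k: "k > 0"
  shows "finite (dirichlet_chars k)"
proof -
  let ?V = "insert 0 {z::complex. z ^ totient k = 1}"
  have fin: "finite (PiE {..<k} (\<lambda>_. ?V))"
    using k finite_nth_roots[of "totient k" 1] by (intro finite_PiE) auto
  have inj: "inj_on (\<lambda>\<chi>. restrict \<chi> {..<k}) (dirichlet_chars k)"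
  proof (rule inj_onI, rule ext)
    fix \<chi> \<psi> n assume *: "\<chi> \<in> dirichlet_chars k" "\<psi> \<in> dirichlet_chars k"
      "restrict \<chi> {..<k} = restrict \<psi> {..<k}"
    have "\<chi> (n mod k) = \<psi> (n mod k)" using fun_cong[OF *(3), of "n mod k"] k by simp
    thus "\<chi> n = \<psi> n"
      using char_cong[OF k *(1), of "n mod k" n] char_cong[OF k *(2), of "n mod k" n]
      by (simp add: cong_def)
  qed
  have "(\<lambda>\<chi>. restrict \<chi> {..<k}) ` dirichlet_chars k \<subseteq> PiE {..<k} (\<lambda>_. ?V)"
    using char_root_of_unity[OF k] char_eq_0_iff[OF k] by (auto split: if_splits)
  thus ?thesis using finite_imageD[OF finite_subset[OF _ fin] inj] by blast
qed

section \<open>Extending characters from subgroups of the unit group\<close>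

definition partial_char :: "nat \<Rightarrow> nat set \<Rightarrow> (nat \<Rightarrow> complex) \<Rightarrow> bool" where
  "partial_char k S \<chi> \<longleftrightarrow> S \<subseteq> {n. coprime n k} \<and> 1 \<in> S \<and> (\<forall>m\<in>S. \<forall>n\<in>S. m * n \<in> S) \<and>
     (\<forall>m\<in>S. \<forall>n. [m = n] (mod k) \<longrightarrow> n \<in> S) \<and>
     \<chi> 1 = 1 \<and> (\<forall>m\<in>S. \<forall>n\<in>S. \<chi> (m * n) = \<chi> m * \<chi> n) \<and>
     (\<forall>m\<in>S. \<forall>n\<in>S. [m = n] (mod k) \<longrightarrow> \<chi> m = \<chi> n)"

text \<open>Cyclic extension step. \<open>S\<close> represents a subgroup of the units as a union of
  residue classes. If \<open>m\<close> is the least positive exponent with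
  \<open>g ^ m \<in> S\<close>, any \<open>z\<close> with \<open>z ^ m = \<chi> (g ^ m)\<close>
  yields an extension sending \<open>s * g ^ i\<close> to \<open>\<chi> s * z ^ i\<close>. As
  \<open>m\<close> is at least 2, \<open>z\<close> can be chosen different from 1, which later
  separates \<open>g\<close> from 1.\<close>

lemma partial_char_extend:
  fixes k :: nat
  assumes k: "k > 0" and pc: "partial_char k S \<chi>" and g: "coprime g k" "g \<notin> S"
  obtains T \<psi> where "partial_char k T \<psi>" "insert g S \<subseteq> T" "\<forall>n\<in>S. \<psi> n = \<chi> n" "\<psi> g \<noteq> 1"
proof -
  have S: "S \<subseteq> {n. coprime n k}" "1 \<in> S" "\<And>m n. m \<in> S \<Longrightarrow> n \<in> S \<Longrightarrow> m * n \<in> S"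
      "\<And>m n. m \<in> S \<Longrightarrow> [m = n] (mod k) \<Longrightarrow> n \<in> S"
    and \<chi>: "\<chi> 1 = (1::complex)" "\<And>m n. m \<in> S \<Longrightarrow> n \<in> S \<Longrightarrow> \<chi> (m * n) = \<chi> m * \<chi> n"
      "\<And>m n. m \<in> S \<Longrightarrow> n \<in> S \<Longrightarrow> [m = n] (mod k) \<Longrightarrow> \<chi> m = \<chi> n"
    using pc unfolding partial_char_def by blast+
  have totS: "\<exists>j>0. g ^ j \<in> S"
    using S(4)[OF S(2) cong_sym[OF euler_theorem[OF g(1)]]] k by (intro exI[of _ "totient k"]) auto
  \<comment> \<open>Closure under products already gives inverses:
    \<open>a ^ (totient k - 1)\<close> inverts \<open>a\<close> modulo \<open>k\<close>.\<close>
  have S_cancel: "b \<in> S" if "a \<in> S" "a * b \<in> S" for a b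
  proof -
    have "a ^ j \<in> S" for j by (induction j) (use S that in auto)
    hence "a ^ (totient k - 1) * (a * b) \<in> S" using S(3) that by blast
    moreover have "a ^ (totient k - 1) * (a * b) = a ^ totient k * b"
      using power_minus_mult[of "totient k" a] k by (simp add: mult.assoc[symmetric])
    moreover have "[a ^ totient k * b = 1 * b] (mod k)"
      using that S(1) by (intro cong_mult euler_theorem) auto
    ultimately show ?thesis using S(4)[of "a ^ totient k * b" b] by (metis mult_1)
  qed
  define m where "m = (LEAST j. j > 0 \<and> g ^ j \<in> S)"
  have m: "m > 0" "g ^ m \<in> S" using LeastI_ex[OF totS] unfolding m_def by auto
  have m_min: "m \<le> j" if "j > 0" "g ^ j \<in> S" for j
    unfolding m_def using that by (intro Least_le) auto
  \<comment> \<open>This is where \<open>g \<notin> S\<close> enters: a nonzero value then has at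
    least two \<open>m\<close>-th roots, so one differs from 1.\<close>
  have "m \<noteq> 1" using m(2) g(2) by auto
  have "\<exists>z. z ^ m = \<chi> (g ^ m) \<and> z \<noteq> 1"
  proof (cases "\<chi> (g ^ m) = 0")
    case True
    thus ?thesis using m(1) by (intro exI[of _ 0]) auto
  next
    case False
    hence "card {z. z ^ m = \<chi> (g ^ m)} = m" using card_nth_roots m(1) by blast
    hence "\<not> {z. z ^ m = \<chi> (g ^ m)} \<subseteq> {1}"
      using \<open>m \<noteq> 1\<close> m(1) by (metis card_1_singleton_iff card.empty less_numeral_extra(3) subset_singletonD One_nat_def)
    thus ?thesis by auto
  qed
  then obtain z where z: "z ^ m = \<chi> (g ^ m)" "z \<noteq> 1" by blast
  have gm: "g ^ (m * q) \<in> S \<and> \<chi> (g ^ (m * q)) = z ^ (m * q)" for q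
    by (induction q) (use S(2,3) \<chi>(1,2) m(2) z in \<open>auto simp: power_add\<close>)
  \<comment> \<open>The exponents that land in \<open>S\<close> are multiples of \<open>m\<close>:
    the remainder modulo \<open>m\<close> is one as well, and minimality makes it 0.\<close>
  have g_pow: "\<chi> (g ^ j) = z ^ j" if "g ^ j \<in> S" for j
  proof -
    have "g ^ (j mod m) \<in> S"
      using S_cancel[of "g ^ (m * (j div m))" "g ^ (j mod m)"] gm[of "j div m"] that
      by (simp flip: power_add)
    hence "j mod m = 0" using m_min[of "j mod m"] m(1) by (meson mod_less_divisor not_le neq0_conv)
    hence "j = m * (j div m)" by auto
    thus ?thesis using gm[of "j div m"] by simp
  qed
  \<comment> \<open>With \<open>i \<le> j\<close> the smaller power of \<open>g\<close> can be
    cancelled from the congruence, so no negative exponents arise.\<close>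
  have wd_aux: "\<chi> s * z ^ i = \<chi> t * z ^ j"
    if "s \<in> S" "t \<in> S" "[s * g ^ i = t * g ^ j] (mod k)" "i \<le> j" for s t i j
  proof -
    obtain d where d: "j = i + d" using \<open>i \<le> j\<close> le_Suc_ex by blast
    have "[g ^ i * s = g ^ i * (t * g ^ d)] (mod k)" using that(3) d by (simp add: power_add mult_ac)
    hence c: "[s = t * g ^ d] (mod k)" using g(1) by (simp add: cong_mult_lcancel_nat)
    hence "t * g ^ d \<in> S" using S(4) that(1) by blast
    hence gd: "g ^ d \<in> S" using S_cancel that(2) by blast
    have "\<chi> s = \<chi> t * z ^ d"
      using \<chi>(3)[OF that(1) \<open>t * g ^ d \<in> S\<close> c] \<chi>(2)[OF that(2) gd] g_pow[OF gd] by simp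
    thus ?thesis using d by (simp add: power_add)
  qed
  have wd: "\<chi> s * z ^ i = \<chi> t * z ^ j"
    if "s \<in> S" "t \<in> S" "[s * g ^ i = t * g ^ j] (mod k)" for s t i j
    using wd_aux[of s t i j] wd_aux[of t s j i] that by (metis cong_sym nle_le)
  define T where "T = {n. \<exists>s\<in>S. \<exists>i. [n = s * g ^ i] (mod k)}"
  define \<psi> where "\<psi> n = (THE v. \<exists>s\<in>S. \<exists>i. [n = s * g ^ i] (mod k) \<and> v = \<chi> s * z ^ i)" for n
  have \<psi>: "\<psi> n = \<chi> s * z ^ i" if "s \<in> S" "[n = s * g ^ i] (mod k)" for n s i
    unfolding \<psi>_def
  proof (rule the_equality)
    show "\<exists>s'\<in>S. \<exists>i'. [n = s' * g ^ i'] (mod k) \<and> \<chi> s * z ^ i = \<chi> s' * z ^ i'" using that by blast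
    fix v assume "\<exists>t\<in>S. \<exists>j. [n = t * g ^ j] (mod k) \<and> v = \<chi> t * z ^ j"
    then obtain t j where t: "t \<in> S" "[n = t * g ^ j] (mod k)" "v = \<chi> t * z ^ j" by blast
    have "[t * g ^ j = s * g ^ i] (mod k)" using cong_trans[OF cong_sym[OF t(2)] that(2)] .
    thus "v = \<chi> s * z ^ i" using wd[OF t(1) that(1)] t(3) by simp
  qed
  have ST: "s \<in> T" if "s \<in> S" for s
    unfolding T_def using that by (auto intro!: bexI[of _ s] exI[of _ 0])
  have gT: "g \<in> T" unfolding T_def using S(2) by (auto intro!: bexI[of _ 1] exI[of _ 1])
  have ext: "\<psi> n = \<chi> n" if "n \<in> S" for n
    using \<psi>[OF that, of n 0] by simp
  have cop: "coprime n k" if "n \<in> T" for n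
  proof -
    obtain s i where si: "s \<in> S" "[n = s * g ^ i] (mod k)" using \<open>n \<in> T\<close> unfolding T_def by auto
    have "coprime (s * g ^ i) k" using S(1) g(1) si(1) by auto
    thus ?thesis using si(2) cong_imp_coprime cong_sym by blast
  qed
  have sat: "n \<in> T" if "m \<in> T" "[m = n] (mod k)" for m n
  proof -
    obtain s i where si: "s \<in> S" "[m = s * g ^ i] (mod k)" using \<open>m \<in> T\<close> unfolding T_def by auto
    have "[n = s * g ^ i] (mod k)" using cong_trans[OF cong_sym[OF that(2)] si(2)] .
    thus ?thesis unfolding T_def using si(1) by blast
  qed
  have \<psi>_cong: "\<psi> m = \<psi> n" if "m \<in> T" "[m = n] (mod k)" for m n
  proof -
    obtain s i where si: "s \<in> S" "[m = s * g ^ i] (mod k)" using \<open>m \<in> T\<close> unfolding T_def by auto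
    have "[n = s * g ^ i] (mod k)" using si(2) that(2) cong_sym cong_trans by blast
    thus ?thesis using \<psi>[OF si] \<psi>[OF si(1)] by simp
  qed
  have mult: "m * n \<in> T \<and> \<psi> (m * n) = \<psi> m * \<psi> n" if "m \<in> T" "n \<in> T" for m n
  proof -
    obtain s i where si: "s \<in> S" "[m = s * g ^ i] (mod k)" using \<open>m \<in> T\<close> unfolding T_def by auto
    obtain t j where tj: "t \<in> S" "[n = t * g ^ j] (mod k)" using \<open>n \<in> T\<close> unfolding T_def by auto
    note st = si tj
    have st': "[m * n = (s * t) * g ^ (i + j)] (mod k)"
      using cong_mult[OF st(2,4)] by (simp add: power_add mult_ac)
    have "m * n \<in> T" unfolding T_def using S(3) st st' by blast
    thus ?thesis
      using \<psi>[OF st(1,2)] \<psi>[OF st(3,4)] \<psi>[OF S(3)[OF st(1,3)] st'] \<chi>(2)[OF st(1,3)]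
      by (simp add: power_add)
  qed
  show ?thesis
  proof (rule that[of T \<psi>])
    show "partial_char k T \<psi>"
      unfolding partial_char_def using ST[OF S(2)] ext[OF S(2)] \<chi>(1) cop sat \<psi>_cong mult
      by (intro conjI ballI allI impI subsetI) simp_all
    show "insert g S \<subseteq> T" using ST gT by auto
    show "\<psi> g \<noteq> 1" using \<psi>[OF S(2), of g 1] \<chi>(1) z(2) by simp
  qed (use ext in auto)
qed

text \<open>Adjoin missing units one by one; the induction counts residues below \<open>k\<close>
  outside \<open>S\<close>. Once \<open>S\<close> contains all units, the function is cut off to 0
  elsewhere, which fixes the values that \<open>partial_char\<close> leaves unspecified.\<close>

lemma partial_char_imp_dirichlet_char:
  assumes k: "k > 0" and "partial_char k S \<chi>"
  shows "\<exists>\<psi>\<in>dirichlet_chars k. \<forall>n\<in>S. \<psi> n = \<chi> n"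
  using assms(2)
proof (induction "card ({..<k} - S)" arbitrary: S \<chi> rule: less_induct)
  case less
  show ?case
  proof (cases "\<exists>g. coprime g k \<and> g \<notin> S")
    case True
    then obtain g where g: "coprime g k" "g \<notin> S" by blast
    obtain T \<psi> where T: "partial_char k T \<psi>" "insert g S \<subseteq> T" "\<forall>n\<in>S. \<psi> n = \<chi> n"
        "\<psi> g \<noteq> 1"
      by (rule partial_char_extend[OF k less(2) g])
    have sat: "n \<in> U" if "partial_char k U \<phi>" "m \<in> U" "m mod k = n mod k" for U \<phi> m n
    proof -
      have "\<forall>m\<in>U. \<forall>n. [m = n] (mod k) \<longrightarrow> n \<in> U" using that(1) unfolding partial_char_def by (elim conjE)
      thus ?thesis using that(2,3) by (simp add: cong_def)
    qed
    \<comment> \<open>\<open>g\<close> may exceed \<open>k\<close>, so its reduced representative is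
      the one that witnesses the strict decrease.\<close>
    have "g mod k \<notin> S" using sat[OF less(2), of "g mod k" g] g(2) by auto
    moreover have "g mod k \<in> T" using sat[OF T(1), of g "g mod k"] T(2) by auto
    moreover have "g mod k < k" using k by simp
    ultimately have "{..<k} - T \<subset> {..<k} - S" using T(2) by blast
    hence "card ({..<k} - T) < card ({..<k} - S)" by (intro psubset_card_mono) auto
    from less(1)[OF this T(1)] obtain \<phi> where \<phi>: "\<phi> \<in> dirichlet_chars k" "\<forall>n\<in>T. \<phi> n = \<psi> n" by blast
    have "\<phi> n = \<chi> n" if "n \<in> S" for n using bspec[OF \<phi>(2), of n] T(2) bspec[OF T(3) that] that by auto
    thus ?thesis using \<phi>(1) by blast
  next
    case False
    moreover have "S \<subseteq> {n. coprime n k}" using less(2) unfolding partial_char_def by (elim conjE)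
    ultimately have S: "n \<in> S \<longleftrightarrow> coprime n k" for n by auto
    have pc: "\<chi> 1 = 1" "\<And>m n. m \<in> S \<Longrightarrow> n \<in> S \<Longrightarrow> \<chi> (m * n) = \<chi> m * \<chi> n"
      "\<And>m n. m \<in> S \<Longrightarrow> n \<in> S \<Longrightarrow> [m = n] (mod k) \<Longrightarrow> \<chi> m = \<chi> n"
      using less(2) unfolding partial_char_def by blast+
    have nz: "\<chi> a \<noteq> 0" if "coprime a k" for a
    proof -
      have "\<chi> (a ^ j) = \<chi> a ^ j" for j by (induction j) (use S that pc(1,2) in auto)
      moreover have "\<chi> (a ^ totient k) = \<chi> 1"
        by (rule pc(3)) (use that S euler_theorem[OF that] in simp_all)
      ultimately have "\<chi> a ^ totient k = 1" using pc(1) by simp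
      thus ?thesis using k by (auto simp: power_0_left)
    qed
    have cc: "coprime m k \<longleftrightarrow> coprime n k" if "[m = n] (mod k)" for m n
      using cong_imp_coprime[OF that] cong_imp_coprime[OF cong_sym[OF that]] by blast
    have "(\<lambda>n. if coprime n k then \<chi> n else 0) \<in> dirichlet_chars k"
      unfolding dirichlet_chars_def mem_Collect_eq
    proof (intro conjI allI impI)
      fix m n assume *: "[m = n] (mod k)"
      show "(if coprime m k then \<chi> m else 0) = (if coprime n k then \<chi> n else 0)"
        using cc[OF *] pc(3)[OF _ _ *] S by simp
    qed (use pc(2) S nz in simp_all)
    thus ?thesis by (rule bexI[rotated]) (use S in simp)
  qed
qed

text \<open>Start from the trivial character on the class of 1 and adjoin \<open>a\<close> first,
  with a value other than 1.\<close>

lemma separating_char_exists: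
  assumes k: "k > 0" and a: "coprime a k" "\<not> [a = 1] (mod k)"
  shows "\<exists>\<chi>\<in>dirichlet_chars k. \<chi> a \<noteq> 1"
proof -
  have pc: "partial_char k {n. [n = 1] (mod k)} (\<lambda>_. 1)"
    unfolding partial_char_def mem_Collect_eq
  proof (intro conjI ballI allI impI subsetI, goal_cases)
    case (1 x)
    thus ?case using cong_imp_coprime[OF cong_sym, of x 1 k] by simp
  next
    case (3 m n)
    thus ?case using cong_mult[of m 1 k n 1] by simp
  next
    case (4 m n)
    hence "[n = m] (mod k)" "[m = 1] (mod k)" by (simp_all add: cong_sym)
    thus ?case using cong_trans by blast
  qed simp_all
  have nin: "a \<notin> {n. [n = 1] (mod k)}" using a(2) by simp
  obtain T \<psi> where T: "partial_char k T \<psi>" "insert a {n. [n = 1] (mod k)} \<subseteq> T" "\<psi> a \<noteq> 1"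
    by (rule partial_char_extend[OF k pc a(1) nin])
  obtain \<chi> where "\<chi> \<in> dirichlet_chars k" "\<forall>n\<in>T. \<chi> n = \<psi> n"
    using partial_char_imp_dirichlet_char[OF k T(1)] by blast
  thus ?thesis using T(2,3) by (intro bexI[of _ \<chi>]) auto
qed

text \<open>Multiplying by a character that separates \<open>a\<close> from 1 permutes the set of
  characters. The number of characters is left as a cardinality because it only serves as a
  nonnegative factor.\<close>

lemma sum_dirichlet_chars:
  assumes k: "k > 0"
  shows "(\<Sum>\<chi>\<in>dirichlet_chars k. \<chi> a) = (if [a = 1] (mod k) then of_nat (card (dirichlet_chars k)) else 0)"
proof (cases "coprime a k \<and> \<not> [a = 1] (mod k)")
  case True
  then obtain \<psi> where \<psi>: "\<psi> \<in> dirichlet_chars k" "\<psi> a \<noteq> 1" using separating_char_exists[OF k] by blast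
  let ?f = "\<lambda>\<chi> n. \<psi> n * \<chi> n"
  have closed: "?f \<chi> \<in> dirichlet_chars k" if "\<chi> \<in> dirichlet_chars k" for \<chi>
    unfolding dirichlet_chars_def mem_Collect_eq
  proof (intro conjI allI impI)
    fix m n assume "[m = n] (mod k)"
    thus "\<psi> m * \<chi> m = \<psi> n * \<chi> n" using char_cong[OF k that] char_cong[OF k \<psi>(1)] by metis
  qed (simp_all add: char_eq_0_iff[OF k that] char_eq_0_iff[OF k \<psi>(1)] char_mult[OF k that] char_mult[OF k \<psi>(1)])
  have inj: "inj_on ?f (dirichlet_chars k)"
  proof (rule inj_onI, rule ext)
    fix \<chi> \<chi>' n assume *: "\<chi> \<in> dirichlet_chars k" "\<chi>' \<in> dirichlet_chars k" "?f \<chi> = ?f \<chi>'"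
    show "\<chi> n = \<chi>' n"
      using fun_cong[OF *(3), of n] char_eq_0_iff[OF k \<psi>(1), of n] char_eq_0_iff[OF k *(1), of n]
        char_eq_0_iff[OF k *(2), of n] by auto
  qed
  have "?f ` dirichlet_chars k = dirichlet_chars k"
    by (rule endo_inj_surj[OF finite_dirichlet_chars[OF k] _ inj]) (use closed in auto)
  hence "(\<Sum>\<chi>\<in>dirichlet_chars k. \<chi> a) = (\<Sum>\<chi>\<in>dirichlet_chars k. \<psi> a * \<chi> a)"
    using sum.reindex[OF inj, of "\<lambda>\<chi>. \<chi> a"] by simp
  thus ?thesis using \<psi>(2) True by (simp flip: sum_distrib_left)
next
  case False
  show ?thesis
  proof (cases "[a = 1] (mod k)")
    case True
    have "(\<Sum>\<chi>\<in>dirichlet_chars k. \<chi> a) = (\<Sum>\<chi>\<in>dirichlet_chars k. 1)"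
      by (intro sum.cong refl) (metis True char_cong[OF k] char_1[OF k] One_nat_def)
    thus ?thesis using True by simp
  next
    case False': False
    have "(\<Sum>\<chi>\<in>dirichlet_chars k. \<chi> a) = 0"
      using char_eq_0_iff[OF k, of _ a] False False' by (intro sum.neutral) auto
    thus ?thesis using False' by simp
  qed
qed

section \<open>Sums over divisors and Chebyshev-type estimates\<close>

text \<open>Abel summation: the weight increments telescope to \<open>g m - g N\<close>, and the
  boundary term supplies the missing \<open>g N\<close>. The bound depends only on the first weight,
  hence is uniform in \<open>N\<close>.\<close>

lemma norm_sum_antimono_le:
  fixes f :: "nat \<Rightarrow> complex" and g :: "nat \<Rightarrow> real"
  assumes B: "\<And>j. norm (\<Sum>n=m..j. f n) \<le> B"
    and dec: "\<And>n. n \<ge> m \<Longrightarrow> g (Suc n) \<le> g n" and nonneg: "\<And>n. n \<ge> m \<Longrightarrow> g n \<ge> 0"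
  shows "norm (\<Sum>n=m..N. f n * of_real (g n)) \<le> B * g m"
proof (cases "m \<le> N")
  case False
  have "B \<ge> 0" using B[of 0] norm_ge_zero order_trans by blast
  thus ?thesis using False nonneg[of m] by simp
next
  case True
  have B0: "B \<ge> 0" using B[of 0] norm_ge_zero order_trans by blast
  define F where "F j = (\<Sum>n=m..j. f n)" for j
  have eq: "(\<Sum>n=m..N. f n * of_real (g n)) = F N * of_real (g N) + (\<Sum>n=m..<N. F n * of_real (g n - g (Suc n)))"
    using True
  proof (induction N rule: dec_induct)
    case base
    thus ?case by (simp add: F_def)
  next
    case (step N)
    have "F (Suc N) = F N + f (Suc N)" using step(1) by (simp add: F_def)
    thus ?case using step by (simp add: algebra_simps)
  qed
  have "norm (\<Sum>n=m..<N. F n * of_real (g n - g (Suc n))) \<le> (\<Sum>n=m..<N. B * (g n - g (Suc n)))"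
    using B dec B0 unfolding F_def
    by (intro sum_norm_le) (auto simp: norm_mult simp del: of_real_diff intro!: mult_mono)
  also have "\<dots> = B * (g m - g N)"
    using sum_Suc_diff'[OF True, of "\<lambda>n. - g n"] by (simp add: sum_distrib_left[symmetric])
  finally have 1: "norm (\<Sum>n=m..<N. F n * of_real (g n - g (Suc n))) \<le> B * (g m - g N)" .
  have 2: "norm (F N * of_real (g N)) \<le> B * g N"
    using B nonneg[OF True] unfolding F_def by (auto simp: norm_mult intro!: mult_right_mono)
  have "norm (\<Sum>n=m..N. f n * of_real (g n)) \<le> B * g N + B * (g m - g N)"
    unfolding eq by (rule order.trans[OF norm_triangle_ineq add_mono[OF 2 1]])
  thus ?thesis by (simp add: algebra_simps)
qed

lemma sum_sum_divisors:
  fixes F :: "nat \<Rightarrow> nat \<Rightarrow> 'a :: comm_monoid_add"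
  shows "(\<Sum>n=1..N. \<Sum>d | d dvd n. F d (n div d)) = (\<Sum>d=1..N. \<Sum>j=1..N div d. F d j)"
proof -
  have "(\<Sum>n=1..N. \<Sum>d | d dvd n. F d (n div d)) = (\<Sum>(n, d)\<in>(SIGMA n:{1..N}. {d. d dvd n}). F d (n div d))"
    by (rule sum.Sigma) auto
  also have "\<dots> = (\<Sum>(d, j)\<in>(SIGMA d:{1..N}. {1..N div d}). F d j)"
  proof (rule sum.reindex_bij_witness[where i = "\<lambda>(d, j). (d * j, d)" and j = "\<lambda>(n, d). (d, n div d)"], goal_cases)
    case (2 x)
    then obtain n d where x: "x = (n, d)" "n \<in> {1..N}" "d dvd n" by auto
    have "d \<le> n" "d \<ge> 1" using x by (auto simp: dvd_imp_le Suc_le_eq intro: Nat.gr0I)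
    moreover have "n div d \<le> N div d" using x by (intro div_le_mono) auto
    moreover have "n div d \<ge> 1" using x \<open>d \<le> n\<close> \<open>d \<ge> 1\<close> by (simp add: Suc_le_eq div_greater_zero_iff)
    ultimately show ?case using x by auto
  next
    case (4 x)
    then obtain d j where x: "x = (d, j)" "d \<in> {1..N}" "j \<in> {1..N div d}" by auto
    have "d * j \<le> d * (N div d)" using x by simp
    also have "\<dots> \<le> N" by simp
    finally have "d * j \<le> N" .
    moreover have "d * j \<ge> 1" using x by (simp add: Suc_le_eq)
    ultimately show ?case using x by auto
  qed auto
  also have "\<dots> = (\<Sum>d=1..N. \<Sum>j=1..N div d. F d j)"
    by (rule sum.Sigma[symmetric]) auto
  finally show ?thesis .
qed

text \<open>Both sides run over the pairs with \<open>d * e\<close> dividing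
  \<open>n\<close>.\<close>

lemma sum_divisors_double_swap:
  fixes F :: "nat \<Rightarrow> nat \<Rightarrow> 'a :: comm_monoid_add"
  assumes "n > 0"
  shows "(\<Sum>d | d dvd n. \<Sum>e | e dvd n div d. F d e) = (\<Sum>e | e dvd n. \<Sum>d | d dvd n div e. F d e)"
proof -
  have fin: "finite {d. d dvd n}" "finite {d. d dvd n div e}" if "e dvd n" for e
    using assms that by (auto simp: dvd_div_eq_0_iff)
  have dm: "d dvd n \<and> e dvd n div d \<longleftrightarrow> d * e dvd n" for d e
  proof (cases "d dvd n")
    case True
    hence "d \<noteq> 0" using assms by auto
    thus ?thesis using True dvd_div_iff_mult[of d n e] by (simp add: mult.commute)
  qed (auto dest: dvd_mult_left)
  have *: "d dvd n \<and> e dvd n div d \<longleftrightarrow> e dvd n \<and> d dvd n div e" for d e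
    unfolding dm by (simp add: mult.commute)
  have "(\<Sum>d | d dvd n. \<Sum>e | e dvd n div d. F d e) = (\<Sum>(d, e)\<in>(SIGMA d:{d. d dvd n}. {e. e dvd n div d}). F d e)"
    by (rule sum.Sigma) (use fin in auto)
  also have "\<dots> = (\<Sum>(e, d)\<in>(SIGMA e:{e. e dvd n}. {d. d dvd n div e}). F d e)"
    by (rule sum.reindex_bij_witness[where i = prod.swap and j = prod.swap]) (use * in auto)
  also have "\<dots> = (\<Sum>e | e dvd n. \<Sum>d | d dvd n div e. F d e)"
    by (rule sum.Sigma[symmetric]) (use fin in auto)
  finally show ?thesis .
qed

section \<open>The Moebius function and its inversion identities\<close>

definition mobius :: "nat \<Rightarrow> real" where
  "mobius n = (if squarefree n then (-1) ^ card (prime_factors n) else 0)"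

lemma abs_mobius_le_1: "\<bar>mobius n\<bar> \<le> 1"
  by (simp add: mobius_def power_abs)

lemma mobius_prime_mult:
  assumes p: "Factorial_Ring.prime p" "\<not> p dvd n"
  shows "mobius (p * n) = - mobius n"
proof -
  have n: "n > 0" using p by (intro Nat.gr0I) auto
  have cop: "coprime p n" using p prime_imp_coprime by blast
  have "squarefree (p * n) \<longleftrightarrow> squarefree n"
    using squarefree_mult_coprime[OF cop] squarefree_prime[OF p(1)] squarefree_mono[of n "p * n"] by auto
  moreover have "prime_factors (p * n) = insert p (prime_factors n)"
    using p n by (auto simp: prime_factors_product prime_prime_factors)
  moreover have "p \<notin> prime_factors n" using p by auto
  ultimately show ?thesis by (simp add: mobius_def)
qed

text \<open>Fix a prime \<open>p\<close> dividing \<open>n\<close>. Divisors \<open>d\<close> prime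
  to \<open>p\<close> cancel against \<open>p * d\<close>; the remaining ones are divisible by the
  square of \<open>p\<close> and contribute 0.\<close>

lemma sum_mobius_divisors:
  assumes "n > 0"
  shows "(\<Sum>d | d dvd n. mobius d) = (if n = 1 then 1 else 0)"
proof (cases "n = 1")
  case True
  thus ?thesis by (simp add: mobius_def)
next
  case False
  then obtain p where p: "Factorial_Ring.prime p" "p dvd n" using prime_factor_nat by blast
  have p0: "p > 0" using p(1) prime_gt_0_nat by blast
  let ?A = "{d. d dvd n \<and> \<not> p dvd d}" and ?B = "{d. d dvd n \<and> p dvd d}"
  have fin: "finite {d. d dvd n}" using assms by simp
  have AB: "{d. d dvd n} = ?A \<union> ?B" by auto
  have finA: "finite ?A" and finB: "finite ?B" using fin unfolding AB by auto
  have "(\<Sum>d | d dvd n. mobius d) = sum mobius ?A + sum mobius ?B"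
    unfolding AB by (rule sum.union_disjoint) (use finA finB in auto)
  also have "sum mobius ?B = sum mobius ((*) p ` ?A)"
  proof (rule sum.mono_neutral_right)
    show "(*) p ` ?A \<subseteq> ?B"
    proof safe
      fix d assume d: "d dvd n" "\<not> p dvd d"
      have "coprime p d" using p(1) d(2) prime_imp_coprime by blast
      thus "p * d dvd n" using d p(2) divides_mult by blast
    qed auto
    show "\<forall>d\<in>?B - (*) p ` ?A. mobius d = 0"
    proof
      fix d assume d: "d \<in> ?B - (*) p ` ?A"
      then obtain e where e: "d = p * e" "d dvd n" by auto
      hence "p dvd e" using d by (auto dest: dvd_mult_right)
      hence "p\<^sup>2 dvd d" using e by (simp add: power2_eq_square)
      hence "\<not> squarefree d" using p(1) unfolding squarefree_def by auto
      thus "mobius d = 0" by (simp add: mobius_def)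
    qed
  qed (use finB in auto)
  also have "\<dots> = (\<Sum>d\<in>?A. mobius (p * d))"
    using p0 by (subst sum.reindex) (auto simp: inj_on_def)
  also have "\<dots> = - sum mobius ?A"
    unfolding sum_negf[symmetric] using mobius_prime_mult[OF p(1)] by (intro sum.cong) auto
  finally show ?thesis using False by simp
qed

text \<open>Expanding \<open>ln (n div d)\<close> into values of \<open>mangoldt\<close> and
  swapping the sums leaves only \<open>mangoldt n\<close>. Then \<open>ln n - ln d\<close> is
  substituted; the \<open>ln n\<close> part vanishes, since either the Moebius sum or, for
  \<open>n = 1\<close>, the logarithm is 0.\<close>

lemma sum_mobius_ln:
  assumes n: "n > 0"
  shows "(\<Sum>d | d dvd n. mobius d * ln (real d)) = - mangoldt n"
proof -
  have "(\<Sum>d | d dvd n. mobius d * ln (real (n div d))) = (\<Sum>d | d dvd n. \<Sum>e | e dvd n div d. mobius d * mangoldt e)"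
  proof (rule sum.cong, rule refl)
    fix d assume "d \<in> {d. d dvd n}"
    hence "n div d > 0" using n by (auto simp: dvd_div_eq_0_iff intro: Nat.gr0I)
    thus "mobius d * ln (real (n div d)) = (\<Sum>e | e dvd n div d. mobius d * mangoldt e)"
      using mangoldt_sum[of "n div d", where ?'a = real] by (simp add: sum_distrib_left[symmetric])
  qed
  also have "\<dots> = (\<Sum>e | e dvd n. \<Sum>d | d dvd n div e. mobius d * mangoldt e)"
    by (rule sum_divisors_double_swap[OF n])
  also have "\<dots> = (\<Sum>e | e dvd n. if e = n then mangoldt n else 0)"
  proof (rule sum.cong, rule refl)
    fix e assume e: "e \<in> {e. e dvd n}"
    hence "n div e > 0" using n by (auto simp: dvd_div_eq_0_iff intro: Nat.gr0I)
    moreover have "n div e = 1 \<longleftrightarrow> e = n" using e n by (auto simp: dvd_div_eq_1 elim!: dvdE)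
    ultimately show "(\<Sum>d | d dvd n div e. mobius d * mangoldt e) = (if e = n then mangoldt n else 0)"
      using sum_mobius_divisors[of "n div e"] by (simp add: sum_distrib_right[symmetric])
  qed
  also have "\<dots> = mangoldt n" using n by simp
  finally have 1: "(\<Sum>d | d dvd n. mobius d * ln (real (n div d))) = mangoldt n" .
  have "(\<Sum>d | d dvd n. mobius d * ln (real (n div d))) = (\<Sum>d | d dvd n. mobius d * ln (real n) - mobius d * ln (real d))"
  proof (rule sum.cong, rule refl)
    fix d assume d: "d \<in> {d. d dvd n}"
    hence "d > 0" using n by (auto intro: Nat.gr0I)
    thus "mobius d * ln (real (n div d)) = mobius d * ln (real n) - mobius d * ln (real d)"
      using d n by (simp add: real_of_nat_div ln_div right_diff_distrib)
  qed
  also have "\<dots> = (\<Sum>d | d dvd n. mobius d) * ln n - (\<Sum>d | d dvd n. mobius d * ln (real d))"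
    by (simp add: sum_subtractf sum_distrib_right)
  also have "(\<Sum>d | d dvd n. mobius d) * ln n = 0" using sum_mobius_divisors[OF n] by simp
  finally show ?thesis using 1 by simp
qed

section \<open>Chebyshev and Mertens estimates for the von Mangoldt function\<close>

lemma ln_fact_eq_sum: "ln (fact N :: real) = (\<Sum>n=1..N. ln (real n))"
  by (induction N) (auto simp: ln_mult)

text \<open>Legendre's formula in logarithmic form: \<open>d\<close> divides exactly
  \<open>N div d\<close> of the numbers up to \<open>N\<close>.\<close>

lemma ln_fact_eq_sum_mangoldt: "ln (fact N) = (\<Sum>d=1..N. mangoldt d * real (N div d))"
proof -
  have "ln (fact N :: real) = (\<Sum>n=1..N. ln (real n))" by (rule ln_fact_eq_sum)
  also have "\<dots> = (\<Sum>n=1..N. \<Sum>d | d dvd n. mangoldt d)"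
    by (intro sum.cong) (auto simp: mangoldt_sum)
  also have "\<dots> = (\<Sum>d=1..N. mangoldt d * real (N div d))"
    using sum_sum_divisors[of "\<lambda>d _. mangoldt d :: real" N] by (simp add: mult.commute)
  finally show ?thesis .
qed

lemma ln_fact_ge: "N > 0 \<Longrightarrow> ln (fact N) \<ge> real N * ln N - N"
proof (induction N rule: nat_induct_non_zero)
  case (Suc N)
  have "1 + 1 / N = real (Suc N) / real N" using Suc by (simp add: field_simps)
  hence "ln (real (Suc N)) - ln N = ln (1 + 1 / N)" using Suc by (simp add: ln_div)
  also have "\<dots> \<le> 1 / N" using Suc by (intro ln_add_one_self_le_self) auto
  finally have 1: "real N * (ln (real (Suc N)) - ln N) \<le> 1"
    using Suc by (simp add: field_simps)
  have 2: "ln (fact (Suc N) :: real) = ln (real (Suc N)) + ln (fact N)"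
    unfolding fact_Suc by (subst ln_mult) auto
  have "(1 + n) * x - (1 + n) \<le> x + F" if "n * (x - y) \<le> 1" "n * y - n \<le> F"
    for n x y F :: real using that by (simp add: algebra_simps)
  from this[OF 1 Suc.IH] show ?case unfolding 2 by (simp only: of_nat_Suc)
qed auto

lemma ln_fact_le: "N > 0 \<Longrightarrow> ln (fact N) \<le> real N * ln N"
proof -
  assume N: "N > 0"
  have "(fact N :: real) \<le> real N ^ N" using fact_le_power[of N, where ?'a = real] by simp
  hence "ln (fact N :: real) \<le> ln (real N ^ N)" using N by (subst ln_le_cancel_iff) auto
  thus ?thesis using N by (simp add: ln_realpow)
qed

definition cheb_psi :: "nat \<Rightarrow> real" where
  "cheb_psi N = (\<Sum>n=1..N. mangoldt n)"

text \<open>Chebyshev's argument: the coefficient \<open>2 * M div d - 2 * (M div d)\<close> is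
  nonnegative and at least 1 for \<open>M < d \<le> 2 * M\<close>, while the sum with these
  coefficients is the logarithm of the central binomial coefficient. The constant 2 rounds up ln
  4.\<close>

lemma cheb_psi_double: "cheb_psi (2 * M) \<le> cheb_psi M + 2 * M"
proof -
  have "cheb_psi (2 * M) - cheb_psi M = (\<Sum>d\<in>{1..2*M} - {1..M}. mangoldt d)"
    unfolding cheb_psi_def by (subst sum_diff) auto
  also have "\<dots> \<le> (\<Sum>d=1..2*M. mangoldt d * real (2 * M div d - 2 * (M div d)))"
  proof (rule order.trans[OF _ sum_mono2])
    show "(\<Sum>d\<in>{1..2*M} - {1..M}. mangoldt d :: real)
        \<le> (\<Sum>d\<in>{1..2*M} - {1..M}. mangoldt d * real (2 * M div d - 2 * (M div d)))"
    proof (rule sum_mono)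
      fix d assume d: "d \<in> {1..2*M} - {1..M}"
      hence "2 * M div d \<ge> 1" "M div d = 0" by (auto simp: Suc_le_eq div_greater_zero_iff)
      thus "(mangoldt d :: real) \<le> mangoldt d * real (2 * M div d - 2 * (M div d))"
        using mangoldt_nonneg[of d] by (simp add: mult_le_cancel_left1)
    qed
  qed (auto intro!: mult_nonneg_nonneg mangoldt_nonneg)
  also have "\<dots> = (\<Sum>d=1..2*M. mangoldt d * real (2 * M div d)) - 2 * (\<Sum>d=1..2*M. mangoldt d * real (M div d))"
  proof -
    have "2 * (M div d) \<le> 2 * M div d" for d
    proof (cases "d = 0")
      case False
      thus ?thesis using div_times_less_eq_dividend[of M d] by (simp add: less_eq_div_iff_mult_less_eq)
    qed simp
    hence "mangoldt d * real (2 * M div d - 2 * (M div d)) =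
        mangoldt d * real (2 * M div d) - 2 * (mangoldt d * real (M div d))" for d
      by (subst of_nat_diff) (auto simp: algebra_simps)
    thus ?thesis by (simp only: sum_subtractf sum_distrib_left)
  qed
  also have "(\<Sum>d=1..2*M. mangoldt d * real (M div d)) = (\<Sum>d=1..M. mangoldt d * real (M div d))"
    by (rule sum.mono_neutral_right) auto
  also have "(\<Sum>d=1..2*M. mangoldt d * real (2 * M div d)) - 2 * (\<Sum>d=1..M. mangoldt d * real (M div d))
      = ln (fact (2 * M)) - 2 * ln (fact M)"
    by (simp add: ln_fact_eq_sum_mangoldt)
  also have "\<dots> = ln (real ((2 * M) choose M))"
  proof -
    have "real ((2 * M) choose M) = fact (2 * M) / (fact M * fact M)"
      using binomial_fact[of M "2 * M", where ?'a = real] by simp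
    hence "ln (real ((2 * M) choose M)) = ln (fact (2 * M)) - ln (fact M * fact M)"
      by (simp only: ln_divide_pos fact_gt_zero mult_pos_pos)
    also have "ln (fact M * fact M :: real) = 2 * ln (fact M)" by (simp add: ln_mult)
    finally show ?thesis by (rule sym)
  qed
  also have "\<dots> \<le> ln (4 ^ M)"
  proof -
    have "real ((2 * M) choose M) \<le> real (2 ^ (2 * M))"
      unfolding of_nat_le_iff by (rule binomial_le_pow2)
    hence "real ((2 * M) choose M) \<le> 4 ^ M" by (simp add: power_mult)
    moreover have "real ((2 * M) choose M) > 0" by simp
    ultimately show ?thesis by (intro ln_mono) auto
  qed
  also have "\<dots> = M * (2 * ln 2)" using ln_realpow[of 2 2] by (simp add: ln_realpow)
  also have "\<dots> \<le> real M * (2 * 1)" using ln_2_less_1 by (intro mult_left_mono) auto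
  finally show ?thesis by simp
qed

text \<open>With \<open>M = N div 2\<close>, the constant 4 splits as 2 + 1 + 1: the induction
  hypothesis costs \<open>4 * M\<close>, at most \<open>2 * N\<close>; doubling costs
  \<open>2 * M\<close>, at most \<open>N\<close>; a last odd term costs \<open>ln N\<close>, at most
  \<open>N\<close>.\<close>

lemma cheb_psi_le: "cheb_psi N \<le> 4 * N"
proof (induction N rule: less_induct)
  case (less N)
  show ?case
  proof (cases "N = 0")
    case True thus ?thesis by (simp add: cheb_psi_def)
  next
    case False
    define M where "M = N div 2"
    have M: "cheb_psi M \<le> 4 * M" using less[of M] False by (simp add: M_def)
    have "cheb_psi N \<le> cheb_psi (2 * M) + real N"
    proof (cases "even N")
      case True
      thus ?thesis by (simp add: M_def)
    next
      case odd: False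
      hence "N = Suc (2 * M)" by (simp add: M_def)
      hence "cheb_psi N = cheb_psi (2 * M) + mangoldt N" by (simp add: cheb_psi_def)
      moreover have "mangoldt N \<le> ln (real N)" using False by (intro mangoldt_le) auto
      moreover have "ln (real N) \<le> N" using False ln_le_minus_one[of "real N"] by simp
      ultimately show ?thesis by linarith
    qed
    moreover have "2 * real M \<le> N" unfolding M_def by linarith
    ultimately show ?thesis using M cheb_psi_double[of M] by linarith
  qed
qed

text \<open>Mertens' estimate, from Legendre's formula with \<open>N div n\<close> replaced by
  \<open>N / n\<close>. Each replacement errs by at most 1, so the total error is at most
  \<open>cheb_psi N\<close>, which is linear in \<open>N\<close>.\<close>

lemma sum_mangoldt_div_bounds:
  assumes N: "N > 0"
  shows "(\<Sum>n=1..N. mangoldt n / real n) \<ge> ln N - 1" "(\<Sum>n=1..N. mangoldt n / real n) \<le> ln N + 4"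
proof -
  have dv: "real (N div d) \<le> N / d" "real N / d \<le> real (N div d) + 1" for d
    using floor_divide_of_nat_eq[of N d, where ?'a = real] by linarith+
  have "real N * ln N - N \<le> ln (fact N)" by (rule ln_fact_ge[OF N])
  also have "\<dots> \<le> (\<Sum>n=1..N. mangoldt n * (N / n))" unfolding ln_fact_eq_sum_mangoldt
    by (intro sum_mono mult_left_mono dv mangoldt_nonneg)
  also have "\<dots> = N * (\<Sum>n=1..N. mangoldt n / real n)" by (simp add: sum_distrib_left mult_ac)
  finally have "N * (ln N - 1) \<le> N * (\<Sum>n=1..N. mangoldt n / real n)" by (simp add: algebra_simps)
  thus "(\<Sum>n=1..N. mangoldt n / real n) \<ge> ln N - 1" using N by simp
  have "N * (\<Sum>n=1..N. mangoldt n / real n) = (\<Sum>n=1..N. mangoldt n * (N / n))"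
    by (simp add: sum_distrib_left mult_ac)
  also have "\<dots> \<le> (\<Sum>n=1..N. mangoldt n * (real (N div n) + 1))"
    by (intro sum_mono mult_left_mono dv mangoldt_nonneg)
  also have "\<dots> = ln (fact N) + cheb_psi N"
    by (simp add: ln_fact_eq_sum_mangoldt cheb_psi_def algebra_simps sum.distrib)
  also have "\<dots> \<le> N * ln N + 4 * N" by (intro add_mono ln_fact_le cheb_psi_le N)
  finally have "N * (\<Sum>n=1..N. mangoldt n / real n) \<le> N * (ln N + 4)" by (simp add: algebra_simps)
  thus "(\<Sum>n=1..N. mangoldt n / real n) \<le> ln N + 4" using N by simp
qed

section \<open>Values of L-functions at 1\<close>

text \<open>Converts the tail bound \<open>2 * k / Suc M\<close> at \<open>M = N div d\<close> into
  \<open>2 * k * d / N\<close>; the factor \<open>d\<close> then cancels the denominator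
  \<open>d\<close> of the summand.\<close>

lemma frac_le_div_Suc:
  assumes "d \<ge> 1" "N \<ge> (1::nat)"
  shows "1 / real (Suc (N div d)) \<le> real d / real N"
proof -
  have "N < d * Suc (N div d)" using assms dividend_less_div_times[of d N] by (simp add: mult.commute)
  hence "real N \<le> real d * real (Suc (N div d))" unfolding of_nat_mult[symmetric] of_nat_le_iff by (rule less_imp_le)
  thus ?thesis using assms by (simp add: field_simps)
qed

lemma ln_div_self_antimono:
  assumes "n \<ge> 3"
  shows "ln (real (Suc n)) / real (Suc n) \<le> ln (real n) / real n"
proof -
  have n: "real n > 0" using assms by simp
  have "1 + 1 / n = real (Suc n) / real n" using n by (simp add: field_simps)
  hence "ln (real (Suc n)) - ln n = ln (1 + 1 / n)" using n by (simp add: ln_div)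
  also have "\<dots> \<le> 1 / n" using n by (intro ln_add_one_self_le_self) auto
  finally have "real n * (ln (real (Suc n)) - ln n) \<le> 1" using n by (simp add: field_simps)
  moreover have "1 \<le> ln (real n)"
  proof -
    have "exp 1 \<le> real n" using exp_le assms by linarith
    thus ?thesis using n ln_ge_iff by blast
  qed
  ultimately have "real n * ln (real (Suc n)) \<le> real (Suc n) * ln n" by (simp add: algebra_simps)
  thus ?thesis using n by (simp add: field_simps)
qed

definition char_partial_L :: "(nat \<Rightarrow> complex) \<Rightarrow> nat \<Rightarrow> complex" where
  "char_partial_L \<chi> N = (\<Sum>n=1..N. \<chi> n / of_nat n)"

definition L_one :: "(nat \<Rightarrow> complex) \<Rightarrow> complex" where
  "L_one \<chi> = lim (char_partial_L \<chi>)"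

definition mangoldt_char_sum :: "(nat \<Rightarrow> complex) \<Rightarrow> nat \<Rightarrow> complex" where
  "mangoldt_char_sum \<chi> N = (\<Sum>n=1..N. \<chi> n * mangoldt n / of_nat n)"

context
  fixes k :: nat and \<chi> :: "nat \<Rightarrow> complex"
  assumes k: "k > 0" and \<chi>: "\<chi> \<in> dirichlet_chars k" and nonprincipal: "\<chi> \<noteq> principal_char k"
begin

lemma norm_char_partial_L_diff:
  assumes "M \<le> N"
  shows "norm (char_partial_L \<chi> N - char_partial_L \<chi> M) \<le> 2 * k / real (Suc M)"
proof -
  have "{1..N} = {1..M} \<union> {Suc M..N}" using assms by auto
  hence "char_partial_L \<chi> N = char_partial_L \<chi> M + (\<Sum>n=Suc M..N. \<chi> n / of_nat n)"
    unfolding char_partial_L_def by (simp only:) (rule sum.union_disjoint, auto)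
  hence "char_partial_L \<chi> N - char_partial_L \<chi> M = (\<Sum>n=Suc M..N. \<chi> n * of_real (1 / real n))"
    by (simp add: divide_inverse)
  also have "norm \<dots> \<le> (2 * k) * (1 / real (Suc M))"
    using norm_sum_char_le[OF k \<chi> nonprincipal]
    by (intro norm_sum_antimono_le) (auto simp: field_simps)
  finally show ?thesis by simp
qed

lemma char_partial_L_tendsto: "char_partial_L \<chi> \<longlonglongrightarrow> L_one \<chi>"
proof -
  have "Cauchy (char_partial_L \<chi>)"
  proof (rule metric_CauchyI)
    fix e :: real assume e: "e > 0"
    obtain M where M: "2 * k / e < real M" using reals_Archimedean2 by blast
    have close: "dist (char_partial_L \<chi> m) (char_partial_L \<chi> n) < e" if "m \<ge> M" "n \<ge> m" for m n
    proof -
      have "dist (char_partial_L \<chi> m) (char_partial_L \<chi> n) \<le> 2 * k / real (Suc m)"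
        using norm_char_partial_L_diff[OF that(2)] by (simp add: dist_norm norm_minus_commute)
      also have "2 * k < e * real (Suc m)"
      proof -
        have "2 * k < e * real M" using M e by (simp add: field_simps)
        also have "\<dots> \<le> e * real (Suc m)" using that e by (intro mult_left_mono) auto
        finally show ?thesis .
      qed
      hence "2 * k / real (Suc m) < e" by (simp add: field_simps)
      finally show ?thesis .
    qed
    show "\<exists>M. \<forall>m\<ge>M. \<forall>n\<ge>M. dist (char_partial_L \<chi> m) (char_partial_L \<chi> n) < e"
    proof (intro exI[of _ M] allI impI)
      fix m n assume "m \<ge> M" "n \<ge> M"
      thus "dist (char_partial_L \<chi> m) (char_partial_L \<chi> n) < e"
        using close[of m n] close[of n m]
        by (cases "m \<le> n") (auto simp: dist_commute)
    qed
  qed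
  thus ?thesis unfolding L_one_def using Cauchy_convergent_iff convergent_LIMSEQ_iff by blast
qed

lemma norm_char_partial_L_minus_L: "norm (char_partial_L \<chi> M - L_one \<chi>) \<le> 2 * k / real (Suc M)"
proof -
  have "(\<lambda>N. norm (char_partial_L \<chi> N - char_partial_L \<chi> M)) \<longlonglongrightarrow> norm (L_one \<chi> - char_partial_L \<chi> M)"
    by (intro tendsto_intros char_partial_L_tendsto)
  moreover have "\<forall>\<^sub>F N in sequentially. norm (char_partial_L \<chi> N - char_partial_L \<chi> M) \<le> 2 * k / real (Suc M)"
    using eventually_ge_at_top[of M] by eventually_elim (rule norm_char_partial_L_diff)
  ultimately have "norm (L_one \<chi> - char_partial_L \<chi> M) \<le> 2 * k / real (Suc M)"
    by (rule tendsto_upperbound) auto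
  thus ?thesis by (simp add: norm_minus_commute)
qed

text \<open>The weights \<open>ln n / n\<close> decrease only beyond e, so Abel summation starts at
  3 and the first two terms are estimated by 1.\<close>

lemma norm_sum_char_ln_div_le: "norm (\<Sum>n=1..N. \<chi> n * of_real (ln n) / of_nat n) \<le> 1 + 2 * k * (ln 3 / 3)"
proof -
  let ?t = "\<lambda>n. \<chi> n * of_real (ln n) / of_nat n"
  have "{1..N} = {1..min N 2} \<union> {3..N}" by auto
  hence "(\<Sum>n=1..N. ?t n) = (\<Sum>n=1..min N 2. ?t n) + (\<Sum>n=3..N. ?t n)"
    by (simp only:) (rule sum.union_disjoint, auto)
  moreover have "norm (\<Sum>n=1..min N 2. ?t n) \<le> 1"
  proof -
    have "norm (\<Sum>n=1..min N 2. ?t n) \<le> (\<Sum>n=1..min N 2. norm (?t n))" by (rule norm_sum)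
    also have "\<dots> \<le> (\<Sum>n=1..2. norm (?t n))" by (rule sum_mono2) auto
    also have "\<dots> = norm (\<chi> 2) * (ln 2 / 2)" by (simp add: numeral_2_eq_2 norm_mult norm_divide)
    also have "\<dots> \<le> 1 * 1" using norm_char_le_1[OF k \<chi>, of 2] ln_2_less_1 by (intro mult_mono) auto
    finally show ?thesis by simp
  qed
  moreover have "norm (\<Sum>n=3..N. \<chi> n * of_real (ln n / n)) \<le> (2 * k) * (ln (real 3) / real 3)"
    by (intro norm_sum_antimono_le norm_sum_char_le[OF k \<chi> nonprincipal] ln_div_self_antimono) auto
  hence "norm (\<Sum>n=3..N. ?t n) \<le> 2 * k * (ln 3 / 3)" by simp
  ultimately show ?thesis by (simp only:) (intro order.trans[OF norm_triangle_ineq] add_mono)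
qed

text \<open>Complete multiplicativity splits \<open>\<chi> n / n\<close> along
  \<open>n = d * j\<close>; summing over \<open>j\<close> first produces a partial sum of the
  L-series.\<close>

lemma char_convolution_sum:
  "(\<Sum>n=1..N. \<chi> n / of_nat n * (\<Sum>d | d dvd n. f d)) = (\<Sum>d=1..N. \<chi> d * f d / of_nat d * char_partial_L \<chi> (N div d))"
proof -
  have "(\<Sum>n=1..N. \<chi> n / of_nat n * (\<Sum>d | d dvd n. f d))
      = (\<Sum>n=1..N. \<Sum>d | d dvd n. \<chi> d * f d / of_nat d * (\<chi> (n div d) / of_nat (n div d)))"
    unfolding sum_distrib_left
  proof (intro sum.cong refl)
    fix n d assume "n \<in> {1..N}" "d \<in> {d. d dvd n}"
    then obtain j where "n = d * j" "d > 0" "j > 0" by (auto elim!: dvdE)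
    thus "\<chi> n / of_nat n * f d = \<chi> d * f d / of_nat d * (\<chi> (n div d) / of_nat (n div d))"
      using char_mult[OF k \<chi>, of d j] by (simp add: field_simps)
  qed
  also have "\<dots> = (\<Sum>d=1..N. \<Sum>j=1..N div d. \<chi> d * f d / of_nat d * (\<chi> j / of_nat j))"
    by (rule sum_sum_divisors[of "\<lambda>d j. \<chi> d * f d / of_nat d * (\<chi> j / of_nat j)" N])
  also have "\<dots> = (\<Sum>d=1..N. \<chi> d * f d / of_nat d * char_partial_L \<chi> (N div d))"
    unfolding char_partial_L_def sum_distrib_left ..
  finally show ?thesis .
qed

lemma norm_char_div_le: "norm (\<chi> d * c / of_nat d) \<le> norm c / real d"
  using mult_right_mono[OF norm_char_le_1[OF k \<chi>, of d], of "norm c / real d"]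
  by (simp add: norm_mult norm_divide)

text \<open>Take \<open>f = mangoldt\<close> in the convolution: the divisor sum is
  \<open>ln n\<close>, whose character sum is bounded. Replacing each partial sum by its limit
  produces \<open>L_one \<chi> * mangoldt_char_sum \<chi> N\<close>, with total error
  \<open>(2 * k / N) * cheb_psi N\<close>, at most \<open>8 * k\<close>. Division by the nonzero
  limit finishes.\<close>

lemma mangoldt_char_sum_bounded:
  assumes "L_one \<chi> \<noteq> 0"
  shows "\<exists>C. \<forall>N. norm (mangoldt_char_sum \<chi> N) \<le> C"
proof -
  define C0 where "C0 = 1 + 2 * k * (ln 3 / 3) + 8 * real k"
  have "norm (L_one \<chi> * mangoldt_char_sum \<chi> N) \<le> C0" for N
  proof (cases "N = 0")
    case True
    thus ?thesis by (simp add: mangoldt_char_sum_def C0_def)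
  next
    case False
    let ?P = "char_partial_L \<chi>"
    have split: "a * b = c * a + a * (b - c)" for a b c :: complex by (simp add: algebra_simps)
    have "(\<Sum>n=1..N. \<chi> n * of_real (ln n) / of_nat n) = (\<Sum>n=1..N. \<chi> n / of_nat n * (\<Sum>d | d dvd n. mangoldt d))"
      by (intro sum.cong) (auto simp: mangoldt_sum)
    also have "\<dots> = (\<Sum>d=1..N. \<chi> d * mangoldt d / of_nat d * ?P (N div d))" by (rule char_convolution_sum)
    also have "\<dots> = (\<Sum>d=1..N. L_one \<chi> * (\<chi> d * mangoldt d / of_nat d)
        + \<chi> d * mangoldt d / of_nat d * (?P (N div d) - L_one \<chi>))"
      by (intro sum.cong refl) (rule split)
    also have "\<dots> = L_one \<chi> * mangoldt_char_sum \<chi> N + (\<Sum>d=1..N. \<chi> d * mangoldt d / of_nat d * (?P (N div d) - L_one \<chi>))"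
      unfolding mangoldt_char_sum_def sum_distrib_left sum.distrib ..
    finally have eq: "L_one \<chi> * mangoldt_char_sum \<chi> N = (\<Sum>n=1..N. \<chi> n * of_real (ln n) / of_nat n)
        - (\<Sum>d=1..N. \<chi> d * mangoldt d / of_nat d * (?P (N div d) - L_one \<chi>))" by simp
    have "norm (\<Sum>d=1..N. \<chi> d * mangoldt d / of_nat d * (?P (N div d) - L_one \<chi>)) \<le> (\<Sum>d=1..N. (2 * k / N) * mangoldt d)"
    proof (rule sum_norm_le)
      fix d assume d: "d \<in> {1..N}"
      have "norm (?P (N div d) - L_one \<chi>) \<le> 2 * k * (1 / real (Suc (N div d)))"
        using norm_char_partial_L_minus_L[of "N div d"] by simp
      also have "\<dots> \<le> 2 * k * (real d / real N)"
        using d by (intro mult_left_mono frac_le_div_Suc) auto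
      finally have "norm (\<chi> d * mangoldt d / of_nat d * (?P (N div d) - L_one \<chi>))
          \<le> norm (mangoldt d :: complex) / real d * (2 * k * (real d / real N))"
        unfolding norm_mult[of "\<chi> d * mangoldt d / of_nat d"] by (intro mult_mono norm_char_div_le) (auto simp: mangoldt_nonneg)
      also have "\<dots> = (2 * k / N) * mangoldt d" using d by simp
      finally show "norm (\<chi> d * mangoldt d / of_nat d * (?P (N div d) - L_one \<chi>)) \<le> (2 * k / N) * mangoldt d" .
    qed
    also have "\<dots> = (2 * k / N) * cheb_psi N" unfolding cheb_psi_def sum_distrib_left ..
    also have "\<dots> \<le> (2 * k / N) * (4 * N)" by (intro mult_left_mono cheb_psi_le) auto
    also have "\<dots> = 8 * real k" using False by simp
    finally show ?thesis unfolding eq C0_def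
      by (intro order.trans[OF norm_triangle_ineq4] add_mono norm_sum_char_ln_div_le)
  qed
  hence "norm (mangoldt_char_sum \<chi> N) \<le> C0 / norm (L_one \<chi>)" for N
    using assms by (simp add: norm_mult field_simps)
  thus ?thesis by blast
qed

text \<open>Here the partial sums of the L-series are themselves the small errors. To exploit this,
  the convolution is used with Moebius weights whose divisor sums give \<open>mangoldt n\<close>,
  plus an extra \<open>ln N\<close> at \<open>n = 1\<close>.\<close>

lemma mangoldt_char_sum_L_zero:
  assumes "L_one \<chi> = 0" and N: "N > 0"
  shows "norm (mangoldt_char_sum \<chi> N + of_real (ln N)) \<le> 2 * k"
proof -
  let ?P = "char_partial_L \<chi>"
  \<comment> \<open>The weight uses \<open>N / d\<close> rather than \<open>n / d\<close>, so that
    it depends on \<open>d\<close> alone; this is the origin of the extra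
    \<open>ln N\<close>.\<close>
  let ?f = "\<lambda>d. complex_of_real (mobius d * ln (N / d))"
  have div_sum: "(\<Sum>d | d dvd n. ?f d) = of_real (if n = 1 then ln N else 0) + mangoldt n" if n: "n > 0" for n
  proof -
    have "(\<Sum>d | d dvd n. mobius d * ln (N / d)) = (\<Sum>d | d dvd n. mobius d * ln N - mobius d * ln d)"
    proof (intro sum.cong refl)
      fix d assume "d \<in> {d. d dvd n}"
      hence "d > 0" using n by (auto intro: Nat.gr0I)
      thus "mobius d * ln (N / d) = mobius d * ln N - mobius d * ln d"
        using N by (simp add: ln_div right_diff_distrib)
    qed
    also have "\<dots> = (\<Sum>d | d dvd n. mobius d) * ln N - (\<Sum>d | d dvd n. mobius d * ln d)"
      by (simp add: sum_subtractf sum_distrib_right)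
    also have "\<dots> = (if n = 1 then ln N else 0) + mangoldt n"
      using sum_mobius_divisors[OF n] sum_mobius_ln[OF n] by simp
    finally have "complex_of_real (\<Sum>d | d dvd n. mobius d * ln (N / d)) = of_real ((if n = 1 then ln N else 0) + mangoldt n)"
      by (rule arg_cong)
    thus ?thesis unfolding of_real_sum of_real_add of_real_mangoldt .
  qed
  have "(\<Sum>n=1..N. \<chi> n / of_nat n * (\<Sum>d | d dvd n. ?f d))
      = (\<Sum>n=1..N. (if n = 1 then of_real (ln N) else 0) + \<chi> n * mangoldt n / of_nat n)"
    by (intro sum.cong refl, subst div_sum) (use char_1[OF k \<chi>] in \<open>auto simp: algebra_simps\<close>)
  also have "\<dots> = of_real (ln N) + mangoldt_char_sum \<chi> N"
    unfolding sum.distrib mangoldt_char_sum_def using N by simp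
  finally have eq: "mangoldt_char_sum \<chi> N + of_real (ln N) = (\<Sum>d=1..N. \<chi> d * ?f d / of_nat d * ?P (N div d))"
    unfolding char_convolution_sum by simp
  have "norm (\<Sum>d=1..N. \<chi> d * ?f d / of_nat d * ?P (N div d)) \<le> (\<Sum>d=1..N. (2 * k / N) * (ln N - ln d))"
  proof (rule sum_norm_le)
    fix d assume d: "d \<in> {1..N}"
    have "norm (?P (N div d)) \<le> 2 * k * (1 / real (Suc (N div d)))"
      using norm_char_partial_L_minus_L[of "N div d"] assms(1) by simp
    also have "\<dots> \<le> 2 * k * (real d / real N)"
      using d by (intro mult_left_mono frac_le_div_Suc) auto
    finally have P: "norm (?P (N div d)) \<le> 2 * k * (real d / real N)" .
    have ln: "ln (N / d) = ln N - ln d" "ln (N / d) \<ge> 0" using d N by (auto simp: ln_div)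
    have "norm (?f d) \<le> ln (N / d)"
      using mult_right_mono[OF abs_mobius_le_1[of d] ln(2)] ln(2) by (simp add: abs_mult norm_mult)
    hence "norm (?f d) / real d \<le> (ln N - ln d) / real d" unfolding ln(1) by (intro divide_right_mono) auto
    hence "norm (\<chi> d * ?f d / of_nat d) \<le> (ln N - ln d) / real d"
      by (rule order.trans[OF norm_char_div_le])
    hence "norm (\<chi> d * ?f d / of_nat d * ?P (N div d)) \<le> (ln N - ln d) / real d * (2 * k * (real d / real N))"
      unfolding norm_mult[of "\<chi> d * ?f d / of_nat d"] using ln by (intro mult_mono P) auto
    also have "\<dots> = (2 * k / N) * (ln N - ln d)" using d by simp
    finally show "norm (\<chi> d * ?f d / of_nat d * ?P (N div d)) \<le> (2 * k / N) * (ln N - ln d)" .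
  qed
  also have "\<dots> = (2 * k / N) * (N * ln N - ln (fact N))"
  proof -
    have "(\<Sum>d=1..N. ln N - ln d) = N * ln N - ln (fact N)"
      unfolding sum_subtractf ln_fact_eq_sum by simp
    thus ?thesis by (simp only: sum_distrib_left[symmetric])
  qed
  \<comment> \<open>The logarithms of \<open>N / d\<close> add up to at most \<open>N\<close>, so
    the error stays bounded although each weight can be as large as \<open>ln N\<close>.\<close>
  also have "\<dots> \<le> (2 * k / N) * N" using ln_fact_ge[OF N] by (intro mult_left_mono) auto
  also have "\<dots> = 2 * k" using N by simp
  finally show ?thesis unfolding eq .
qed

end

section \<open>Divisor sums of completely multiplicative functions with values -1, 0, 1\<close>

lemma sum_divisors_prime_power:
  fixes f :: "nat \<Rightarrow> 'b :: comm_monoid_add"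
  assumes p: "Factorial_Ring.prime p" "\<not> p dvd m" and m: "m > 0"
  shows "(\<Sum>d | d dvd p ^ a * m. f d) = (\<Sum>d | d dvd m. \<Sum>i\<le>a. f (p ^ i * d))"
proof -
  let ?g = "\<lambda>(e, i). p ^ i * e"
  have mult_p: "multiplicity p (p ^ i * e) = i" if "e dvd m" for i e
  proof -
    have "\<not> p dvd e" "e \<noteq> 0" using p(2) that m by (auto dest: dvd_trans)
    thus ?thesis
      using p(1) by (simp add: prime_elem_multiplicity_mult_distrib not_dvd_imp_multiplicity_0)
  qed
  have inj: "inj_on ?g ({e. e dvd m} \<times> {..a})"
  proof (rule inj_onI, clarsimp)
    fix i e j e' assume *: "e dvd m" "e' dvd m" "p ^ i * e = p ^ j * e'"
    have "i = j" using mult_p[OF *(1), of i] mult_p[OF *(2), of j] *(3) by simp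
    thus "e = e' \<and> i = j" using * p(1) by (auto simp: prime_gt_0_nat)
  qed
  have img: "{d. d dvd p ^ a * m} = ?g ` ({e. e dvd m} \<times> {..a})"
  proof (intro equalityI subsetI)
    fix d assume "d \<in> {d. d dvd p ^ a * m}"
    then obtain b c where bc: "d = b * c" "b dvd p ^ a" "c dvd m" using division_decomp by blast
    then obtain i where "i \<le> a" "b = p ^ i" using divides_primepow_nat[OF p(1)] by blast
    thus "d \<in> ?g ` ({e. e dvd m} \<times> {..a})" using bc by (auto intro!: image_eqI[of _ _ "(c, i)"])
  next
    fix d assume "d \<in> ?g ` ({e. e dvd m} \<times> {..a})"
    thus "d \<in> {d. d dvd p ^ a * m}" by (auto intro!: mult_dvd_mono le_imp_power_dvd)
  qed
  show ?thesis
    unfolding img sum.cartesian_product by (subst sum.reindex[OF inj]) (auto intro!: sum.cong)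
qed

lemma sum_divisors_prime_power_mult:
  fixes f :: "nat \<Rightarrow> real"
  assumes p: "Factorial_Ring.prime p" "\<not> p dvd m" and m: "m > 0"
    and mult: "\<And>a b. f (a * b) = f a * f b" and f1: "f 1 = 1"
  shows "(\<Sum>d | d dvd p ^ a * m. f d) = (\<Sum>i\<le>a. f p ^ i) * (\<Sum>d | d dvd m. f d)"
proof -
  have pow: "f (p ^ i) = f p ^ i" for i using f1 by (induction i) (auto simp: mult)
  have "(\<Sum>d | d dvd p ^ a * m. f d) = (\<Sum>d | d dvd m. \<Sum>i\<le>a. f p ^ i * f d)"
    unfolding sum_divisors_prime_power[OF p m] by (simp add: mult pow)
  thus ?thesis by (simp add: sum_distrib_left sum_distrib_right)
qed

text \<open>These are the Euler factors of the divisor sums: for the value -1 the sum alternates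
  between 1 and 0, and an even exponent ends on 1.\<close>

lemma sum_sign_powers:
  assumes "v \<in> {-1, 0, 1 :: real}"
  shows "(\<Sum>i\<le>a. v ^ i) \<ge> 0" "even a \<Longrightarrow> (\<Sum>i\<le>a. v ^ i) \<ge> 1"
proof -
  have "(\<Sum>i\<le>a. (-1 :: real) ^ i) = (if even a then 1 else 0)" by (induction a) auto
  moreover have "(\<Sum>i\<le>a. (0 :: real) ^ i) = 1" by (induction a) auto
  ultimately show "(\<Sum>i\<le>a. v ^ i) \<ge> 0" "even a \<Longrightarrow> (\<Sum>i\<le>a. v ^ i) \<ge> 1"
    using assms by auto
qed

context
  fixes f :: "nat \<Rightarrow> real"
  assumes mult: "\<And>a b. f (a * b) = f a * f b" and f1: "f 1 = 1" and range: "\<And>n. f n \<in> {-1, 0, 1}"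
begin

lemma sum_divisors_sign_nonneg: "n > 0 \<Longrightarrow> (\<Sum>d | d dvd n. f d) \<ge> 0"
proof (induction n rule: less_induct)
  case (less n)
  show ?case
  proof (cases "n = 1")
    case True
    thus ?thesis using f1 by simp
  next
    case False
    then obtain p where p: "Factorial_Ring.prime p" "p dvd n" using prime_factor_nat by blast
    have "n \<noteq> 0" "\<not> is_unit p" using less(2) p(1) by auto
    then obtain m where m: "n = p ^ multiplicity p n * m" "\<not> p dvd m"
      by (rule multiplicity_decompose') blast
    have "multiplicity p n > 0" using p less(2) by (simp add: prime_multiplicity_gt_zero_iff)
    hence "p ^ multiplicity p n > 1" using p(1) by (intro one_less_power prime_gt_1_nat) auto
    moreover have "m > 0" using m less(2) by (intro Nat.gr0I) auto
    ultimately have "m < n" using m(1) by (metis mult_less_cancel2 mult_1)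
    from less(1)[OF this \<open>m > 0\<close>]
    have "0 \<le> (\<Sum>i\<le>multiplicity p n. f p ^ i) * (\<Sum>d | d dvd m. f d)"
      using sum_sign_powers(1)[OF range] by (intro mult_nonneg_nonneg)
    also have "\<dots> = (\<Sum>d | d dvd p ^ multiplicity p n * m. f d)"
      by (rule sum_divisors_prime_power_mult[symmetric, OF p(1) m(2) \<open>m > 0\<close> mult f1])
    finally show ?thesis using m(1) by simp
  qed
qed

text \<open>In a square all prime exponents are even, so each Euler factor is at least 1.\<close>

lemma sum_divisors_sign_square: "n > 0 \<Longrightarrow> (\<Sum>d | d dvd n\<^sup>2. f d) \<ge> 1"
proof (induction n rule: less_induct)
  case (less n)
  show ?case
  proof (cases "n = 1")
    case True
    thus ?thesis using f1 by simp
  next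
    case False
    then obtain p where p: "Factorial_Ring.prime p" "p dvd n" using prime_factor_nat by blast
    have "n \<noteq> 0" "\<not> is_unit p" using less(2) p(1) by auto
    then obtain m where m: "n = p ^ multiplicity p n * m" "\<not> p dvd m"
      by (rule multiplicity_decompose') blast
    have "multiplicity p n > 0" using p less(2) by (simp add: prime_multiplicity_gt_zero_iff)
    hence "p ^ multiplicity p n > 1" using p(1) by (intro one_less_power prime_gt_1_nat) auto
    moreover have "m > 0" using m less(2) by (intro Nat.gr0I) auto
    ultimately have "m < n" using m(1) by (metis mult_less_cancel2 mult_1)
    have n2: "n\<^sup>2 = p ^ (2 * multiplicity p n) * m\<^sup>2"
      by (subst m(1)) (simp add: power_mult_distrib power_mult[symmetric] mult.commute)
    have "\<not> p dvd m\<^sup>2" using m(2) p(1) prime_dvd_power by blast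
    have "1 * 1 \<le> (\<Sum>i\<le>2 * multiplicity p n. f p ^ i) * (\<Sum>d | d dvd m\<^sup>2. f d)"
      using less(1)[OF \<open>m < n\<close> \<open>m > 0\<close>] sum_sign_powers(2)[OF range, of "2 * multiplicity p n" p]
        sum_sign_powers(1)[OF range, of "2 * multiplicity p n" p]
      by (intro mult_mono) auto
    also have "\<dots> = (\<Sum>d | d dvd n\<^sup>2. f d)" unfolding n2
      using \<open>m > 0\<close> by (intro sum_divisors_prime_power_mult[symmetric, OF p(1) \<open>\<not> p dvd m\<^sup>2\<close> _ mult f1]) auto
    finally show ?thesis by simp
  qed
qed

end

section \<open>The weights in Monsky's Lambert series argument\<close>

definition geo :: "real \<Rightarrow> nat \<Rightarrow> real" where
  "geo z n = (\<Sum>i<n. z ^ i)"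

lemma one_minus_power_eq_geo: "1 - z ^ n = (1 - z) * geo z n"
  unfolding geo_def by (rule one_diff_power_eq)

text \<open>The terms with indices \<open>i\<close> and \<open>n - 1 - i\<close> are paired and the
  arithmetic-geometric mean inequality applied. Writing the base as a square keeps the geometric
  mean \<open>w ^ (n - 1)\<close> free of roots.\<close>

lemma geo_square_ge:
  assumes "0 < w" "n \<ge> 1"
  shows "geo (w\<^sup>2) n \<ge> n * w ^ (n - 1)"
proof -
  have "2 * geo (w\<^sup>2) n = (\<Sum>i<n. (w\<^sup>2) ^ i) + (\<Sum>i<n. (w\<^sup>2) ^ (n - Suc i))"
    unfolding geo_def sum.nat_diff_reindex by simp
  also have "\<dots> = (\<Sum>i<n. (w ^ i)\<^sup>2 + (w ^ (n - Suc i))\<^sup>2)"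
    by (simp add: sum.distrib power_mult[symmetric] mult.commute)
  also have "\<dots> \<ge> (\<Sum>i<n. 2 * w ^ (n - 1))"
  proof (rule sum_mono)
    fix i assume "i \<in> {..<n}"
    hence "w ^ (n - 1) = w ^ i * w ^ (n - Suc i)" by (simp add: power_add[symmetric])
    thus "2 * w ^ (n - 1) \<le> (w ^ i)\<^sup>2 + (w ^ (n - Suc i))\<^sup>2"
      using sum_squares_bound[of "w ^ i" "w ^ (n - Suc i)"] by simp
  qed
  finally show ?thesis by simp
qed

text \<open>The Lambert term \<open>z ^ n / (1 - z ^ n)\<close> behaves like
  \<open>1 / (n * (1 - z))\<close> as \<open>z\<close> tends to 1. Summed against a character, the
  latter gives a partial sum of L(1, \<chi>), so what matters is that the difference is a decreasing
  weight.\<close>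

definition lambert_weight :: "real \<Rightarrow> nat \<Rightarrow> real" where
  "lambert_weight z n = 1 / (n * (1 - z)) - z ^ n / (1 - z ^ n)"

context
  fixes w z :: real
  assumes w: "0 < w" "w < 1" and z: "z = w\<^sup>2"
begin

lemma z_bounds: "0 < z" "z < 1"
  using w unfolding z by (auto simp: power_less_one_iff)

lemma lambert_weight_eq: "n \<ge> 1 \<Longrightarrow> (1 - z) * lambert_weight z n = 1 / n - z ^ n / geo z n"
proof -
  have "u * (1 / (m * u) - a / (u * g)) = 1 / m - a / g" if "u \<noteq> 0" for u m a g :: real
    using that by (simp add: right_diff_distrib)
  from this[of "1 - z" n] show ?thesis
    using z_bounds unfolding lambert_weight_def one_minus_power_eq_geo by simp
qed

lemma geo_pos: "n \<ge> 1 \<Longrightarrow> geo z n > 0"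
  unfolding geo_def using z_bounds by (intro sum_pos) (auto simp: lessThan_empty_iff)

lemma lambert_weight_nonneg: 
  assumes n: "n \<ge> 1"
  shows "lambert_weight z n \<ge> 0"
proof -
  have "z ^ n \<le> w ^ (n - 1)"
    unfolding z power_mult[symmetric] using w by (intro power_decreasing) auto
  hence "n * z ^ n \<le> n * w ^ (n - 1)" by (intro mult_left_mono) auto
  also have "\<dots> \<le> geo z n" unfolding z by (rule geo_square_ge[OF w(1) n])
  finally have "z ^ n / geo z n \<le> 1 / n" using geo_pos[OF n] n by (simp add: field_simps)
  hence "(1 - z) * lambert_weight z n \<ge> 0" unfolding lambert_weight_eq[OF n] by simp
  thus ?thesis using z_bounds by (simp add: zero_le_mult_iff)
qed

text \<open>After scaling by \<open>1 - z\<close>, the comparison is between the decrements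
  \<open>1 / (n * Suc n)\<close> and \<open>z ^ n / (geo z n * geo z (Suc n))\<close>, because
  \<open>geo z (Suc n) - z * geo z n = 1\<close>. The mean inequality bounds both geometric sums
  from below.\<close>

lemma lambert_weight_antimono:
  assumes n: "n \<ge> 1"
  shows "lambert_weight z (Suc n) \<le> lambert_weight z n"
proof -
  let ?S = "geo z n" and ?T = "geo z (Suc n)"
  have S: "?S > 0" "?T > 0" using geo_pos n by auto
  have T: "?T = 1 + z * ?S"
    unfolding geo_def by (subst sum.lessThan_Suc_shift) (simp add: sum_distrib_left)
  have "real n * real (Suc n) * z ^ n \<le> (n * w ^ (n - 1)) * (Suc n * w ^ n)"
  proof -
    have "z ^ n = w ^ (n + n)" unfolding z by (simp add: power_mult[symmetric] mult_2)
    also have "\<dots> \<le> w ^ ((n - 1) + n)" using w by (intro power_decreasing) auto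
    also have "\<dots> = w ^ (n - 1) * w ^ n" by (rule power_add)
    finally have "real n * real (Suc n) * z ^ n \<le> real n * real (Suc n) * (w ^ (n - 1) * w ^ n)"
      by (intro mult_left_mono) auto
    thus ?thesis by (simp only: mult_ac)
  qed
  also have "\<dots> \<le> ?S * ?T"
    using geo_square_ge[OF w(1) n] geo_square_ge[OF w(1), of "Suc n"] w S unfolding z
    by (intro mult_mono) auto
  finally have key: "real n * real (Suc n) * z ^ n \<le> ?S * ?T" .
  have "z ^ n / ?S - z ^ Suc n / ?T = z ^ n * (?T - z * ?S) / (?S * ?T)"
    using S by (simp add: field_simps)
  also have "\<dots> = z ^ n / (?S * ?T)" unfolding T by simp
  also have "\<dots> \<le> 1 / (real n * real (Suc n))"
  proof -
    have "a / b \<le> 1 / c" if "c * a \<le> b" "b > 0" "c > 0" for a b c :: real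
      using that by (simp add: field_simps)
    from this[OF key] show ?thesis using S n by simp
  qed
  also have "\<dots> = 1 / n - 1 / Suc n" using n by (simp add: field_simps)
  finally have "(1 - z) * lambert_weight z (Suc n) \<le> (1 - z) * lambert_weight z n"
    using n by (simp add: lambert_weight_eq)
  thus ?thesis using z_bounds by simp
qed

lemma lambert_weight_1: "lambert_weight z (Suc 0) = 1"
  using z_bounds unfolding lambert_weight_def by (simp add: field_simps)

end

text \<open>If L(1, \<chi>) vanished, the power series with coefficients \<open>r n\<close>, the
  divisor sums of the character, would stay bounded by \<open>2 * k\<close> as \<open>z\<close>
  tends to 1. But \<open>r\<close> is nonnegative and at least 1 on squares, so it dominates a sum
  of \<open>z ^ m\<^sup>2\<close> that grows without bound.\<close>

lemma L_one_real_nonzero: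
  assumes k: "k > 0" and \<chi>: "\<chi> \<in> dirichlet_chars k" and nonprincipal: "\<chi> \<noteq> principal_char k"
    and real: "\<And>n. cnj (\<chi> n) = \<chi> n"
  shows "L_one \<chi> \<noteq> 0"
proof
  assume L0: "L_one \<chi> = 0"
  define f where "f n = Re (\<chi> n)" for n
  have \<chi>f: "\<chi> n = of_real (f n)" for n
    using real[of n] unfolding f_def by (simp add: complex_eq_iff)
  have f_mult: "f (a * b) = f a * f b" for a b
    using char_mult[OF k \<chi>, of a b] unfolding \<chi>f by (simp flip: of_real_mult)
  have f1: "f 1 = 1" using char_1[OF k \<chi>] unfolding \<chi>f by simp
  have frange: "f n \<in> {-1, 0, 1}" for n
  proof (cases "coprime n k")
    case True
    hence "\<bar>f n\<bar> = 1" using norm_char_coprime[OF k \<chi> True] unfolding \<chi>f by simp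
    thus ?thesis by auto
  next
    case False
    thus ?thesis using char_eq_0_iff[OF k \<chi>, of n] unfolding \<chi>f by simp
  qed
  define r where "r n = (\<Sum>d | d dvd n. f d)" for n
  \<comment> \<open>Everything is truncated at \<open>N\<close> to avoid infinite rearrangements.
    The three terms bound the weight sum, the partial sum of the L-series and the cut-off tails of
    the geometric series.\<close>
  have main: "(\<Sum>n=1..N. r n * z ^ n) \<le> 2 * k + 2 * k / real (Suc N) / (1 - z) + real N * z ^ N / (1 - z)"
    if w: "0 < w" "w < 1" "z = w\<^sup>2" for N w z
  proof -
    note zb = z_bounds[OF w]
    have zd: "1 - z \<le> 1 - z ^ d" "1 - z ^ d > 0" if "d \<ge> 1" for d
      using that zb power_decreasing[of 1 d z] power_less_one_iff[of z d] by auto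
    have "(\<Sum>n=1..N. r n * z ^ n) = (\<Sum>n=1..N. \<Sum>d | d dvd n. f d * z ^ (d * (n div d)))"
      unfolding r_def sum_distrib_right by (intro sum.cong) auto
    also have "\<dots> = (\<Sum>d=1..N. \<Sum>j=1..N div d. f d * z ^ (d * j))"
      by (rule sum_sum_divisors)
    also have "\<dots> = (\<Sum>d=1..N. f d * (z ^ d / (1 - z ^ d)) - f d * (z ^ (d * Suc (N div d)) / (1 - z ^ d)))"
    proof (intro sum.cong refl)
      fix d assume d: "d \<in> {1..N}"
      have "(\<Sum>j=1..M. (z ^ d) ^ j) = z ^ d / (1 - z ^ d) - z ^ (d * Suc M) / (1 - z ^ d)" for M
      proof (induction M)
        case 0
        thus ?case by simp
      next
        case (Suc M)
        have "(z ^ d) ^ Suc M = z ^ (d * Suc M) / (1 - z ^ d) - z ^ (d * Suc (Suc M)) / (1 - z ^ d)"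
          using zd[of d] d by (simp add: diff_divide_distrib[symmetric] power_mult[symmetric] field_simps power_add)
        thus ?case using Suc by simp
      qed
      thus "(\<Sum>j=1..N div d. f d * z ^ (d * j)) =
          f d * (z ^ d / (1 - z ^ d)) - f d * (z ^ (d * Suc (N div d)) / (1 - z ^ d))"
        by (simp only: power_mult sum_distrib_left[symmetric] right_diff_distrib)
    qed
    also have "\<dots> = (\<Sum>d=1..N. f d * (z ^ d / (1 - z ^ d))) - (\<Sum>d=1..N. f d * (z ^ (d * Suc (N div d)) / (1 - z ^ d)))"
      by (rule sum_subtractf)
    also have "(\<Sum>d=1..N. f d * (z ^ d / (1 - z ^ d))) = (\<Sum>d=1..N. f d / d) / (1 - z) - (\<Sum>d=1..N. f d * lambert_weight z d)"
      unfolding lambert_weight_def sum_divide_distrib sum_subtractf[symmetric]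
      by (intro sum.cong refl) (simp add: right_diff_distrib)
    finally have eq: "(\<Sum>n=1..N. r n * z ^ n) = (\<Sum>d=1..N. f d / d) / (1 - z) - (\<Sum>d=1..N. f d * lambert_weight z d)
        - (\<Sum>d=1..N. f d * (z ^ (d * Suc (N div d)) / (1 - z ^ d)))" .
    have "\<bar>\<Sum>d=1..N. f d / d\<bar> \<le> 2 * k / real (Suc N)"
    proof -
      have "char_partial_L \<chi> N = of_real (\<Sum>d=1..N. f d / d)"
        unfolding char_partial_L_def \<chi>f by simp
      thus ?thesis using norm_char_partial_L_minus_L[OF k \<chi> nonprincipal, of N] L0
        by (metis diff_zero norm_of_real)
    qed
    hence 1: "(\<Sum>d=1..N. f d / d) / (1 - z) \<le> 2 * k / real (Suc N) / (1 - z)"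
      using zb by (intro divide_right_mono) auto
    have "norm (\<Sum>d=1..N. \<chi> d * of_real (lambert_weight z d)) \<le> (2 * k) * lambert_weight z 1"
      using lambert_weight_nonneg[OF w] lambert_weight_antimono[OF w]
      by (intro norm_sum_antimono_le norm_sum_char_le[OF k \<chi> nonprincipal]) auto
    moreover have "(\<Sum>d=1..N. \<chi> d * of_real (lambert_weight z d)) = of_real (\<Sum>d=1..N. f d * lambert_weight z d)"
      unfolding \<chi>f by simp
    ultimately have 2: "- (\<Sum>d=1..N. f d * lambert_weight z d) \<le> 2 * k"
      using lambert_weight_1[OF w] by (simp only: norm_of_real One_nat_def)
    \<comment> \<open>Each tail starts at exponent \<open>d * Suc (N div d)\<close>, which is at
      least \<open>N\<close>; replacing \<open>d\<close> by 1 in the denominator only enlarges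
      it.\<close>
    have "(\<Sum>d=1..N. - f d * (z ^ (d * Suc (N div d)) / (1 - z ^ d))) \<le> (\<Sum>d=1..N. z ^ N / (1 - z))"
    proof (rule sum_mono)
      fix d assume d: "d \<in> {1..N}"
      have "N \<le> d * Suc (N div d)" using d dividend_less_div_times[of d N] by (simp add: mult.commute)
      hence "z ^ (d * Suc (N div d)) \<le> z ^ N" using zb by (intro power_decreasing) auto
      hence "z ^ (d * Suc (N div d)) / (1 - z ^ d) \<le> z ^ N / (1 - z)"
        using zb zd[of d] d by (intro frac_le) auto
      moreover have "z ^ (d * Suc (N div d)) / (1 - z ^ d) \<ge> 0" using zb zd[of d] d by auto
      ultimately show "- f d * (z ^ (d * Suc (N div d)) / (1 - z ^ d)) \<le> z ^ N / (1 - z)"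
        using frange[of d] by auto
    qed
    hence 3: "- (\<Sum>d=1..N. f d * (z ^ (d * Suc (N div d)) / (1 - z ^ d))) \<le> real N * z ^ N / (1 - z)"
      by (simp add: sum_negf)
    show ?thesis unfolding eq using 1 2 3 by linarith
  qed
  have squares: "(\<Sum>m=1..M. (w\<^sup>2) ^ m\<^sup>2) \<le> 2 * k" if w: "0 < w" "w < 1" for M and w :: real
  proof -
    define z where "z = w\<^sup>2"
    note zb = z_bounds[OF w z_def]
    have "(\<Sum>m=1..M. z ^ m\<^sup>2) \<le> 2 * k + 2 * k / real (Suc N) / (1 - z) + real N * z ^ N / (1 - z)" if "N \<ge> M\<^sup>2" for N
    proof -
      have "(\<Sum>m=1..M. z ^ m\<^sup>2) \<le> (\<Sum>m=1..M. r (m\<^sup>2) * z ^ m\<^sup>2)"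
        using sum_divisors_sign_square[of f, OF f_mult f1 frange] zb unfolding r_def
        by (intro sum_mono) (auto simp: mult_le_cancel_right1)
      also have "\<dots> = (\<Sum>n\<in>(\<lambda>m. m\<^sup>2) ` {1..M}. r n * z ^ n)"
        by (subst sum.reindex) (auto simp: inj_on_def)
      also have "\<dots> \<le> (\<Sum>n=1..N. r n * z ^ n)"
      proof (rule sum_mono2)
        show "(\<lambda>m. m\<^sup>2) ` {1..M} \<subseteq> {1..N}"
          using \<open>N \<ge> M\<^sup>2\<close> by (auto intro: order.trans[OF power_mono] simp: Suc_le_eq)
        show "0 \<le> r n * z ^ n" if "n \<in> {1..N} - (\<lambda>m. m\<^sup>2) ` {1..M}" for n
          using that sum_divisors_sign_nonneg[of f n, OF f_mult f1 frange] zb unfolding r_def by auto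
      qed auto
      also note main[OF w z_def, of N]
      finally show ?thesis .
    qed
    \<comment> \<open>For fixed \<open>z < 1\<close> the truncation errors vanish as
      \<open>N\<close> grows, leaving a bound independent of \<open>w\<close> and
      \<open>M\<close>.\<close>
    moreover have "(\<lambda>N. 2 * k + 2 * k / real (Suc N) / (1 - z) + real N * z ^ N / (1 - z)) \<longlonglongrightarrow> 2 * k + 0 / (1 - z) + 0 / (1 - z)"
      using zb by (intro tendsto_intros LIMSEQ_Suc[OF lim_const_over_n] powser_times_n_limit_0) auto
    ultimately show ?thesis unfolding z_def[symmetric]
      by (intro tendsto_lowerbound[of "\<lambda>N. 2 * k + 2 * k / real (Suc N) / (1 - z) + real N * z ^ N / (1 - z)" _ sequentially])
        (auto intro: eventually_mono[OF eventually_ge_at_top[of "M\<^sup>2"]])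
  qed
  \<comment> \<open>Now \<open>w\<close> tends to 1 in a sum of \<open>2 * k + 1\<close> terms, each
    tending to 1. The double successor keeps \<open>w\<close> strictly positive.\<close>
  have "(\<lambda>j. \<Sum>m=1..2*k+1. ((1 - 1 / real (Suc (Suc j)))\<^sup>2) ^ m\<^sup>2) \<longlonglongrightarrow> (\<Sum>m=1..2*k+1. ((1 - 0)\<^sup>2) ^ m\<^sup>2)"
    by (intro tendsto_intros LIMSEQ_Suc[OF LIMSEQ_Suc[OF lim_const_over_n]])
  moreover have "(\<Sum>m=1..2*k+1. ((1 - 1 / real (Suc (Suc j)))\<^sup>2) ^ m\<^sup>2) \<le> 2 * k" for j
    by (rule squares) auto
  ultimately have "(\<Sum>m=1..2*k+1. ((1 - 0 :: real)\<^sup>2) ^ m\<^sup>2) \<le> 2 * k"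
    by (intro tendsto_upperbound[of _ _ sequentially "real (2 * k)"]) auto
  thus False by simp
qed

section \<open>Primes in arithmetic progressions\<close>

lemma sum_inverse_powers_le:
  assumes "p \<ge> 2"
  shows "(\<Sum>j=2..M. 1 / real p ^ j) \<le> 1 / (real p * (real p - 1))"
proof (cases "M \<ge> 1")
  case True
  have "(\<Sum>j=2..M. 1 / real p ^ j) = 1 / (real p * (real p - 1)) - 1 / (real p ^ M * (real p - 1))"
    using True
  proof (induction M rule: dec_induct)
    case (step M)
    have "1 / x ^ Suc M = 1 / (x ^ M * (x - 1)) - 1 / (x ^ Suc M * (x - 1))" if "x > 1" for x :: real
      using that by (simp add: divide_simps)
    from this[of "real p"] show ?case using step assms by simp
  qed simp
  thus ?thesis using assms by simp
next
  case False
  thus ?thesis using assms by simp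
qed

text \<open>The right side is 0 at \<open>N = 1\<close>, and its increments dominate the summands:
  with \<open>x = N\<close> this reduces to \<open>(x + 1) * (ln (x + 1) - ln x) \<le> 2\<close>,
  which is where the constant 2 comes from.\<close>

lemma sum_ln_div_le:
  assumes "N \<ge> 1"
  shows "(\<Sum>n=2..N. ln (real n) / (real n * (real n - 1))) \<le> 2 - (ln N + 2) / N"
  using assms
proof (induction N rule: dec_induct)
  case (step N)
  define x where "x = real N"
  have x: "x \<ge> 1" "real (Suc N) = x + 1" using step(1) by (auto simp: x_def)
  have "1 + 1 / x = (x + 1) / x" using x by (simp add: field_simps)
  hence "ln (x + 1) - ln x = ln (1 + 1 / x)" using x by (simp add: ln_div)
  also have "\<dots> \<le> 1 / x" using x by (intro ln_add_one_self_le_self) auto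
  finally have "(x + 1) * (ln (x + 1) - ln x) \<le> (x + 1) * (1 / x)" using x by (intro mult_left_mono) auto
  also have "\<dots> \<le> 2" using x by (simp add: field_simps)
  finally have "ln (x + 1) \<le> (x + 1) * (ln x + 2) - x * (ln (x + 1) + 2)" by (simp add: algebra_simps)
  hence "ln (x + 1) / ((x + 1) * x) \<le> ((x + 1) * (ln x + 2) - x * (ln (x + 1) + 2)) / ((x + 1) * x)"
    using x by (intro divide_right_mono) auto
  also have "\<dots> = (ln x + 2) / x - (ln (x + 1) + 2) / (x + 1)"
    using x by (simp add: diff_divide_distrib)
  finally show ?case using step by (simp add: x_def[symmetric] add.commute[of 1 x])
qed simp

text \<open>A bound uniform in \<open>N\<close>, so any unbounded sum of
  \<open>mangoldt n / n\<close> must be fed by primes.\<close>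

lemma sum_mangoldt_nonprime_le:
  "(\<Sum>n | n \<in> {1..N} \<and> \<not> Factorial_Ring.prime n. mangoldt n / real n) \<le> 2"
proof (cases "N \<ge> 1")
  case True
  let ?A = "{n \<in> {1..N}. primepow n \<and> \<not> Factorial_Ring.prime n}"
  let ?h = "\<lambda>(p, j). ln (real p) / real p ^ j"
  define g where "g n = (aprimedivisor n, multiplicity (aprimedivisor n) n)" for n :: nat
  have A: "Factorial_Ring.prime (fst (g n))" "n = fst (g n) ^ snd (g n)" "snd (g n) \<ge> 2" if "n \<in> ?A" for n
  proof -
    obtain p j where pj: "Factorial_Ring.prime p" "n = p ^ j" "j > 0" using \<open>n \<in> ?A\<close> by (auto simp: primepow_def)
    have "j \<noteq> 1" using pj \<open>n \<in> ?A\<close> by auto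
    have ap: "aprimedivisor n = p" using pj by (simp add: aprimedivisor_prime_power)
    have "multiplicity p n = j" using pj by simp
    thus "Factorial_Ring.prime (fst (g n))" "n = fst (g n) ^ snd (g n)" "snd (g n) \<ge> 2"
      using pj ap \<open>j \<noteq> 1\<close> unfolding g_def by auto
  qed
  have inj: "inj_on g ?A" by (rule inj_onI) (metis A(2))
  have "(\<Sum>n | n \<in> {1..N} \<and> \<not> Factorial_Ring.prime n. mangoldt n / real n) = (\<Sum>n\<in>?A. mangoldt n / real n)"
    by (rule sum.mono_neutral_right) (auto simp: mangoldt_def)
  also have "\<dots> = (\<Sum>n\<in>?A. ?h (g n))"
  proof (rule sum.cong, rule refl)
    fix n assume n: "n \<in> ?A"
    have "mangoldt n = ln (real (fst (g n)))" using n by (simp add: mangoldt_def g_def)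
    moreover have "real n = real (fst (g n)) ^ snd (g n)" by (subst A(2)[OF n]) simp
    ultimately show "mangoldt n / real n = ?h (g n)" by (simp add: case_prod_beta)
  qed
  also have "\<dots> = (\<Sum>x\<in>g ` ?A. ?h x)" using sum.reindex[OF inj, of ?h] by simp
  \<comment> \<open>Coding prime powers as pairs of base and exponent, the sum is enlarged to a full
    rectangle; both coordinates are at most \<open>p ^ j\<close>, hence at most
    \<open>N\<close>.\<close>
  also have "\<dots> \<le> (\<Sum>x\<in>{2..N} \<times> {2..N}. ?h x)"
  proof (rule sum_mono2)
    show "g ` ?A \<subseteq> {2..N} \<times> {2..N}"
    proof (rule image_subsetI)
      fix n assume n: "n \<in> ?A"
      note An = A[OF n]
      define p j where "p = fst (g n)" and "j = snd (g n)"
      have p2: "p \<ge> 2" using An(1) prime_ge_2_nat unfolding p_def by blast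
      have pj: "n = p ^ j" "j \<ge> 2" using An(2,3) unfolding p_def j_def by auto
      have "p ^ 1 \<le> p ^ j" using p2 pj by (intro power_increasing) auto
      moreover have "j < p ^ j" using p2 by (intro power_gt_expt) auto
      ultimately have "p \<le> N" "j \<le> N" using n pj by auto
      thus "g n \<in> {2..N} \<times> {2..N}" using p2 pj(2) unfolding p_def j_def by (cases "g n") auto
    qed
    show "0 \<le> ?h x" if "x \<in> {2..N} \<times> {2..N} - g ` ?A" for x using that by auto
  qed auto
  also have "\<dots> = (\<Sum>p=2..N. ln (real p) * (\<Sum>j=2..N. 1 / real p ^ j))"
    unfolding sum.cartesian_product[symmetric] sum_distrib_left by simp
  also have "\<dots> \<le> (\<Sum>p=2..N. ln (real p) * (1 / (real p * (real p - 1))))"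
    by (intro sum_mono mult_left_mono sum_inverse_powers_le) auto
  also have "\<dots> \<le> 2 - (ln N + 2) / N" using sum_ln_div_le[OF True] by simp
  also have "\<dots> \<le> 2" using True by simp
  finally show ?thesis .
qed simp

section \<open>Mertens sums over residue classes\<close>

definition mangoldt_progression_sum :: "(nat \<Rightarrow> bool) \<Rightarrow> nat \<Rightarrow> real" where
  "mangoldt_progression_sum P N = (\<Sum>n | n \<in> {1..N} \<and> P n. mangoldt n / real n)"

lemma mangoldt_progression_sum_altdef:
  "mangoldt_progression_sum P N = (\<Sum>n=1..N. if P n then mangoldt n / real n else 0)"
  unfolding mangoldt_progression_sum_def by (simp add: sum.If_cases Int_def)

lemma mangoldt_progression_sum_nonneg: "mangoldt_progression_sum P N \<ge> 0"
  unfolding mangoldt_progression_sum_def by (intro sum_nonneg) (simp add: mangoldt_nonneg)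

text \<open>Applied to the primes dividing \<open>k\<close>, to compare the coprime sum with the
  full one, and to the hypothetically finite set of primes in a progression.\<close>

lemma mangoldt_progression_sum_le_primes:
  assumes "\<And>n. Factorial_Ring.prime n \<Longrightarrow> P n \<Longrightarrow> n \<in> Q" and fin: "finite Q"
  shows "mangoldt_progression_sum P N \<le> 2 + (\<Sum>n\<in>Q. mangoldt n / real n)"
proof -
  have nn: "(mangoldt n :: real) / real n \<ge> 0" for n by (simp add: mangoldt_nonneg)
  have "mangoldt_progression_sum P N \<le>
      (\<Sum>n\<in>{n. n \<in> {1..N} \<and> \<not> Factorial_Ring.prime n} \<union> Q. mangoldt n / real n)"
    unfolding mangoldt_progression_sum_def
    using assms nn by (intro sum_mono2) auto
  also have "\<dots> \<le> (\<Sum>n | n \<in> {1..N} \<and> \<not> Factorial_Ring.prime n. mangoldt n / real n) + (\<Sum>n\<in>Q. mangoldt n / real n)"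
    using nn fin by (subst sum.union_inter[symmetric]) (auto intro!: sum_nonneg)
  also have "\<dots> \<le> 2 + (\<Sum>n\<in>Q. mangoldt n / real n)" using sum_mangoldt_nonprime_le by simp
  finally show ?thesis .
qed

lemma mangoldt_char_sum_principal:
  "mangoldt_char_sum (principal_char k) N = of_real (mangoldt_progression_sum (\<lambda>n. coprime n k) N)"
  unfolding mangoldt_char_sum_def principal_char_def mangoldt_progression_sum_altdef of_real_sum
  by (intro sum.cong refl) simp

lemma mangoldt_coprime_sum_bounds:
  assumes k: "k > 0"
  shows "N > 0 \<Longrightarrow> mangoldt_progression_sum (\<lambda>n. coprime n k) N \<le> ln N + 4"
    and "\<exists>C. \<forall>N>0. mangoldt_progression_sum (\<lambda>n. coprime n k) N \<ge> ln N - C"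
proof -
  have nn: "(mangoldt n :: real) / real n \<ge> 0" for n by (simp add: mangoldt_nonneg)
  show "mangoldt_progression_sum (\<lambda>n. coprime n k) N \<le> ln N + 4" if "N > 0"
  proof -
    have "mangoldt_progression_sum (\<lambda>n. coprime n k) N \<le> (\<Sum>n=1..N. mangoldt n / real n)"
      unfolding mangoldt_progression_sum_def using nn by (intro sum_mono2) auto
    thus ?thesis using sum_mangoldt_div_bounds(2)[OF that] by linarith
  qed
  define D where "D = (2::real) + (\<Sum>n | n dvd k. mangoldt n / real n)"
  have "mangoldt_progression_sum (\<lambda>n. coprime n k) N \<ge> ln N - (1 + D)" if "N > 0" for N
  proof -
    have "mangoldt_progression_sum (\<lambda>n. \<not> coprime n k) N \<le> D" unfolding D_def
      using k prime_imp_coprime by (intro mangoldt_progression_sum_le_primes) auto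
    moreover have "(\<Sum>n=1..N. mangoldt n / real n) =
        mangoldt_progression_sum (\<lambda>n. coprime n k) N + mangoldt_progression_sum (\<lambda>n. \<not> coprime n k) N"
      unfolding mangoldt_progression_sum_altdef sum.distrib[symmetric] by (intro sum.cong) auto
    ultimately show ?thesis using sum_mangoldt_div_bounds(1)[OF that] by linarith
  qed
  thus "\<exists>C. \<forall>N>0. mangoldt_progression_sum (\<lambda>n. coprime n k) N \<ge> ln N - C" by blast
qed

text \<open>Orthogonality with a shift: \<open>b = 1\<close> serves the positivity argument, and
  \<open>b\<close> inverse to \<open>a\<close> selects the progression of \<open>a\<close>.\<close>

lemma sum_chars_mangoldt:
  assumes k: "k > 0"
  shows "(\<Sum>\<chi>\<in>dirichlet_chars k. \<chi> b * mangoldt_char_sum \<chi> N)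
    = of_real (card (dirichlet_chars k) * mangoldt_progression_sum (\<lambda>n. [b * n = 1] (mod k)) N)"
proof -
  have "(\<Sum>\<chi>\<in>dirichlet_chars k. \<chi> b * mangoldt_char_sum \<chi> N)
      = (\<Sum>n=1..N. \<Sum>\<chi>\<in>dirichlet_chars k. \<chi> b * (\<chi> n * mangoldt n / of_nat n))"
    unfolding mangoldt_char_sum_def sum_distrib_left by (rule sum.swap)
  also have "\<dots> = (\<Sum>n=1..N. (\<Sum>\<chi>\<in>dirichlet_chars k. \<chi> (b * n)) * (mangoldt n / of_nat n))"
    unfolding sum_distrib_right by (intro sum.cong refl) (simp add: char_mult[OF k])
  also have "\<dots> = of_real (card (dirichlet_chars k) * mangoldt_progression_sum (\<lambda>n. [b * n = 1] (mod k)) N)"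
    unfolding sum_dirichlet_chars[OF k] mangoldt_progression_sum_altdef sum_distrib_left of_real_sum
    by (intro sum.cong refl) simp
  finally show ?thesis .
qed

lemma ln_unbounded: "\<exists>N>0. ln (real N) > C"
proof -
  obtain N where N: "exp C < real N" using reals_Archimedean2 by blast
  hence "real N > 0" using exp_gt_zero[of C] by linarith
  thus ?thesis using N ln_less_cancel_iff[of "exp C" "real N"] by (intro exI[of _ N]) auto
qed

text \<open>A vanishing \<chi> is not real, so its conjugate \<psi> is a second vanishing character.
  Against the \<open>ln N\<close> of the principal character both contribute \<open>- ln N\<close>,
  and the nonnegative total would be at most \<open>- ln N + O(1)\<close>.\<close>

lemma L_one_nonzero:
  assumes k: "k > 0" and \<chi>: "\<chi> \<in> dirichlet_chars k" and nonprincipal: "\<chi> \<noteq> principal_char k"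
  shows "L_one \<chi> \<noteq> 0"
proof
  assume L0: "L_one \<chi> = 0"
  define \<psi> where "\<psi> n = cnj (\<chi> n)" for n
  have \<psi>: "\<psi> \<in> dirichlet_chars k" unfolding \<psi>_def by (rule cnj_char_in[OF k \<chi>])
  have "\<psi> \<noteq> principal_char k"
  proof
    assume *: "\<psi> = principal_char k"
    have "\<chi> n = principal_char k n" for n
      using fun_cong[OF *, of n] unfolding \<psi>_def principal_char_def by (auto split: if_splits)
    thus False using nonprincipal by auto
  qed
  have "\<psi> \<noteq> \<chi>" using L_one_real_nonzero[OF k \<chi> nonprincipal] L0 unfolding \<psi>_def by metis
  have "char_partial_L \<psi> = (\<lambda>N. cnj (char_partial_L \<chi> N))"
    unfolding char_partial_L_def \<psi>_def by simp
  hence "char_partial_L \<psi> \<longlonglongrightarrow> cnj (L_one \<chi>)"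
    using tendsto_cnj[OF char_partial_L_tendsto[OF k \<chi> nonprincipal]] by simp
  hence L0': "L_one \<psi> = 0"
    using char_partial_L_tendsto[OF k \<psi> \<open>\<psi> \<noteq> principal_char k\<close>] LIMSEQ_unique L0 by fastforce
  \<comment> \<open>The remaining characters need only an upper bound, which holds whether or not
    they vanish at 1.\<close>
  have ub: "\<exists>C. \<forall>N>0. Re (mangoldt_char_sum \<phi> N) \<le> C" if \<phi>: "\<phi> \<in> dirichlet_chars k" "\<phi> \<noteq> principal_char k" for \<phi>
  proof (cases "L_one \<phi> = 0")
    case True
    have "Re (mangoldt_char_sum \<phi> N) \<le> 2 * k" if "N > 0" for N
    proof -
      have "Re (mangoldt_char_sum \<phi> N + of_real (ln N)) \<le> 2 * k"
        using mangoldt_char_sum_L_zero[OF k \<phi> True that] complex_Re_le_cmod order_trans by blast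
      moreover have "ln (real N) \<ge> 0" using that by simp
      ultimately show ?thesis by simp
    qed
    thus ?thesis by blast
  next
    case False
    thus ?thesis using mangoldt_char_sum_bounded[OF k \<phi> False] complex_Re_le_cmod order_trans by meson
  qed
  let ?X = "dirichlet_chars k" and ?p = "principal_char k"
  let ?Y = "?X - {?p, \<chi>, \<psi>}"
  have "\<forall>\<phi>\<in>?Y. \<exists>C. \<forall>N>0. Re (mangoldt_char_sum \<phi> N) \<le> C" using ub by auto
  then obtain C where C: "\<And>\<phi> N. \<phi> \<in> ?Y \<Longrightarrow> N > 0 \<Longrightarrow> Re (mangoldt_char_sum \<phi> N) \<le> C \<phi>" by metis
  have "ln N \<le> 4 + 4 * k + sum C ?Y" if N: "N > 0" for N :: nat
  proof -
    have "0 \<le> Re (\<Sum>\<phi>\<in>?X. \<phi> 1 * mangoldt_char_sum \<phi> N)"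
      unfolding sum_chars_mangoldt[OF k] Re_complex_of_real
      by (intro mult_nonneg_nonneg mangoldt_progression_sum_nonneg) auto
    also have "\<dots> = (\<Sum>\<phi>\<in>?X. Re (mangoldt_char_sum \<phi> N))"
      unfolding Re_sum
    proof (intro sum.cong refl)
      fix \<phi> assume "\<phi> \<in> ?X"
      hence "\<phi> 1 = 1" using char_1[OF k, of \<phi>] by simp
      thus "Re (\<phi> 1 * mangoldt_char_sum \<phi> N) = Re (mangoldt_char_sum \<phi> N)" by simp
    qed
    also have "\<dots> = (\<Sum>\<phi>\<in>{?p, \<chi>, \<psi>}. Re (mangoldt_char_sum \<phi> N)) + (\<Sum>\<phi>\<in>?Y. Re (mangoldt_char_sum \<phi> N))"
      using \<chi> \<psi> finite_dirichlet_chars[OF k] by (subst sum.subset_diff[of "{?p, \<chi>, \<psi>}"]) auto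
    also have "(\<Sum>\<phi>\<in>?Y. Re (mangoldt_char_sum \<phi> N)) \<le> sum C ?Y" using C N by (intro sum_mono) auto
    also have "(\<Sum>\<phi>\<in>{?p, \<chi>, \<psi>}. Re (mangoldt_char_sum \<phi> N)) =
        Re (mangoldt_char_sum ?p N) + Re (mangoldt_char_sum \<chi> N) + Re (mangoldt_char_sum \<psi> N)"
      using nonprincipal \<open>\<psi> \<noteq> ?p\<close> \<open>\<psi> \<noteq> \<chi>\<close> by auto
    also have "Re (mangoldt_char_sum ?p N) \<le> ln N + 4"
      unfolding mangoldt_char_sum_principal Re_complex_of_real by (rule mangoldt_coprime_sum_bounds(1)[OF k N])
    also have "Re (mangoldt_char_sum \<chi> N) \<le> 2 * k - ln N"
      using complex_Re_le_cmod[of "mangoldt_char_sum \<chi> N + of_real (ln N)"]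
        mangoldt_char_sum_L_zero[OF k \<chi> nonprincipal L0 N] by simp
    also have "Re (mangoldt_char_sum \<psi> N) \<le> 2 * k - ln N"
      using complex_Re_le_cmod[of "mangoldt_char_sum \<psi> N + of_real (ln N)"]
        mangoldt_char_sum_L_zero[OF k \<psi> \<open>\<psi> \<noteq> ?p\<close> L0' N] by simp
    finally show ?thesis by simp
  qed
  thus False using ln_unbounded[of "4 + 4 * k + sum C ?Y"] by (meson not_le)
qed

text \<open>With finitely many primes the sum over the progression stays bounded, whereas the
  principal character forces \<open>ln N + O(1)\<close> and all others contribute boundedly.\<close>

theorem dirichlet_primes_infinite:
  fixes a k :: nat
  assumes k: "k > 0" and a: "coprime a k"
  shows "infinite {p. Factorial_Ring.prime p \<and> [p = a] (mod k)}"
proof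
  assume fin: "finite {p. Factorial_Ring.prime p \<and> [p = a] (mod k)}" (is "finite ?Q")
  obtain b where b: "[a * b = 1] (mod k)" using cong_solve_coprime_nat[OF a] by auto
  have ba: "[n = a] (mod k)" if "[b * n = 1] (mod k)" for n
  proof -
    have "[a * b * n = a] (mod k)" using cong_mult[OF cong_refl that, of a] by (simp add: mult.assoc)
    moreover have "[a * b * n = n] (mod k)" using cong_mult[OF b cong_refl, of n] by simp
    ultimately show ?thesis by (rule cong_trans[OF cong_sym, rotated])
  qed
  let ?X = "dirichlet_chars k" and ?p = "principal_char k"
  define D where "D = (2::real) + (\<Sum>n\<in>?Q. mangoldt n / real n)"
  have "mangoldt_progression_sum (\<lambda>n. [b * n = 1] (mod k)) N \<le> D" for N
    unfolding D_def by (rule mangoldt_progression_sum_le_primes[OF _ fin]) (use ba in blast)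
  hence ub: "card ?X * mangoldt_progression_sum (\<lambda>n. [b * n = 1] (mod k)) N \<le> card ?X * D" for N
    by (intro mult_left_mono) auto
  have "\<forall>\<phi>\<in>?X - {?p}. \<exists>C. \<forall>N. norm (mangoldt_char_sum \<phi> N) \<le> C"
  proof
    fix \<phi> assume "\<phi> \<in> ?X - {?p}"
    hence \<phi>: "\<phi> \<in> ?X" "\<phi> \<noteq> ?p" by auto
    show "\<exists>C. \<forall>N. norm (mangoldt_char_sum \<phi> N) \<le> C"
      by (rule mangoldt_char_sum_bounded[OF k \<phi> L_one_nonzero[OF k \<phi>]])
  qed
  then obtain C where C: "\<And>\<phi> N. \<phi> \<in> ?X - {?p} \<Longrightarrow> norm (mangoldt_char_sum \<phi> N) \<le> C \<phi>" by metis
  obtain E where E: "\<And>N. N > 0 \<Longrightarrow> mangoldt_progression_sum (\<lambda>n. coprime n k) N \<ge> ln N - E"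
    using mangoldt_coprime_sum_bounds(2)[OF k] by blast
  have "coprime b k" using cong_imp_coprime[OF cong_sym[OF b]] by simp
  have "ln N \<le> E + card ?X * D + sum C (?X - {?p})" if N: "N > 0" for N :: nat
  proof -
    have "card ?X * D \<ge> Re (\<Sum>\<phi>\<in>?X. \<phi> b * mangoldt_char_sum \<phi> N)"
      unfolding sum_chars_mangoldt[OF k] Re_complex_of_real by (rule ub)
    also have "(\<Sum>\<phi>\<in>?X. \<phi> b * mangoldt_char_sum \<phi> N) =
        ?p b * mangoldt_char_sum ?p N + (\<Sum>\<phi>\<in>?X - {?p}. \<phi> b * mangoldt_char_sum \<phi> N)"
      using finite_dirichlet_chars[OF k] by (intro sum.remove) auto
    also have "?p b * mangoldt_char_sum ?p N = of_real (mangoldt_progression_sum (\<lambda>n. coprime n k) N)"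
      using \<open>coprime b k\<close> by (simp add: mangoldt_char_sum_principal principal_char_def)
    finally have 1: "mangoldt_progression_sum (\<lambda>n. coprime n k) N
        + Re (\<Sum>\<phi>\<in>?X - {?p}. \<phi> b * mangoldt_char_sum \<phi> N) \<le> card ?X * D" by simp
    have "norm (\<Sum>\<phi>\<in>?X - {?p}. \<phi> b * mangoldt_char_sum \<phi> N) \<le> sum C (?X - {?p})"
    proof (rule sum_norm_le)
      fix \<phi> assume \<phi>: "\<phi> \<in> ?X - {?p}"
      have "norm (\<phi> b * mangoldt_char_sum \<phi> N) \<le> 1 * C \<phi>" unfolding norm_mult
        using \<phi> norm_char_le_1[OF k, of \<phi> b] by (intro mult_mono C) auto
      thus "norm (\<phi> b * mangoldt_char_sum \<phi> N) \<le> C \<phi>" by simp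
    qed
    hence "Re (\<Sum>\<phi>\<in>?X - {?p}. \<phi> b * mangoldt_char_sum \<phi> N) \<ge> - sum C (?X - {?p})"
      using abs_Re_le_cmod[of "\<Sum>\<phi>\<in>?X - {?p}. \<phi> b * mangoldt_char_sum \<phi> N"] by linarith
    thus ?thesis using 1 E[OF N] by linarith
  qed
  thus False using ln_unbounded[of "E + card ?X * D + sum C (?X - {?p})"] by (meson not_le)
qed

section \<open>Factorization of $X^n - 1$ over a prime field\<close>

lemma prime_dvd_binomial:
  fixes p i :: nat
  assumes "Factorial_Ring.prime p" "0 < i" "i < p"
  shows "p dvd (p choose i)"
proof -
  have "i * (p choose i) = p * ((p - 1) choose (i - 1))" using assms by (intro times_binomial_minus1_eq)
  hence "p dvd i * (p choose i)" by simp
  thus ?thesis using assms by (auto simp: prime_dvd_mult_iff dest: dvd_imp_le)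
qed

lemma (in cring) binomial_ring:
  assumes a: "a \<in> carrier R" and b: "b \<in> carrier R"
  shows "(a \<oplus> b) [^] (n::nat) = (\<Oplus>i\<in>{..n}. [(n choose i)] \<cdot> (a [^] i \<otimes> b [^] (n - i)))"
proof (induction n)
  case 0
  thus ?case by (simp add: Pi_def)
next
  case (Suc n)
  define T where "T n i = [(n choose i)] \<cdot> (a [^] i \<otimes> b [^] (n - i))" for n i :: nat
  have T: "T n i \<in> carrier R" for n i unfolding T_def using a b by simp
  have rec: "T (Suc n) (Suc i) = T n i \<otimes> a \<oplus> T n (Suc i) \<otimes> b" if "i \<le> n" for i
  proof -
    have 1: "T n i \<otimes> a = [(n choose i)] \<cdot> (a [^] Suc i \<otimes> b [^] (n - i))"
    proof -
      have "a [^] i \<otimes> b [^] (n - i) \<otimes> a = a [^] Suc i \<otimes> b [^] (n - i)" using a b by (simp add: m_ac)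
      thus ?thesis unfolding T_def using a b by (simp add: add_pow_ldistr)
    qed
    have 2: "T n (Suc i) \<otimes> b = [(n choose Suc i)] \<cdot> (a [^] Suc i \<otimes> b [^] (n - i))"
    proof (cases "i = n")
      case True
      thus ?thesis unfolding T_def using a b by (simp add: binomial_eq_0)
    next
      case False
      hence "n - i = Suc (n - Suc i)" using that by simp
      thus ?thesis unfolding T_def using a b by (simp add: add_pow_ldistr m_assoc)
    qed
    show ?thesis unfolding 1 2 unfolding T_def using a b by (simp add: add.nat_pow_mult)
  qed
  have T0: "T (Suc n) 0 = T n 0 \<otimes> b" unfolding T_def using a b by simp
  have Tn: "T n (Suc n) = \<zero>" unfolding T_def by (simp add: binomial_eq_0)
  have "(a \<oplus> b) [^] Suc n = (\<Oplus>i\<in>{..n}. T n i) \<otimes> (a \<oplus> b)"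
    using Suc unfolding T_def by simp
  also have "\<dots> = (\<Oplus>i\<in>{..n}. T n i) \<otimes> a \<oplus> (\<Oplus>i\<in>{..n}. T n i) \<otimes> b"
    using a b T by (intro r_distr finsum_closed) auto
  also have "(\<Oplus>i\<in>{..n}. T n i) \<otimes> a = (\<Oplus>i\<in>{..n}. T n i \<otimes> a)"
    using a T by (intro finsum_ldistr) auto
  also have "(\<Oplus>i\<in>{..n}. T n i) \<otimes> b = (\<Oplus>i\<in>{..Suc n}. T n i) \<otimes> b"
    using T Tn by (subst finsum_Suc) auto
  also have "\<dots> = (\<Oplus>i\<in>{..Suc n}. T n i \<otimes> b)"
    using b T by (intro finsum_ldistr) auto
  also have "\<dots> = (\<Oplus>i\<in>{..n}. T n (Suc i) \<otimes> b) \<oplus> T n 0 \<otimes> b"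
    using b T by (subst finsum_Suc2) auto
  also have "(\<Oplus>i\<in>{..n}. T n i \<otimes> a) \<oplus> ((\<Oplus>i\<in>{..n}. T n (Suc i) \<otimes> b) \<oplus> T n 0 \<otimes> b)
      = ((\<Oplus>i\<in>{..n}. T n i \<otimes> a) \<oplus> (\<Oplus>i\<in>{..n}. T n (Suc i) \<otimes> b)) \<oplus> T n 0 \<otimes> b"
    using a b T by (intro a_assoc[symmetric] finsum_closed) auto
  also have "(\<Oplus>i\<in>{..n}. T n i \<otimes> a) \<oplus> (\<Oplus>i\<in>{..n}. T n (Suc i) \<otimes> b) = (\<Oplus>i\<in>{..n}. T n i \<otimes> a \<oplus> T n (Suc i) \<otimes> b)"
    using a b T by (intro finsum_addf[symmetric]) auto
  also have "\<dots> = (\<Oplus>i\<in>{..n}. T (Suc n) (Suc i))"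
    using T rec by (intro finsum_cong') auto
  also have "(\<Oplus>i\<in>{..n}. T (Suc n) (Suc i)) \<oplus> T n 0 \<otimes> b = (\<Oplus>i\<in>{..Suc n}. T (Suc n) i)"
    unfolding T0[symmetric] using T by (subst finsum_Suc2) auto
  finally show ?case unfolding T_def .
qed

lemma (in cring) freshman_dream:
  fixes p :: nat
  assumes p: "Factorial_Ring.prime p" and char: "\<And>x. x \<in> carrier R \<Longrightarrow> [p] \<cdot> x = \<zero>"
    and a: "a \<in> carrier R" and b: "b \<in> carrier R"
  shows "(a \<oplus> b) [^] p = a [^] p \<oplus> b [^] p"
proof -
  obtain q where q: "p = Suc (Suc q)"
    using prime_ge_2_nat[OF p] by (metis Suc_le_D numeral_2_eq_2 Suc_le_mono)
  define T where "T i = [(p choose i)] \<cdot> (a [^] i \<otimes> b [^] (p - i))" for i :: nat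
  have T: "T i \<in> carrier R" for i unfolding T_def using a b by simp
  have T0: "T (Suc i) = \<zero>" if "i \<le> q" for i
  proof -
    have "p dvd p choose Suc i" using p that q by (intro prime_dvd_binomial) auto
    then obtain m where "p choose Suc i = p * m" by auto
    hence "T (Suc i) = [m] \<cdot> ([p] \<cdot> (a [^] Suc i \<otimes> b [^] (p - Suc i)))"
      unfolding T_def using a b by (simp add: add.nat_pow_pow)
    thus ?thesis using char[of "a [^] Suc i \<otimes> b [^] (p - Suc i)"] a b by simp
  qed
  have "(a \<oplus> b) [^] p = (\<Oplus>i\<in>{..Suc (Suc q)}. T i)"
    unfolding T_def using binomial_ring[OF a b, of p] q by simp
  also have "\<dots> = T (Suc (Suc q)) \<oplus> ((\<Oplus>i\<in>{..q}. T (Suc i)) \<oplus> T 0)"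
    using T by (subst finsum_Suc, simp, subst finsum_Suc2) auto
  also have "(\<Oplus>i\<in>{..q}. T (Suc i)) = (\<Oplus>i\<in>{..q}. \<zero>)"
    using T0 by (intro finsum_cong') auto
  also have "\<dots> = \<zero>" by simp
  finally show ?thesis unfolding T_def using a b q by simp
qed

lemma (in cring) freshman_dream_power:
  fixes p :: nat
  assumes p: "Factorial_Ring.prime p" and char: "\<And>x. x \<in> carrier R \<Longrightarrow> [p] \<cdot> x = \<zero>"
    and a: "a \<in> carrier R" and b: "b \<in> carrier R"
  shows "(a \<oplus> b) [^] (p ^ r) = a [^] (p ^ r) \<oplus> b [^] (p ^ r)"
proof (induction r)
  case 0
  thus ?case using a b by simp
next
  case (Suc r)
  have "(a \<oplus> b) [^] (p ^ Suc r) = ((a \<oplus> b) [^] (p ^ r)) [^] p"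
    using a b by (simp add: nat_pow_pow mult.commute)
  also have "\<dots> = (a [^] (p ^ r)) [^] p \<oplus> (b [^] (p ^ r)) [^] p"
    unfolding Suc using a b by (intro freshman_dream[OF p char]) auto
  finally show ?case using a b by (simp add: nat_pow_pow mult.commute)
qed

text \<open>Additivity is applied to \<open>a = (a \<ominus> \<one>) \<oplus> \<one>\<close>, which
  avoids determining powers of -1 and treats \<open>p = 2\<close> uniformly.\<close>

lemma (in cring) freshman_dream_power_minus_one:
  fixes p :: nat
  assumes p: "Factorial_Ring.prime p" and char: "\<And>x. x \<in> carrier R \<Longrightarrow> [p] \<cdot> x = \<zero>"
    and a: "a \<in> carrier R"
  shows "(a \<ominus> \<one>) [^] (p ^ r) = a [^] (p ^ r) \<ominus> \<one>"
proof -
  let ?u = "a \<ominus> \<one>"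
  have u: "?u \<in> carrier R" using a by simp
  have "a = ?u \<oplus> \<one>" using a by algebra
  hence "a [^] (p ^ r) = ?u [^] (p ^ r) \<oplus> \<one> [^] (p ^ r)"
    using freshman_dream_power[OF p char u one_closed, of r] by simp
  hence "a [^] (p ^ r) = ?u [^] (p ^ r) \<oplus> \<one>" by simp
  moreover have "?u [^] (p ^ r) \<in> carrier R" using u by simp
  ultimately show ?thesis by algebra
qed

lemma (in cring) pow_minus_one_divides:
  assumes x: "x \<in> carrier R"
  shows "(x [^] e \<ominus> \<one>) divides (x [^] (e * m :: nat) \<ominus> \<one>)"
proof (induction m)
  case 0
  have "x [^] (e * 0) \<ominus> \<one> = (x [^] e \<ominus> \<one>) \<otimes> \<zero>" using x by (simp add: r_neg minus_eq)
  thus ?case using x by (intro dividesI[of \<zero>]) auto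
next
  case (Suc m)
  then obtain c where c: "c \<in> carrier R" "x [^] (e * m) \<ominus> \<one> = (x [^] e \<ominus> \<one>) \<otimes> c" by auto
  let ?u = "x [^] e" and ?v = "x [^] (e * m)"
  have uv: "?u \<in> carrier R" "?v \<in> carrier R" using x by auto
  have "x [^] (e * Suc m) \<ominus> \<one> = ?u \<otimes> ?v \<ominus> \<one>"
    using x by (simp add: nat_pow_mult)
  also have "\<dots> = ?u \<otimes> (?v \<ominus> \<one>) \<oplus> (?u \<ominus> \<one>)" using uv by algebra
  also have "\<dots> = (?u \<ominus> \<one>) \<otimes> (?u \<otimes> c \<oplus> \<one>)" unfolding c(2) using uv c(1) by algebra
  finally show ?case using uv c by (intro dividesI[of "?u \<otimes> c \<oplus> \<one>"]) auto
qed

section \<open>Polynomials over a field of prime order\<close>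

locale prime_field = field R for R (structure) +
  fixes p :: nat
  assumes prime_p: "Factorial_Ring.prime p" and card_p: "card (carrier R) = p"
begin

sublocale UP: principal_domain "poly_ring R"
  using univ_poly_is_principal[OF carrier_is_subfield] .

lemma finite_R: "finite (carrier R)"
  using card_p prime_gt_0_nat[OF prime_p] card_ge_0_finite[of "carrier R"] by simp

lemma char_p: "a \<in> carrier R \<Longrightarrow> [p] \<cdot> a = \<zero>"
  using add.pow_order_eq_1[of a] card_p unfolding order_def by simp

lemma pow_p: 
  assumes a: "a \<in> carrier R"
  shows "a [^] p = a"
proof (cases "a = \<zero>")
  case True
  thus ?thesis using prime_gt_0_nat[OF prime_p] by (simp add: nat_pow_zero)
next
  case False
  interpret M: group "Multiplicative_Group.mult_of R" by (rule field_mult_group)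
  have "a [^] (p - 1) = \<one>"
    using M.pow_order_eq_1[of a] a False order_mult_of[OF finite_R] card_p
    unfolding order_def Multiplicative_Group.nat_pow_mult_of by simp
  hence "a [^] (p - 1) \<otimes> a = a" using a by simp
  thus ?thesis using prime_gt_0_nat[OF prime_p] a by (metis Suc_diff_1 nat_pow_Suc)
qed

lemma pow_p_pow: "a \<in> carrier R \<Longrightarrow> a [^] (p ^ r) = a"
  by (induction r) (simp_all add: nat_pow_pow[symmetric] pow_p)

lemma const_hom: "ring_hom_ring R (poly_ring R) poly_of_const"
  using canonical_embedding_ring_hom[OF carrier_is_subring] by simp

lemma const_eq: "a \<noteq> \<zero> \<Longrightarrow> poly_of_const a = [a]"
  unfolding poly_of_const_def by simp

lemma poly_char_p:
  assumes f: "f \<in> carrier (poly_ring R)"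
  shows "[p] \<cdot>\<^bsub>poly_ring R\<^esub> f = \<zero>\<^bsub>poly_ring R\<^esub>"
proof -
  interpret h: ring_hom_ring R "poly_ring R" poly_of_const by (rule const_hom)
  have nat: "poly_of_const ([n] \<cdot> \<one>) = [n] \<cdot>\<^bsub>poly_ring R\<^esub> \<one>\<^bsub>poly_ring R\<^esub>" for n :: nat
    by (induction n) (simp_all add: h.hom_add)
  have "[p] \<cdot>\<^bsub>poly_ring R\<^esub> \<one>\<^bsub>poly_ring R\<^esub> = \<zero>\<^bsub>poly_ring R\<^esub>"
    using nat[of p] char_p[of \<one>] by simp
  hence "([p] \<cdot>\<^bsub>poly_ring R\<^esub> \<one>\<^bsub>poly_ring R\<^esub>) \<otimes>\<^bsub>poly_ring R\<^esub> f = \<zero>\<^bsub>poly_ring R\<^esub>"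
    using f by simp
  thus ?thesis using f UP.add_pow_ldistr[of "\<one>\<^bsub>poly_ring R\<^esub>" f p] by simp
qed

lemma const_pow:
  assumes a: "a \<in> carrier R - {\<zero>}"
  shows "[a] [^]\<^bsub>poly_ring R\<^esub> (p ^ r) = [a]"
proof -
  interpret h: ring_hom_ring R "poly_ring R" poly_of_const by (rule const_hom)
  have "poly_of_const a [^]\<^bsub>poly_ring R\<^esub> (p ^ r) = poly_of_const (a [^] (p ^ r))"
    using a by (simp add: h.hom_nat_pow)
  thus ?thesis using a by (simp add: pow_p_pow const_eq)
qed

lemma const_closed: "a \<in> carrier R - {\<zero>} \<Longrightarrow> [a] \<in> carrier (poly_ring R)"
  unfolding univ_poly_carrier[symmetric] by (rule const_is_polynomial)

lemma X_closed: "X \<in> carrier (poly_ring R)"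
  by (rule var_closed(1)[OF carrier_is_subring])

text \<open>Strips leading terms. The tail of a coefficient list may begin with zeros, so it is
  normalized before the induction hypothesis applies.\<close>

lemma poly_induct [consumes 1, case_names zero add]:
  assumes g: "g \<in> carrier (poly_ring R)"
    and zero: "Q \<zero>\<^bsub>poly_ring R\<^esub>"
    and add: "\<And>a n h. a \<in> carrier R - {\<zero>} \<Longrightarrow> h \<in> carrier (poly_ring R) \<Longrightarrow> Q h \<Longrightarrow>
      Q ([a] \<otimes>\<^bsub>poly_ring R\<^esub> X [^]\<^bsub>poly_ring R\<^esub> (n::nat) \<oplus>\<^bsub>poly_ring R\<^esub> h)"
  shows "Q g"
  using g
proof (induction "length g" arbitrary: g rule: less_induct)
  case less
  show ?case
  proof (cases g)
    case Nil
    thus ?thesis using zero by (simp add: univ_poly_zero)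
  next
    case (Cons a l)
    have pg: "polynomial (carrier R) (a # l)" using less(2) Cons univ_poly_carrier by blast
    hence a: "a \<in> carrier R - {\<zero>}" using lead_coeff_not_zero by blast
    have l: "set l \<subseteq> carrier R" using polynomial_incl[OF pg] by simp
    define h where "h = normalize l"
    have h: "h \<in> carrier (poly_ring R)"
      unfolding h_def using normalize_gives_polynomial[OF l] univ_poly_carrier by blast
    have "g = poly_add (monom a (length l)) l" using poly_add_monom[OF l a] Cons by simp
    also have "\<dots> = poly_add (monom a (length l)) h"
      unfolding h_def using a l by (intro poly_add_normalize(2) monom_in_carrier) auto
    also have "\<dots> = [a] \<otimes>\<^bsub>poly_ring R\<^esub> X [^]\<^bsub>poly_ring R\<^esub> (length l) \<oplus>\<^bsub>poly_ring R\<^esub> h"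
      unfolding monom_eq_var_pow[OF carrier_is_subring a] univ_poly_add ..
    finally have eq: "g = [a] \<otimes>\<^bsub>poly_ring R\<^esub> X [^]\<^bsub>poly_ring R\<^esub> (length l) \<oplus>\<^bsub>poly_ring R\<^esub> h" .
    have "length h < length g" unfolding h_def using normalize_length_le[of l] Cons by simp
    hence "Q h" using less(1)[OF _ h] by blast
    thus ?thesis unfolding eq by (rule add[OF a h])
  qed
qed

text \<open>Frobenius fixes every residue class modulo \<open>X\<^sup>e - 1\<close> because it fixes \<open>X\<close> and the constants.
  Both the squarefreeness of \<open>X\<^sup>e - 1\<close> and the degrees of its irreducible factors follow from this.\<close>

lemma X_pow_minus_one_divides_frobenius:
  assumes e: "e dvd p ^ r - 1" and g: "g \<in> carrier (poly_ring R)"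
  shows "(X [^]\<^bsub>poly_ring R\<^esub> e \<ominus>\<^bsub>poly_ring R\<^esub> \<one>\<^bsub>poly_ring R\<^esub>)
      divides\<^bsub>poly_ring R\<^esub> (g [^]\<^bsub>poly_ring R\<^esub> (p ^ r) \<ominus>\<^bsub>poly_ring R\<^esub> g)"
  using g
proof (induction g rule: poly_induct)
  case zero
  have "p ^ r \<noteq> 0" using prime_gt_0_nat[OF prime_p] by simp
  thus ?case using X_closed UP.divides_zero by (simp add: UP.nat_pow_zero UP.minus_eq)
next
  case (add a n h)
  let ?P = "poly_ring R"
  let ?m = "[a] \<otimes>\<^bsub>?P\<^esub> X [^]\<^bsub>?P\<^esub> n"
  let ?f = "X [^]\<^bsub>?P\<^esub> e \<ominus>\<^bsub>?P\<^esub> \<one>\<^bsub>?P\<^esub>"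
  note c = const_closed[OF add(1)]
  have Xn: "X [^]\<^bsub>?P\<^esub> k \<in> carrier ?P" for k :: nat using X_closed by simp
  obtain t where t: "p ^ r - 1 = e * t" using e by auto
  have q: "n * p ^ r = n + n * (p ^ r - 1)"
  proof -
    have "p ^ r = 1 + (p ^ r - 1)" using prime_gt_0_nat[OF prime_p] by simp
    thus ?thesis by (metis add_mult_distrib2 mult_1_right)
  qed
  have "?m [^]\<^bsub>?P\<^esub> (p ^ r) = [a] \<otimes>\<^bsub>?P\<^esub> X [^]\<^bsub>?P\<^esub> (n * p ^ r)"
    using c Xn X_closed by (simp add: UP.nat_pow_distrib const_pow[OF add(1)] UP.nat_pow_pow)
  also have "\<dots> = ?m \<otimes>\<^bsub>?P\<^esub> X [^]\<^bsub>?P\<^esub> (n * (p ^ r - 1))"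
    unfolding q using c Xn X_closed by (simp add: UP.nat_pow_mult[symmetric] UP.m_assoc)
  finally have "?m [^]\<^bsub>?P\<^esub> (p ^ r) \<ominus>\<^bsub>?P\<^esub> ?m = ?m \<otimes>\<^bsub>?P\<^esub> (X [^]\<^bsub>?P\<^esub> (e * (n * t)) \<ominus>\<^bsub>?P\<^esub> \<one>\<^bsub>?P\<^esub>)"
    using c Xn[of n] Xn[of "n * (p ^ r - 1)"] unfolding t by (simp add: mult.left_commute) algebra
  moreover have "?f divides\<^bsub>?P\<^esub> (X [^]\<^bsub>?P\<^esub> (e * (n * t)) \<ominus>\<^bsub>?P\<^esub> \<one>\<^bsub>?P\<^esub>)"
    by (rule UP.pow_minus_one_divides[OF X_closed])
  ultimately have dm: "?f divides\<^bsub>?P\<^esub> (?m [^]\<^bsub>?P\<^esub> (p ^ r) \<ominus>\<^bsub>?P\<^esub> ?m)"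
    using c Xn by (simp add: UP.divides_prod_l)
  obtain u where u: "u \<in> carrier ?P" "?m [^]\<^bsub>?P\<^esub> (p ^ r) \<ominus>\<^bsub>?P\<^esub> ?m = ?f \<otimes>\<^bsub>?P\<^esub> u" using dm by auto
  obtain v where v: "v \<in> carrier ?P" "h [^]\<^bsub>?P\<^esub> (p ^ r) \<ominus>\<^bsub>?P\<^esub> h = ?f \<otimes>\<^bsub>?P\<^esub> v" using add(3) by auto
  have m: "?m \<in> carrier ?P" "?f \<in> carrier ?P" using c Xn by auto
  have "(?m \<oplus>\<^bsub>?P\<^esub> h) [^]\<^bsub>?P\<^esub> (p ^ r) = ?m [^]\<^bsub>?P\<^esub> (p ^ r) \<oplus>\<^bsub>?P\<^esub> h [^]\<^bsub>?P\<^esub> (p ^ r)"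
    by (rule UP.freshman_dream_power[OF prime_p poly_char_p m(1) add(2)])
  moreover have "A \<oplus>\<^bsub>?P\<^esub> B \<ominus>\<^bsub>?P\<^esub> (C \<oplus>\<^bsub>?P\<^esub> D) = (A \<ominus>\<^bsub>?P\<^esub> C) \<oplus>\<^bsub>?P\<^esub> (B \<ominus>\<^bsub>?P\<^esub> D)"
    if "A \<in> carrier ?P" "B \<in> carrier ?P" "C \<in> carrier ?P" "D \<in> carrier ?P" for A B C D
    using that by algebra
  ultimately have "(?m \<oplus>\<^bsub>?P\<^esub> h) [^]\<^bsub>?P\<^esub> (p ^ r) \<ominus>\<^bsub>?P\<^esub> (?m \<oplus>\<^bsub>?P\<^esub> h) = ?f \<otimes>\<^bsub>?P\<^esub> u \<oplus>\<^bsub>?P\<^esub> ?f \<otimes>\<^bsub>?P\<^esub> v"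
    using m(1) add(2) u(2) v(2) by simp
  also have "\<dots> = ?f \<otimes>\<^bsub>?P\<^esub> (u \<oplus>\<^bsub>?P\<^esub> v)" using u v m(2) by (simp add: UP.r_distr)
  finally show ?case using u v by (intro dividesI[of "u \<oplus>\<^bsub>?P\<^esub> v"]) auto
qed

end

context prime_field
begin

lemmas subfield_R = carrier_is_subfield and subring_R = carrier_is_subring

definition X_pow_m1 :: "nat \<Rightarrow> 'a list" where
  "X_pow_m1 n = X [^]\<^bsub>poly_ring R\<^esub> n \<ominus>\<^bsub>poly_ring R\<^esub> \<one>\<^bsub>poly_ring R\<^esub>"

lemma X_pow_m1_closed: "X_pow_m1 n \<in> carrier (poly_ring R)"
  unfolding X_pow_m1_def using X_closed by simp

lemma X_pow_m1_divides: "e dvd n \<Longrightarrow> X_pow_m1 e divides\<^bsub>poly_ring R\<^esub> X_pow_m1 n"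
  unfolding X_pow_m1_def using UP.pow_minus_one_divides[OF X_closed] by (elim dvdE) simp

lemma degree_X_pow_m1:
  assumes "n > 0"
  shows "X_pow_m1 n \<noteq> []" "degree (X_pow_m1 n) = n"
proof -
  have pX: "polynomial (carrier R) (X [^]\<^bsub>poly_ring R\<^esub> n)" and p1: "polynomial (carrier R) (\<ominus>\<^bsub>poly_ring R\<^esub> \<one>\<^bsub>poly_ring R\<^esub>)"
    using X_closed by (simp_all add: univ_poly_carrier)
  have dX: "degree (X [^]\<^bsub>poly_ring R\<^esub> n) = n"
    using polynomial_pow_degree[OF X_closed, of n] by (simp add: var_def)
  have d1: "degree (\<ominus>\<^bsub>poly_ring R\<^esub> \<one>\<^bsub>poly_ring R\<^esub>) = 0"
    using univ_poly_a_inv_degree[OF subring_R UP.one_closed] by (simp add: univ_poly_one)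
  have "degree (X_pow_m1 n) = max (degree (X [^]\<^bsub>poly_ring R\<^esub> n)) (degree (\<ominus>\<^bsub>poly_ring R\<^esub> \<one>\<^bsub>poly_ring R\<^esub>))"
    unfolding X_pow_m1_def a_minus_def univ_poly_add
    using assms by (intro poly_add_degree_eq[OF subring_R pX p1]) (simp only: dX d1)
  thus deg: "degree (X_pow_m1 n) = n" unfolding dX d1 by simp
  show "X_pow_m1 n \<noteq> []" using deg assms by auto
qed

lemma pdivides_divides: "f pdivides g \<longleftrightarrow> f divides\<^bsub>poly_ring R\<^esub> g"
  unfolding pdivides_def ..

lemma degree_mult:
  assumes "f \<in> carrier (poly_ring R)" "g \<in> carrier (poly_ring R)" "f \<noteq> []" "g \<noteq> []"
  shows "degree (f \<otimes>\<^bsub>poly_ring R\<^esub> g) = degree f + degree g"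
  using poly_mult_degree_eq[OF subring_R, of f g] assms
  unfolding univ_poly_mult univ_poly_carrier by simp

section \<open>Squarefree polynomials and their monic irreducible divisors\<close>

definition squarefree_poly :: "'a list \<Rightarrow> bool" where
  "squarefree_poly f \<longleftrightarrow> (\<forall>Q\<in>carrier (poly_ring R). pirreducible (carrier R) Q \<longrightarrow>
     \<not> (Q \<otimes>\<^bsub>poly_ring R\<^esub> Q) divides\<^bsub>poly_ring R\<^esub> f)"

lemma squarefree_poly_divides:
  assumes "squarefree_poly f" "g divides\<^bsub>poly_ring R\<^esub> f" "g \<in> carrier (poly_ring R)"
  shows "squarefree_poly g"
  unfolding squarefree_poly_def
proof (intro ballI impI notI)
  fix Q assume Q: "Q \<in> carrier (poly_ring R)" "pirreducible (carrier R) Q"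
    and "(Q \<otimes>\<^bsub>poly_ring R\<^esub> Q) divides\<^bsub>poly_ring R\<^esub> g"
  hence "(Q \<otimes>\<^bsub>poly_ring R\<^esub> Q) divides\<^bsub>poly_ring R\<^esub> f"
    using UP.divides_trans[OF _ assms(2)] by simp
  thus False using assms(1) Q unfolding squarefree_poly_def by blast
qed

text \<open>No derivatives: for \<open>r = totient n\<close>, the square of \<open>Q\<close> would
  divide \<open>Q ^ (p ^ r) - Q\<close>. As \<open>p ^ r\<close> is at least 2, it would then divide
  \<open>Q\<close>, making \<open>Q\<close> a unit.\<close>

lemma squarefree_X_pow_m1:
  assumes n: "n > 0" "\<not> p dvd n"
  shows "squarefree_poly (X_pow_m1 n)"
  unfolding squarefree_poly_def
proof (intro ballI impI notI)
  let ?P = "poly_ring R"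
  fix Q assume Q: "Q \<in> carrier ?P" "pirreducible (carrier R) Q"
    and dvd: "(Q \<otimes>\<^bsub>?P\<^esub> Q) divides\<^bsub>?P\<^esub> X_pow_m1 n"
  define r where "r = totient n"
  have r: "r > 0" using n by (simp add: r_def)
  have "coprime p n" using n(2) prime_p prime_imp_coprime by blast
  hence "[p ^ r = 1] (mod n)" unfolding r_def by (rule euler_theorem)
  hence nr: "n dvd p ^ r - 1" by (rule cong_to_1_nat)
  have "p ^ r > 1" using r prime_gt_1_nat[OF prime_p] one_less_power by blast
  then obtain s where s: "p ^ r = Suc (Suc s)" by (metis less_imp_Suc_add plus_nat.simps(2) One_nat_def)
  have "(Q \<otimes>\<^bsub>?P\<^esub> Q) divides\<^bsub>?P\<^esub> (Q [^]\<^bsub>?P\<^esub> (p ^ r) \<ominus>\<^bsub>?P\<^esub> Q)"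
    using UP.divides_trans[OF dvd] X_pow_minus_one_divides_frobenius[OF nr Q(1)] Q(1)
    unfolding X_pow_m1_def by auto
  then obtain c where c: "c \<in> carrier ?P" "Q [^]\<^bsub>?P\<^esub> (p ^ r) \<ominus>\<^bsub>?P\<^esub> Q = Q \<otimes>\<^bsub>?P\<^esub> Q \<otimes>\<^bsub>?P\<^esub> c" by auto
  let ?v = "Q [^]\<^bsub>?P\<^esub> s"
  have v: "?v \<in> carrier ?P" using Q by simp
  have "Q [^]\<^bsub>?P\<^esub> (p ^ r) = ?v \<otimes>\<^bsub>?P\<^esub> Q \<otimes>\<^bsub>?P\<^esub> Q" unfolding s using Q by simp
  hence eq: "?v \<otimes>\<^bsub>?P\<^esub> Q \<otimes>\<^bsub>?P\<^esub> Q \<ominus>\<^bsub>?P\<^esub> Q = Q \<otimes>\<^bsub>?P\<^esub> Q \<otimes>\<^bsub>?P\<^esub> c" using c(2) by simp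
  have "Q = ?v \<otimes>\<^bsub>?P\<^esub> Q \<otimes>\<^bsub>?P\<^esub> Q \<ominus>\<^bsub>?P\<^esub> (?v \<otimes>\<^bsub>?P\<^esub> Q \<otimes>\<^bsub>?P\<^esub> Q \<ominus>\<^bsub>?P\<^esub> Q)" using Q(1) v by algebra
  also have "\<dots> = Q \<otimes>\<^bsub>?P\<^esub> (Q \<otimes>\<^bsub>?P\<^esub> (?v \<ominus>\<^bsub>?P\<^esub> c))" unfolding eq using Q(1) v c(1) by algebra
  finally have "Q \<otimes>\<^bsub>?P\<^esub> \<one>\<^bsub>?P\<^esub> = Q \<otimes>\<^bsub>?P\<^esub> (Q \<otimes>\<^bsub>?P\<^esub> (?v \<ominus>\<^bsub>?P\<^esub> c))" using Q(1) by simp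
  moreover have "Q \<noteq> \<zero>\<^bsub>?P\<^esub>" using pirreducibleE(1)[OF subring_R Q] by (simp add: univ_poly_zero)
  ultimately have "\<one>\<^bsub>?P\<^esub> = Q \<otimes>\<^bsub>?P\<^esub> (?v \<ominus>\<^bsub>?P\<^esub> c)"
    using Q(1) v c(1) by (subst (asm) UP.m_lcancel) auto
  hence "Q \<in> Units ?P" using Q(1) v c(1) UP.m_comm unfolding Units_def
    by (auto intro!: bexI[of _ "?v \<ominus>\<^bsub>?P\<^esub> c"])
  thus False using pirreducibleE(2)[OF subring_R Q] by blast
qed

text \<open>Monicity selects one representative per class of associates, so that factors can be
  counted by equality.\<close>

definition monic_irred_divisors :: "'a list \<Rightarrow> 'a list set" where
  "monic_irred_divisors f = {Q \<in> carrier (poly_ring R). pirreducible (carrier R) Q \<and> lead_coeff Q = \<one> \<and>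
     Q divides\<^bsub>poly_ring R\<^esub> f}"

lemma exists_monic_irred_divisor:
  assumes f: "f \<in> carrier (poly_ring R)" "degree f > 0"
  shows "\<exists>Q. Q \<in> monic_irred_divisors f"
proof -
  let ?P = "poly_ring R"
  have f0: "f \<in> carrier ?P - {\<zero>\<^bsub>?P\<^esub>}" using f by (auto simp: univ_poly_zero)
  have fu: "f \<notin> Units ?P" using univ_poly_units'[OF subfield_R, of f] f(2) by auto
  obtain Q where Q: "Q \<in> carrier ?P" "pirreducible (carrier R) Q" "Q divides\<^bsub>?P\<^esub> f"
    by (rule UP.exists_irreducible_divisor[OF f0 fu])
  have Qn: "Q \<noteq> []" using pirreducibleE(1)[OF subring_R Q(1,2)] .
  have pQ: "polynomial (carrier R) Q" using Q(1) univ_poly_carrier by blast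
  define a where "a = lead_coeff Q"
  have a: "a \<in> carrier R - {\<zero>}"
    using pQ Qn lead_coeff_not_zero[of "carrier R" "hd Q" "tl Q"] unfolding a_def by simp
  hence ia: "inv a \<in> carrier R - {\<zero>}" "inv a \<otimes> a = \<one>"
    using subfield_m_inv[OF subfield_R, of a] by auto
  define S where "S = [inv a] \<otimes>\<^bsub>?P\<^esub> Q"
  have u: "[inv a] \<in> Units ?P" using univ_poly_units[OF subfield_R] ia by auto
  have c: "[inv a] \<in> carrier ?P" by (rule const_closed[OF ia(1)])
  have S: "S \<in> carrier ?P" unfolding S_def using c Q(1) by simp
  have assoc: "S \<sim>\<^bsub>?P\<^esub> Q"
    using associated_polynomials_iff[OF subfield_R S Q(1)] ia(1) unfolding S_def by blast
  have "pirreducible (carrier R) S"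
    unfolding ring_irreducible_def
  proof
    show "S \<noteq> \<zero>\<^bsub>?P\<^esub>"
      unfolding S_def using c Q(1) Qn ia(1) UP.integral[of "[inv a]" Q] by (auto simp: univ_poly_zero)
    show "irreducible ?P S"
      unfolding S_def using Q(2) u c Q(1) by (intro UP.irreducible_prod_lI) (auto simp: ring_irreducible_def)
  qed
  moreover have "lead_coeff S = \<one>"
  proof -
    have "lead_coeff S = inv a \<otimes> lead_coeff Q"
      unfolding S_def univ_poly_mult using c Qn
      by (subst poly_mult_lead_coeff[OF subring_R _ pQ]) (auto simp: univ_poly_carrier)
    thus ?thesis using ia(2) unfolding a_def[symmetric] by simp
  qed
  moreover have "S divides\<^bsub>?P\<^esub> f"
    using assoc Q(3) S UP.divides_trans unfolding associated_def by blast
  ultimately show ?thesis using S unfolding monic_irred_divisors_def by blast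
qed

lemma monic_irred_divides_eq:
  assumes Q: "Q \<in> carrier (poly_ring R)" "pirreducible (carrier R) Q" "lead_coeff Q = \<one>"
    and S: "S \<in> carrier (poly_ring R)" "pirreducible (carrier R) S" "lead_coeff S = \<one>"
    and dvd: "Q divides\<^bsub>poly_ring R\<^esub> S"
  shows "Q = S"
proof -
  let ?P = "poly_ring R"
  obtain c where c: "c \<in> carrier ?P" "S = Q \<otimes>\<^bsub>?P\<^esub> c" using dvd by auto
  have "c \<in> Units ?P"
    using pirreducibleE(3)[OF subring_R S(1,2) Q(1) c] pirreducibleE(2)[OF subring_R Q(1,2)] by blast
  then obtain k where k: "c = [k]" "k \<in> carrier R - {\<zero>}" using univ_poly_units[OF subfield_R] by auto
  have "lead_coeff S = lead_coeff Q \<otimes> lead_coeff c"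
    unfolding c(2) univ_poly_mult
    using Q(1) c(1) k(1) pirreducibleE(1)[OF subring_R Q(1,2)]
    by (intro poly_mult_lead_coeff[OF subring_R]) (auto simp: univ_poly_carrier)
  hence "k = \<one>" using Q(3) S(3) k by simp
  hence "c = \<one>\<^bsub>?P\<^esub>" unfolding k by (simp add: univ_poly_one)
  thus ?thesis using c Q(1) by simp
qed

lemma irred_divides_mult:
  assumes Q: "Q \<in> carrier (poly_ring R)" "pirreducible (carrier R) Q"
    and "f \<in> carrier (poly_ring R)" "g \<in> carrier (poly_ring R)"
    and "Q divides\<^bsub>poly_ring R\<^esub> (f \<otimes>\<^bsub>poly_ring R\<^esub> g)"
  shows "Q divides\<^bsub>poly_ring R\<^esub> f \<or> Q divides\<^bsub>poly_ring R\<^esub> g"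
  using pprimeE(3)[OF subfield_R Q(1), of f g] pprime_iff_pirreducible[OF subfield_R Q(1)] assms
  unfolding pdivides_divides by blast

text \<open>Induction removes one monic irreducible factor. All three claims rest on the same fact,
  that the cofactor loses exactly this factor, and are therefore proved together.\<close>

lemma squarefree_poly_divisors:
  assumes "f \<in> carrier (poly_ring R)" "f \<noteq> []" "squarefree_poly f"
  shows "finite (monic_irred_divisors f) \<and> degree f = (\<Sum>Q\<in>monic_irred_divisors f. degree Q) \<and>
    (\<forall>S\<subseteq>monic_irred_divisors f. \<exists>g\<in>carrier (poly_ring R). g divides\<^bsub>poly_ring R\<^esub> f \<and>
       g \<noteq> [] \<and> degree g = (\<Sum>Q\<in>S. degree Q))"
  using assms
proof (induction "degree f" arbitrary: f rule: less_induct)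
  case less
  let ?P = "poly_ring R"
  show ?case
  proof (cases "degree f = 0")
    case True
    have "monic_irred_divisors f = {}"
    proof (rule ccontr)
      assume "monic_irred_divisors f \<noteq> {}"
      then obtain Q where Q: "Q \<in> carrier ?P" "pirreducible (carrier R) Q" "Q divides\<^bsub>?P\<^esub> f"
        unfolding monic_irred_divisors_def by blast
      have "degree Q \<le> degree f"
        using pdivides_imp_degree_le[OF subring_R Q(1) less(2,3)] Q(3) unfolding pdivides_divides by blast
      thus False using pirreducible_degree[OF subfield_R Q(1,2)] True by simp
    qed
    thus ?thesis using True less(2)
      by (auto intro!: bexI[of _ "\<one>\<^bsub>?P\<^esub>"] UP.one_divides simp: univ_poly_one)
  next
    case False
    then obtain Q where Qm: "Q \<in> monic_irred_divisors f" using exists_monic_irred_divisor less(2) by blast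
    hence Q: "Q \<in> carrier ?P" "pirreducible (carrier R) Q" "lead_coeff Q = \<one>" "Q divides\<^bsub>?P\<^esub> f"
      unfolding monic_irred_divisors_def by auto
    then obtain h where h: "h \<in> carrier ?P" "f = Q \<otimes>\<^bsub>?P\<^esub> h" by auto
    have Qn: "Q \<noteq> []" using pirreducibleE(1)[OF subring_R Q(1,2)] .
    have hn: "h \<noteq> []" using h(2) less(3) UP.r_null[OF Q(1)] unfolding univ_poly_zero by auto
    have deg: "degree f = degree Q + degree h" unfolding h(2) by (rule degree_mult[OF Q(1) h(1) Qn hn])
    have hf: "h divides\<^bsub>?P\<^esub> f" using h Q(1) UP.m_comm by (intro dividesI[of Q]) auto
    have sqh: "squarefree_poly h" by (rule squarefree_poly_divides[OF less(4) hf h(1)])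
    have "degree h < degree f" using deg pirreducible_degree[OF subfield_R Q(1,2)] by simp
    note IH = less(1)[OF this h(1) hn sqh]
    \<comment> \<open>The only place where squarefreeness forces the removed factor to be new; it
      makes the degree sum additive.\<close>
    have Qh: "Q \<notin> monic_irred_divisors h"
    proof
      assume "Q \<in> monic_irred_divisors h"
      then obtain c where c: "c \<in> carrier ?P" "h = Q \<otimes>\<^bsub>?P\<^esub> c" unfolding monic_irred_divisors_def by auto
      have "(Q \<otimes>\<^bsub>?P\<^esub> Q) divides\<^bsub>?P\<^esub> f"
        using h c Q(1) by (intro dividesI[of c]) (auto simp: UP.m_assoc)
      thus False using less(4) Q(1,2) unfolding squarefree_poly_def by blast
    qed
    have ins: "monic_irred_divisors f = insert Q (monic_irred_divisors h)"
    proof (intro equalityI subsetI)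
      fix S assume "S \<in> monic_irred_divisors f"
      hence S: "S \<in> carrier ?P" "pirreducible (carrier R) S" "lead_coeff S = \<one>" "S divides\<^bsub>?P\<^esub> (Q \<otimes>\<^bsub>?P\<^esub> h)"
        unfolding monic_irred_divisors_def h(2) by auto
      from irred_divides_mult[OF S(1,2) Q(1) h(1) S(4)]
      show "S \<in> insert Q (monic_irred_divisors h)"
        using monic_irred_divides_eq[OF S(1-3) Q(1-3)] S unfolding monic_irred_divisors_def by auto
    next
      fix S assume "S \<in> insert Q (monic_irred_divisors h)"
      thus "S \<in> monic_irred_divisors f"
        using Qm UP.divides_trans[OF _ hf] unfolding monic_irred_divisors_def by auto
    qed
    have "\<exists>g\<in>carrier ?P. g divides\<^bsub>?P\<^esub> f \<and> g \<noteq> [] \<and> degree g = (\<Sum>Q\<in>S. degree Q)"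
      if S: "S \<subseteq> monic_irred_divisors f" for S
    proof (cases "Q \<in> S")
      case True
      have "S - {Q} \<subseteq> monic_irred_divisors h" using S unfolding ins by auto
      then obtain g where g: "g \<in> carrier ?P" "g divides\<^bsub>?P\<^esub> h" "g \<noteq> []" "degree g = (\<Sum>Q\<in>S - {Q}. degree Q)"
        using IH by blast
      have "finite S" using S IH unfolding ins by (auto intro: finite_subset)
      hence "degree (Q \<otimes>\<^bsub>?P\<^esub> g) = (\<Sum>Q\<in>S. degree Q)"
        unfolding degree_mult[OF Q(1) g(1) Qn g(3)] g(4) using True by (subst sum.remove[of S Q]) auto
      moreover have "(Q \<otimes>\<^bsub>?P\<^esub> g) divides\<^bsub>?P\<^esub> f"
        unfolding h(2) using g(1,2) Q(1) h(1) by (intro UP.divides_mult_lI) auto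
      moreover have "Q \<otimes>\<^bsub>?P\<^esub> g \<noteq> []"
        using UP.integral[of Q g] Q(1) g(1,3) Qn unfolding univ_poly_zero by blast
      ultimately show ?thesis using Q(1) g(1) by (intro bexI[of _ "Q \<otimes>\<^bsub>?P\<^esub> g"]) auto
    next
      case False
      hence "S \<subseteq> monic_irred_divisors h" using S unfolding ins by auto
      then obtain g where g: "g \<in> carrier ?P" "g divides\<^bsub>?P\<^esub> h" "g \<noteq> []" "degree g = (\<Sum>Q\<in>S. degree Q)"
        using IH by blast
      thus ?thesis using UP.divides_trans[OF g(2) hf] by blast
    qed
    moreover have "degree f = (\<Sum>Q\<in>monic_irred_divisors f. degree Q)"
      unfolding ins deg using IH Qh by simp
    ultimately show ?thesis using IH ins by simp
  qed
qed

section \<open>Residue fields of irreducible divisors and the order of X\<close>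

lemma card_bounded_polys:
  "finite {q \<in> carrier (poly_ring R). length q \<le> k}" "card {q \<in> carrier (poly_ring R). length q \<le> k} = p ^ k"
proof -
  let ?A = "{q \<in> carrier (poly_ring R). length q \<le> k}" and ?B = "{l. set l \<subseteq> carrier R \<and> length l = k}"
  have bij: "bij_betw normalize ?B ?A"
  \<comment> \<open>Padding with leading zeros to length \<open>k\<close> inverts
    \<open>normalize\<close>; length at most \<open>k\<close> covers the degrees below
    \<open>k\<close> and the zero polynomial.\<close>
  proof (rule bij_betw_byWitness[where f' = "\<lambda>q. replicate (k - length q) \<zero> @ q"])
    show "\<forall>l\<in>?B. replicate (k - length (normalize l)) \<zero> @ normalize l = l"
      using normalize_trick by auto
    show "\<forall>q\<in>?A. normalize (replicate (k - length q) \<zero> @ q) = q"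
      using normalize_replicate_zero normalize_polynomial by (auto simp: univ_poly_carrier[symmetric])
    show "normalize ` ?B \<subseteq> ?A"
      using normalize_gives_polynomial normalize_length_le by (auto simp: univ_poly_carrier[symmetric])
    show "(\<lambda>q. replicate (k - length q) \<zero> @ q) ` ?A \<subseteq> ?B"
      using polynomial_incl[THEN subsetD] by (auto simp: univ_poly_carrier[symmetric] set_replicate_conv_if split: if_splits)
  qed
  have B: "finite ?B" "card ?B = p ^ k"
    using finite_lists_length_eq[OF finite_R, of k] card_lists_length_eq[OF finite_R, of k] card_p by auto
  show "finite ?A" using bij_betw_finite[OF bij] B(1) by simp
  show "card ?A = p ^ k" using bij_betw_same_card[OF bij] B(2) by simp
qed

definition xord :: "'a list \<Rightarrow> nat" where
  "xord Q = group.ord (Multiplicative_Group.mult_of (Rupt (carrier R) Q)) (rupture_surj (carrier R) Q X)"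

lemma rupture_surj_eq_iff:
  assumes "Q \<in> carrier (poly_ring R)" "a \<in> carrier (poly_ring R)" "b \<in> carrier (poly_ring R)"
  shows "rupture_surj (carrier R) Q a = rupture_surj (carrier R) Q b \<longleftrightarrow>
    Q divides\<^bsub>poly_ring R\<^esub> (a \<ominus>\<^bsub>poly_ring R\<^esub> b)"
proof -
  have "x \<in> PIdl\<^bsub>poly_ring R\<^esub> Q \<longleftrightarrow> Q divides\<^bsub>poly_ring R\<^esub> x" for x
    using assms(1) UP.m_comm unfolding cgenideal_def factor_def by auto
  thus ?thesis using UP.quotient_eq_iff_same_a_r_cos[OF UP.cgenideal_ideal[OF assms(1)] assms(2,3)] by simp
qed

context
  fixes Q :: "'a list" and n :: nat
  assumes Q: "Q \<in> carrier (poly_ring R)" "pirreducible (carrier R) Q"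
    and n: "n > 0" and dvd: "Q divides\<^bsub>poly_ring R\<^esub> X_pow_m1 n"
begin

interpretation K: field "Rupt (carrier R) Q"
  using rupture_is_field_iff_pirreducible[OF subfield_R Q(1)] Q(2) by blast

interpretation h: ring_hom_ring "poly_ring R" "Rupt (carrier R) Q" "rupture_surj (carrier R) Q"
  using rupture_surj_hom(2)[OF subring_R Q(1)] .

interpretation M: group "Multiplicative_Group.mult_of (Rupt (carrier R) Q)"
  by (rule K.field_mult_group)

lemma rupture_X_pow_eq_one_iff:
  "rupture_surj (carrier R) Q X [^]\<^bsub>Rupt (carrier R) Q\<^esub> (e::nat) = \<one>\<^bsub>Rupt (carrier R) Q\<^esub> \<longleftrightarrow>
   Q divides\<^bsub>poly_ring R\<^esub> X_pow_m1 e"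
proof -
  have "rupture_surj (carrier R) Q X [^]\<^bsub>Rupt (carrier R) Q\<^esub> e = rupture_surj (carrier R) Q (X [^]\<^bsub>poly_ring R\<^esub> e)"
    using h.hom_nat_pow[OF X_closed] by simp
  moreover have "\<one>\<^bsub>Rupt (carrier R) Q\<^esub> = rupture_surj (carrier R) Q \<one>\<^bsub>poly_ring R\<^esub>" using h.hom_one by simp
  ultimately show ?thesis
    using rupture_surj_eq_iff[OF Q(1), of "X [^]\<^bsub>poly_ring R\<^esub> e" "\<one>\<^bsub>poly_ring R\<^esub>"] X_closed
    unfolding X_pow_m1_def by simp
qed

text \<open>The class of X is nonzero because its \<open>n\<close>-th power is 1; only thus does
  \<open>xord Q\<close> speak about a group element.\<close>

lemma rupture_X_in_mult: "rupture_surj (carrier R) Q X \<in> carrier (Multiplicative_Group.mult_of (Rupt (carrier R) Q))"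
proof -
  have "rupture_surj (carrier R) Q X \<noteq> \<zero>\<^bsub>Rupt (carrier R) Q\<^esub>"
    using rupture_X_pow_eq_one_iff[of n] dvd n K.zero_not_one by (auto simp: K.nat_pow_zero)
  thus ?thesis using h.hom_closed[OF X_closed] by simp
qed

lemma xord_dvd_iff: "xord Q dvd e \<longleftrightarrow> Q divides\<^bsub>poly_ring R\<^esub> X_pow_m1 e"
  using M.pow_eq_id[OF rupture_X_in_mult, of e] rupture_X_pow_eq_one_iff[of e]
  unfolding xord_def Multiplicative_Group.nat_pow_mult_of by simp

lemma card_rupture: "finite (carrier (Rupt (carrier R) Q))" "card (carrier (Rupt (carrier R) Q)) = p ^ degree Q"
proof -
  have Qn: "Q \<noteq> []" using pirreducibleE(1)[OF subring_R Q] .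
  let ?A = "{q \<in> carrier (poly_ring R). length q \<le> degree Q}"
  note img = pmod_image_characterization[OF subfield_R Q(1) Qn]
  have K: "carrier (Rupt (carrier R) Q) = rupture_surj (carrier R) Q ` ?A"
    using rupture_carrier_as_pmod_image[OF subfield_R Q(1)] unfolding img by simp
  show "finite (carrier (Rupt (carrier R) Q))" unfolding K using card_bounded_polys(1) by simp
  show "card (carrier (Rupt (carrier R) Q)) = p ^ degree Q" unfolding K
    using card_image[OF rupture_surj_inj_on[OF subfield_R Q(1), unfolded img]] card_bounded_polys(2) by simp
qed

text \<open>Let \<open>k\<close> be the degree of \<open>Q\<close> and \<open>r\<close> the order of
  \<open>p\<close> modulo \<open>xord Q\<close>. Lagrange in the residue field with
  \<open>p ^ k\<close> elements gives that \<open>r\<close> divides \<open>k\<close>. Conversely the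
  \<open>r\<close>-th iterate of Frobenius fixes all residue classes; applied to a generator of the
  multiplicative group this gives \<open>k \<le> r\<close>.\<close>

lemma degree_eq_ord:
  assumes pn: "\<not> p dvd n"
  shows "degree Q = ord (xord Q) p"
proof -
  let ?K = "Rupt (carrier R) Q" and ?d = "xord Q" and ?k = "degree Q"
  let ?r = "ord ?d p"
  have order_eq: "order (Multiplicative_Group.mult_of ?K) = p ^ ?k - 1"
    using K.order_mult_of[OF card_rupture(1)] card_rupture(2) unfolding order_def by simp
  have finM: "finite (carrier (Multiplicative_Group.mult_of ?K))" using card_rupture(1) by simp
  have p1: "p > 1" using prime_gt_1_nat[OF prime_p] .
  have dn: "?d dvd n" using xord_dvd_iff dvd by blast
  have cop: "coprime ?d p"
    using pn dn prime_imp_coprime[OF prime_p, of ?d] dvd_trans[of p ?d n] by (auto simp: coprime_commute)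
  have "?d dvd p ^ ?k - 1"
    using M.pow_order_eq_1[OF rupture_X_in_mult] M.pow_eq_id[OF rupture_X_in_mult] unfolding order_eq xord_def by simp
  hence "[p ^ ?k = 1] (mod ?d)" using p1 by (subst cong_altdef_nat) auto
  hence rk: "?r dvd ?k" unfolding ord_divides .
  have "[p ^ ?r = 1] (mod ?d)" unfolding ord_divides by (rule dvd_refl)
  hence dr: "?d dvd p ^ ?r - 1" by (rule cong_to_1_nat)
  have pr_Suc: "Suc (p ^ ?r - 1) = p ^ ?r" using p1 by simp
  obtain g where g: "g \<in> carrier (Multiplicative_Group.mult_of ?K)"
    "carrier (Multiplicative_Group.mult_of ?K) = {g [^]\<^bsub>?K\<^esub> i | i::nat. i \<in> UNIV}"
    using K.finite_field_mult_group_has_gen[OF card_rupture(1)] by auto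
  obtain y where y: "y \<in> carrier (poly_ring R)" "g = rupture_surj (carrier R) Q y"
  proof -
    have "g \<in> rupture_surj (carrier R) Q ` ((\<lambda>q. q pmod Q) ` carrier (poly_ring R))"
      using rupture_carrier_as_pmod_image[OF subfield_R Q(1)] g(1) by simp
    then obtain q where q: "q \<in> carrier (poly_ring R)" "g = rupture_surj (carrier R) Q (q pmod Q)" by blast
    show ?thesis by (rule that[OF long_division_closed(2)[OF subfield_R q(1) Q(1)] q(2)])
  qed
  have "Q divides\<^bsub>poly_ring R\<^esub> X_pow_m1 ?d" using xord_dvd_iff[of ?d] by simp
  hence "Q divides\<^bsub>poly_ring R\<^esub> (y [^]\<^bsub>poly_ring R\<^esub> (p ^ ?r) \<ominus>\<^bsub>poly_ring R\<^esub> y)"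
    using X_pow_minus_one_divides_frobenius[OF dr y(1)] Q(1) unfolding X_pow_m1_def
    by (rule UP.divides_trans)
  hence "g [^]\<^bsub>?K\<^esub> (p ^ ?r) = g"
    using rupture_surj_eq_iff[OF Q(1) UP.nat_pow_closed[OF y(1)] y(1)] h.hom_nat_pow[OF y(1)] y(2) by simp
  moreover have "g [^]\<^bsub>?K\<^esub> (p ^ ?r) = g [^]\<^bsub>?K\<^esub> (p ^ ?r - 1) \<otimes>\<^bsub>?K\<^esub> g"
    using K.nat_pow_Suc[of g "p ^ ?r - 1"] unfolding pr_Suc .
  ultimately have "g [^]\<^bsub>?K\<^esub> (p ^ ?r - 1) \<otimes>\<^bsub>?K\<^esub> g = \<one>\<^bsub>?K\<^esub> \<otimes>\<^bsub>?K\<^esub> g" using g(1) by simp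
  hence "g [^]\<^bsub>?K\<^esub> (p ^ ?r - 1) = \<one>\<^bsub>?K\<^esub>"
    using g(1) by (subst (asm) K.m_rcancel) auto
  hence gd: "M.ord g dvd p ^ ?r - 1"
    using M.pow_eq_id[OF g(1)] unfolding Multiplicative_Group.nat_pow_mult_of by simp
  have "M.ord g = p ^ ?k - 1"
  proof -
    have "carrier (Multiplicative_Group.mult_of ?K) = generate (Multiplicative_Group.mult_of ?K) {g}"
      using M.generate_pow_on_finite_carrier[OF finM g(1)] g(2)
      unfolding Multiplicative_Group.nat_pow_mult_of by simp
    thus ?thesis using M.generate_pow_card[OF g(1)] order_eq unfolding order_def by simp
  qed
  hence "p ^ ?k - 1 dvd p ^ ?r - 1" using gd by simp
  moreover have "?r > 0" using cop by simp
  hence "p ^ ?r > 1" using p1 one_less_power by blast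
  ultimately have "p ^ ?k - 1 \<le> p ^ ?r - 1" by (intro dvd_imp_le) auto
  hence "p ^ ?k \<le> p ^ ?r" using \<open>p ^ ?r > 1\<close> by linarith
  hence "?k \<le> ?r" using p1 by simp
  moreover have "?k > 0" using pirreducible_degree[OF subfield_R Q] by simp
  ultimately show ?thesis using rk by (meson dvd_imp_le le_antisym)
qed

end

end

text \<open>The divisor-sum identities determine a function recursively, and the totient satisfies
  the same ones.\<close>

lemma totient_unique:
  assumes G: "\<And>e. e dvd n \<Longrightarrow> (\<Sum>d | d dvd e. G d) = e" and n: "n > 0"
  shows "d dvd n \<Longrightarrow> G d = totient d"
proof (induction d rule: less_induct)
  case (less d)
  have d: "d > 0" using less(2) n by (intro Nat.gr0I) auto
  have split: "(\<Sum>e | e dvd d. F e) = F d + (\<Sum>e\<in>{e. e dvd d} - {d}. F e)" for F :: "nat \<Rightarrow> nat"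
    using d by (intro sum.remove) auto
  have "(\<Sum>e\<in>{e. e dvd d} - {d}. G e) = (\<Sum>e\<in>{e. e dvd d} - {d}. totient e)"
  proof (rule sum.cong, rule refl)
    fix e assume e: "e \<in> {e. e dvd d} - {d}"
    hence "e dvd d" "e < d" using dvd_imp_le[of e d] d by auto
    thus "G e = totient e" using less(1)[of e] dvd_trans[of e d n] less(2) by simp
  qed
  thus ?case using split[of G] split[of totient] G[OF less(2)] totient_divisor_sum[of d] by linarith
qed

section \<open>Counting irreducible factors by the order of X\<close>

context prime_field
begin

lemma X_pow_m1_frobenius: "X_pow_m1 (p ^ j * n) = X_pow_m1 n [^]\<^bsub>poly_ring R\<^esub> (p ^ j)"
  using UP.freshman_dream_power_minus_one[OF prime_p poly_char_p, of "X [^]\<^bsub>poly_ring R\<^esub> n" j] X_closed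
  unfolding X_pow_m1_def by (simp add: UP.nat_pow_pow mult.commute)

context
  fixes n :: nat
  assumes n: "n > 0" and pn: "\<not> p dvd n"
begin

lemma monic_irred_divisors_X_pow_m1:
  assumes e: "e dvd n"
  shows "monic_irred_divisors (X_pow_m1 e) = {Q \<in> monic_irred_divisors (X_pow_m1 n). xord Q dvd e}"
proof (intro equalityI subsetI)
  fix Q assume Qe: "Q \<in> monic_irred_divisors (X_pow_m1 e)"
  hence Q: "Q \<in> carrier (poly_ring R)" "pirreducible (carrier R) Q" "Q divides\<^bsub>poly_ring R\<^esub> X_pow_m1 e"
    unfolding monic_irred_divisors_def by auto
  have "Q divides\<^bsub>poly_ring R\<^esub> X_pow_m1 n" by (rule UP.divides_trans[OF Q(3) X_pow_m1_divides[OF e] Q(1)])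
  thus "Q \<in> {Q \<in> monic_irred_divisors (X_pow_m1 n). xord Q dvd e}"
    using Qe xord_dvd_iff[OF Q(1,2) n] Q(3) unfolding monic_irred_divisors_def by auto
next
  fix Q assume "Q \<in> {Q \<in> monic_irred_divisors (X_pow_m1 n). xord Q dvd e}"
  thus "Q \<in> monic_irred_divisors (X_pow_m1 e)"
    using xord_dvd_iff[OF _ _ n] unfolding monic_irred_divisors_def by auto
qed

lemma finite_monic_irred_divisors_X_pow_m1: "finite (monic_irred_divisors (X_pow_m1 n))"
  using squarefree_poly_divisors[OF X_pow_m1_closed degree_X_pow_m1(1)[OF n] squarefree_X_pow_m1[OF n pn]] by blast

lemma xord_dvd: "Q \<in> monic_irred_divisors (X_pow_m1 n) \<Longrightarrow> xord Q dvd n"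
  using monic_irred_divisors_X_pow_m1[of n] by auto

lemma degree_monic_irred_divisor:
  "Q \<in> monic_irred_divisors (X_pow_m1 n) \<Longrightarrow> degree Q = ord (xord Q) p"
  using degree_eq_ord[OF _ _ n _ pn] unfolding monic_irred_divisors_def by blast

text \<open>For each \<open>e\<close> dividing \<open>n\<close> the factors whose order divides
  \<open>e\<close> are those of \<open>X ^ e - 1\<close>, of total degree \<open>e\<close>. By
  \<open>totient_unique\<close> those of order exactly \<open>d\<close> have total degree
  \<open>totient d\<close>.\<close>

lemma card_xord_mult_ord:
  assumes d: "d dvd n"
  shows "card {Q \<in> monic_irred_divisors (X_pow_m1 n). xord Q = d} * ord d p = totient d"
proof -
  let ?I = "monic_irred_divisors (X_pow_m1 n)"
  define G where "G d = (\<Sum>Q\<in>{Q \<in> ?I. xord Q = d}. degree Q)" for d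
  have "(\<Sum>d | d dvd e. G d) = e" if e: "e dvd n" for e
  proof -
    have e0: "e > 0" using e n by (intro Nat.gr0I) auto
    have pe: "\<not> p dvd e" using e pn dvd_trans by blast
    let ?Ie = "{Q \<in> ?I. xord Q dvd e}"
    have "e = degree (X_pow_m1 e)" using degree_X_pow_m1(2)[OF e0] by simp
    also have "\<dots> = (\<Sum>Q\<in>?Ie. degree Q)"
      using squarefree_poly_divisors[OF X_pow_m1_closed degree_X_pow_m1(1)[OF e0] squarefree_X_pow_m1[OF e0 pe]]
      unfolding monic_irred_divisors_X_pow_m1[OF e] by blast
    also have "\<dots> = (\<Sum>d | d dvd e. \<Sum>Q\<in>{Q \<in> ?Ie. xord Q = d}. degree Q)"
      using finite_monic_irred_divisors_X_pow_m1 e0 by (intro sum.group[symmetric]) auto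
    also have "\<dots> = (\<Sum>d | d dvd e. G d)"
      unfolding G_def by (intro sum.cong refl) auto
    finally show ?thesis by simp
  qed
  hence "G d = totient d" by (rule totient_unique[OF _ n d])
  moreover have "G d = (\<Sum>Q\<in>{Q \<in> ?I. xord Q = d}. ord d p)"
    unfolding G_def using degree_monic_irred_divisor by (intro sum.cong) auto
  ultimately show ?thesis by simp
qed

lemma ord_p_pos: "d dvd n \<Longrightarrow> ord d p > 0"
  using prime_imp_coprime[OF prime_p, of d] pn dvd_trans[of p d n] by (auto simp: coprime_commute)

lemma degree_divisor_X_pow_m1:
  assumes g: "g \<in> carrier (poly_ring R)" "g divides\<^bsub>poly_ring R\<^esub> X_pow_m1 n"
  shows "\<exists>c. (\<forall>d. d dvd n \<longrightarrow> c d * ord d p \<le> totient d) \<and> degree g = (\<Sum>d | d dvd n. ord d p * c d)"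
proof -
  let ?I = "monic_irred_divisors (X_pow_m1 n)" and ?J = "monic_irred_divisors g"
  have gn: "g \<noteq> []"
    using g(2) degree_X_pow_m1(1)[OF n] zero_pdivides[of "X_pow_m1 n"] unfolding pdivides_divides by auto
  have sq: "squarefree_poly g" by (rule squarefree_poly_divides[OF squarefree_X_pow_m1[OF n pn] g(2,1)])
  have J: "finite ?J" "degree g = (\<Sum>Q\<in>?J. degree Q)" using squarefree_poly_divisors[OF g(1) gn sq] by blast+
  have JI: "?J \<subseteq> ?I" using UP.divides_trans[OF _ g(2)] unfolding monic_irred_divisors_def by auto
  define c where "c d = card {Q \<in> ?J. xord Q = d}" for d
  have "c d * ord d p \<le> totient d" if d: "d dvd n" for d
  proof -
    have "c d \<le> card {Q \<in> ?I. xord Q = d}"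
      unfolding c_def using JI finite_monic_irred_divisors_X_pow_m1 by (intro card_mono) auto
    thus ?thesis using card_xord_mult_ord[OF d] by (metis mult_le_mono1)
  qed
  moreover have "degree g = (\<Sum>d | d dvd n. ord d p * c d)"
  proof -
    have "degree g = (\<Sum>d | d dvd n. \<Sum>Q\<in>{Q \<in> ?J. xord Q = d}. degree Q)"
      unfolding J(2) using J(1) n xord_dvd JI by (intro sum.group[symmetric]) auto
    also have "\<dots> = (\<Sum>d | d dvd n. \<Sum>Q\<in>{Q \<in> ?J. xord Q = d}. ord d p)"
      using degree_monic_irred_divisor JI by (intro sum.cong refl) auto
    finally show ?thesis unfolding c_def by (simp add: mult.commute)
  qed
  ultimately show ?thesis by blast
qed

lemma divisor_X_pow_m1_exists:
  assumes c: "\<And>d. d dvd n \<Longrightarrow> c d * ord d p \<le> totient d"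
  shows "\<exists>g\<in>carrier (poly_ring R). g divides\<^bsub>poly_ring R\<^esub> X_pow_m1 n \<and> g \<noteq> [] \<and>
    degree g = (\<Sum>d | d dvd n. ord d p * c d)"
proof -
  let ?I = "monic_irred_divisors (X_pow_m1 n)"
  have "\<exists>S. S \<subseteq> {Q \<in> ?I. xord Q = d} \<and> card S = c d" if d: "d dvd n" for d
  proof -
    have "c d * ord d p \<le> card {Q \<in> ?I. xord Q = d} * ord d p" using c[OF d] card_xord_mult_ord[OF d] by simp
    hence "c d \<le> card {Q \<in> ?I. xord Q = d}" using ord_p_pos[OF d] by simp
    then obtain S where "S \<subseteq> {Q \<in> ?I. xord Q = d}" "card S = c d" by (rule obtain_subset_with_card_n)
    thus ?thesis by blast
  qed
  hence "\<forall>d\<in>{d. d dvd n}. \<exists>S. S \<subseteq> {Q \<in> ?I. xord Q = d} \<and> card S = c d" by blast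
  from bchoice[OF this] obtain S where S: "\<And>d. d dvd n \<Longrightarrow> S d \<subseteq> {Q \<in> ?I. xord Q = d}"
    "\<And>d. d dvd n \<Longrightarrow> card (S d) = c d" by blast
  let ?S = "\<Union>d\<in>{d. d dvd n}. S d"
  have "?S \<subseteq> ?I" using S(1) by auto
  then obtain g where g: "g \<in> carrier (poly_ring R)" "g divides\<^bsub>poly_ring R\<^esub> X_pow_m1 n" "g \<noteq> []"
    "degree g = (\<Sum>Q\<in>?S. degree Q)"
    using squarefree_poly_divisors[OF X_pow_m1_closed degree_X_pow_m1(1)[OF n] squarefree_X_pow_m1[OF n pn]] by blast
  have "finite (S d)" if "d dvd n" for d
    using S(1)[OF that] finite_monic_irred_divisors_X_pow_m1 by (auto intro: finite_subset)
  moreover have "S d \<inter> S e = {}" if "d dvd n" "e dvd n" "d \<noteq> e" for d e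
    using S(1)[OF that(1)] S(1)[OF that(2)] that(3) by auto
  ultimately have "(\<Sum>Q\<in>?S. degree Q) = (\<Sum>d | d dvd n. \<Sum>Q\<in>S d. degree Q)"
    using n by (intro sum.UNION_disjoint) auto
  also have "\<dots> = (\<Sum>d | d dvd n. ord d p * c d)"
  proof (intro sum.cong refl)
    fix d assume "d \<in> {d. d dvd n}"
    hence d: "d dvd n" by simp
    have "(\<Sum>Q\<in>S d. degree Q) = (\<Sum>Q\<in>S d. ord d p)"
      using S(1)[OF d] degree_monic_irred_divisor by (intro sum.cong) auto
    thus "(\<Sum>Q\<in>S d. degree Q) = ord d p * c d" using S(2)[OF d] by simp
  qed
  finally show ?thesis using g by auto
qed

text \<open>Greedy choice: one copy of \<open>X ^ n - 1\<close> supplies as many factors of each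
  order as it has, and the other copies cover the rest. Treating the orders independently is
  possible since the bound is imposed for each \<open>d\<close>.\<close>

lemma divisor_power_X_pow_m1_exists:
  assumes t: "\<And>d. d dvd n \<Longrightarrow> t d * ord d p \<le> q * totient d"
  shows "\<exists>g\<in>carrier (poly_ring R). g divides\<^bsub>poly_ring R\<^esub> (X_pow_m1 n [^]\<^bsub>poly_ring R\<^esub> q) \<and> g \<noteq> [] \<and>
    degree g = (\<Sum>d | d dvd n. ord d p * t d)"
  using t
proof (induction q arbitrary: t)
  case 0
  have "t d = 0" if "d dvd n" for d using 0[OF that] ord_p_pos[OF that] by simp
  thus ?case using UP.one_closed
    by (intro bexI[of _ "\<one>\<^bsub>poly_ring R\<^esub>"]) (auto simp: univ_poly_one)
next
  case (Suc q)
  let ?P = "poly_ring R"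
  \<comment> \<open>\<open>N d\<close> is the exact number of irreducible factors of order
    \<open>d\<close>, the division leaving no remainder.\<close>
  define N where "N d = totient d div ord d p" for d
  have N: "N d * ord d p = totient d" if "d dvd n" for d
    using card_xord_mult_ord[OF that] unfolding N_def by (metis dvd_div_mult_self dvd_triv_right)
  define s where "s d = min (t d) (N d)" for d
  have "s d * ord d p \<le> totient d" if "d dvd n" for d
    unfolding N[OF that, symmetric] s_def by (intro mult_right_mono) auto
  then obtain g where g: "g \<in> carrier ?P" "g divides\<^bsub>?P\<^esub> X_pow_m1 n" "g \<noteq> []"
    "degree g = (\<Sum>d | d dvd n. ord d p * s d)" using divisor_X_pow_m1_exists by blast
  have "(t d - s d) * ord d p \<le> q * totient d" if d: "d dvd n" for d
  proof (cases "t d \<le> N d")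
    case True
    thus ?thesis by (simp add: s_def)
  next
    case False
    have "t d * ord d p \<le> Suc q * totient d" by (rule Suc(2)[OF d])
    thus ?thesis using False N[OF d] by (simp add: s_def diff_mult_distrib)
  qed
  then obtain h where h: "h \<in> carrier ?P" "h divides\<^bsub>?P\<^esub> (X_pow_m1 n [^]\<^bsub>?P\<^esub> q)" "h \<noteq> []"
    "degree h = (\<Sum>d | d dvd n. ord d p * (t d - s d))" using Suc.IH[of "\<lambda>d. t d - s d"] by blast
  have "(h \<otimes>\<^bsub>?P\<^esub> g) divides\<^bsub>?P\<^esub> (X_pow_m1 n [^]\<^bsub>?P\<^esub> Suc q)"
  proof -
    have "(h \<otimes>\<^bsub>?P\<^esub> g) divides\<^bsub>?P\<^esub> (h \<otimes>\<^bsub>?P\<^esub> X_pow_m1 n)"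
      using g h X_pow_m1_closed by (intro UP.divides_mult_lI) auto
    moreover have "(h \<otimes>\<^bsub>?P\<^esub> X_pow_m1 n) divides\<^bsub>?P\<^esub> (X_pow_m1 n [^]\<^bsub>?P\<^esub> q \<otimes>\<^bsub>?P\<^esub> X_pow_m1 n)"
      using h X_pow_m1_closed by (intro UP.divides_mult_rI) auto
    ultimately show ?thesis using g h UP.divides_trans[of "h \<otimes>\<^bsub>?P\<^esub> g"] by simp
  qed
  moreover have "h \<otimes>\<^bsub>?P\<^esub> g \<noteq> []"
    using UP.integral[of h g] g h unfolding univ_poly_zero by blast
  moreover have "degree (h \<otimes>\<^bsub>?P\<^esub> g) = (\<Sum>d | d dvd n. ord d p * t d)"
  proof -
    have "ord d p * (t d - s d) + ord d p * s d = ord d p * t d" for d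
      unfolding s_def by (simp add: distrib_left[symmetric])
    thus ?thesis unfolding degree_mult[OF h(1) g(1) h(3) g(3)] g(4) h(4) sum.distrib[symmetric] by simp
  qed
  ultimately show ?case using g h by (intro bexI[of _ "h \<otimes>\<^bsub>?P\<^esub> g"]) auto
qed

end

end

section \<open>The characterization of lambda-practical numbers\<close>

text \<open>The same \<open>g\<close> must serve all exponents, because divisors of \<open>n\<close>
  contain smaller powers of \<open>q\<close>. For odd \<open>q\<close> it is a primitive root modulo
  all powers; for \<open>q = 2\<close> it is 3.\<close>

lemma ord_prime_power_Carmichael_root:
  assumes q: "Factorial_Ring.prime (q::nat)"
  shows "\<exists>g. coprime q g \<and> (\<forall>k>0. ord (q ^ k) g = Carmichael (q ^ k))"
proof (cases "q = 2")
  case False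
  hence "odd q" using prime_odd_nat[OF q] prime_ge_2_nat[OF q] by simp
  then obtain g where g: "\<forall>k>0. residue_primroot (q ^ k) g"
    using residue_primroot_odd_prime_power_exists[OF q] by blast
  have "coprime q g" using g[rule_format, of 1] unfolding residue_primroot_def by simp
  moreover have "ord (q ^ k) g = Carmichael (q ^ k)" if "k > 0" for k
    using g that residue_primroot_Carmichael[of "q ^ k" g] unfolding residue_primroot_def by simp
  ultimately show ?thesis by blast
next
  case True
  have "ord (2 ^ k) (3::nat) = Carmichael (2 ^ k)" if "k > 0" for k
  proof -
    consider "k = 1" | "k = 2" | "k \<ge> 3" using \<open>k > 0\<close> by linarith
    thus ?thesis
    proof cases
      case 1
      thus ?thesis using ord_eq_Suc_0_iff[of 2 3] by (simp add: cong_def)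
    next
      case 2
      have "ord 4 (3::nat) dvd 2" unfolding ord_divides[symmetric] by (simp add: cong_def)
      moreover have "ord 4 (3::nat) \<noteq> 1" using ord_eq_Suc_0_iff[of 4 3] by (simp add: cong_def)
      ultimately have "ord 4 (3::nat) = 2" using dvd_imp_le[of "ord 4 (3::nat)" 2] by (auto simp: le_Suc_eq numeral_2_eq_2)
      thus ?thesis using 2 by simp
    next
      case 3
      thus ?thesis by (simp add: ord_twopow_3_5 Carmichael_twopow_ge_8)
    qed
  qed
  moreover have "coprime 2 (3::nat)" by simp
  ultimately show ?thesis using True by blast
qed

text \<open>Local roots are glued by the Chinese remainder theorem. For each divisor
  \<open>d\<close> both \<open>ord d a\<close> and \<open>Carmichael d\<close> are the least common
  multiples of their values at the prime powers of \<open>d\<close>, so agreement there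
  suffices.\<close>

lemma simultaneous_Carmichael_root:
  assumes n: "n > 0"
  shows "\<exists>a. coprime a n \<and> (\<forall>d. d dvd n \<longrightarrow> ord d a = Carmichael d)"
proof -
  let ?A = "prime_factors n" and ?m = "\<lambda>q. q ^ multiplicity q n"
  have prime: "Factorial_Ring.prime q" if "q \<in> ?A" for q using that by auto
  have "\<forall>q\<in>?A. \<exists>g. coprime q g \<and> (\<forall>k>0. ord (q ^ k) g = Carmichael (q ^ k))"
    using ord_prime_power_Carmichael_root prime by blast
  from bchoice[OF this] obtain g where g: "\<And>q. q \<in> ?A \<Longrightarrow> coprime q (g q)"
      "\<And>q k. q \<in> ?A \<Longrightarrow> k > 0 \<Longrightarrow> ord (q ^ k) (g q) = Carmichael (q ^ k)" by blast
  have "\<forall>i\<in>?A. \<forall>j\<in>?A. i \<noteq> j \<longrightarrow> coprime (?m i) (?m j)"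
    using prime primes_coprime by auto
  then obtain a where a: "\<forall>q\<in>?A. [a = g q] (mod ?m q)"
    using chinese_remainder_nat[of ?A ?m g] by auto
  have mult_pos: "multiplicity q n > 0" if "q \<in> ?A" for q
    using that by (simp add: prime_factors_multiplicity)
  have "coprime a n"
  proof (rule ccontr)
    assume "\<not> coprime a n"
    then obtain q where q: "Factorial_Ring.prime q" "q dvd a" "q dvd n"
      using prime_factor_nat[of "gcd a n"] by (auto simp: coprime_iff_gcd_eq_1)
    have qA: "q \<in> ?A" using q n by (simp add: in_prime_factors_iff)
    have "q dvd ?m q" using mult_pos[OF qA] by (simp add: dvd_power)
    hence "[a = g q] (mod q)" using a qA cong_dvd_modulus_nat by blast
    hence "q dvd g q" using q(2) cong_dvd_iff by blast
    thus False using g(1)[OF qA] q(1) coprime_absorb_left[of q "g q"] by auto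
  qed
  moreover have "ord d a = Carmichael d" if d: "d dvd n" for d
  proof -
    have d0: "d \<noteq> 0" using d n by auto
    let ?B = "prime_factors d" and ?k = "\<lambda>q. q ^ multiplicity q d"
    have BA: "?B \<subseteq> ?A" using d n by (intro dvd_prime_factors) auto
    have d_eq: "d = (\<Prod>q\<in>?B. ?k q)" using d0 by (simp add: prod_prime_factors)
    have cop: "coprime (?k i) (?k j)" if "i \<in> ?B" "j \<in> ?B" "i \<noteq> j" for i j
      using that primes_coprime[of i j] by auto
    have eq: "ord (?k q) a = Carmichael (?k q)" if q: "q \<in> ?B" for q
    proof -
      have "multiplicity q d \<le> multiplicity q n" using d n by (intro dvd_imp_multiplicity_le) auto
      hence "?k q dvd ?m q" by (rule le_imp_power_dvd)
      hence "[a = g q] (mod ?k q)" using a q BA cong_dvd_modulus_nat by blast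
      hence "ord (?k q) a = ord (?k q) (g q)" by (rule ord_cong)
      moreover have "multiplicity q d > 0" using q by (simp add: prime_factors_multiplicity)
      ultimately show ?thesis using g(2) q BA by auto
    qed
    have "ord d a = (LCM q\<in>?B. ord (?k q) a)"
      by (subst d_eq, rule ord_modulus_prod_coprime) (use cop in auto)
    also have "\<dots> = (LCM q\<in>?B. Carmichael (?k q))" using eq by (simp cong: image_cong)
    also have "\<dots> = Carmichael d"
      by (subst (3) d_eq, rule Carmichael_prod_coprime[symmetric]) (use cop in auto)
    finally show ?thesis .
  qed
  ultimately show ?thesis by blast
qed

section \<open>From degrees of divisors to sums of Carmichael values\<close>

lemma prime_field_residue_ring:
  assumes p: "Factorial_Ring.prime p"
  shows "prime_field (residue_ring (int p)) p"
proof -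
  have rp: "residues_prime p" using p by (rule residues_prime.intro)
  have "card (carrier (residue_ring (int p))) = p" unfolding residue_ring_def by simp
  thus ?thesis
    using residues_prime.is_field[OF rp] p unfolding prime_field_def prime_field_axioms_def by blast
qed

lemma le_divide_Carmichael_iff:
  "real_of_int (int c) \<le> real (totient d) / real (Carmichael d) \<longleftrightarrow> c * Carmichael d \<le> totient d"
proof -
  have "real_of_int (int c) \<le> real (totient d) / real (Carmichael d) \<longleftrightarrow> real (c * Carmichael d) \<le> real (totient d)"
    by (simp add: pos_le_divide_eq)
  thus ?thesis unfolding of_nat_le_iff .
qed

lemma p_practical_imp_sum:
  assumes p: "Factorial_Ring.prime p" and n: "n > 0" "\<not> p dvd n"
    and root: "\<And>d. d dvd n \<Longrightarrow> ord d p = Carmichael d"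
    and practical: "p_practical p n" and m: "m \<in> {1..n}"
  shows "\<exists>c. (\<forall>d. d dvd n \<longrightarrow> c d * Carmichael d \<le> totient d) \<and> m = (\<Sum>d | d dvd n. Carmichael d * c d)"
proof -
  interpret F: prime_field "residue_ring (int p)" p by (rule prime_field_residue_ring[OF p])
  obtain f where f: "f \<in> carrier (Fp_poly_ring p)" "f pdivides\<^bsub>residue_ring (int p)\<^esub> X_pow_minus_1 p n"
    "Polynomials.degree f = m" using practical m unfolding p_practical_def by blast
  have "f divides\<^bsub>Fp_poly_ring p\<^esub> F.X_pow_m1 n"
    using f(2) unfolding X_pow_minus_1_def F.X_pow_m1_def pdivides_def .
  from F.degree_divisor_X_pow_m1[OF n f(1) this] obtain c where
    c: "\<forall>d. d dvd n \<longrightarrow> c d * ord d p \<le> totient d" "Polynomials.degree f = (\<Sum>d | d dvd n. ord d p * c d)" by blast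
  have "m = (\<Sum>d | d dvd n. Carmichael d * c d)"
    unfolding f(3)[symmetric] c(2) using root by (intro sum.cong) auto
  moreover have "c d * Carmichael d \<le> totient d" if "d dvd n" for d
    using c(1)[rule_format, OF that] root[OF that] by simp
  ultimately show ?thesis by blast
qed

text \<open>Also covers primes dividing \<open>n = p ^ j * n'\<close>. A summand for
  \<open>p ^ i * d\<close>, with \<open>d\<close> dividing \<open>n'\<close>, is realized by factors
  of order \<open>d\<close>, as the order of X in characteristic \<open>p\<close> only sees the part
  of \<open>n\<close> prime to \<open>p\<close>.\<close>

lemma sum_imp_p_divisor:
  assumes p: "Factorial_Ring.prime p" and n: "n > 0"
    and c: "\<And>d. d dvd n \<Longrightarrow> c d * Carmichael d \<le> totient d"
  shows "\<exists>f\<in>carrier (Fp_poly_ring p). f pdivides\<^bsub>residue_ring (int p)\<^esub> X_pow_minus_1 p n \<and>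
    Polynomials.degree f = (\<Sum>d | d dvd n. Carmichael d * c d)"
proof -
  interpret F: prime_field "residue_ring (int p)" p by (rule prime_field_residue_ring[OF p])
  define j where "j = multiplicity p n"
  have "n \<noteq> 0" "\<not> is_unit p" using n p by auto
  then obtain n' where n': "n = p ^ j * n'" "\<not> p dvd n'"
    unfolding j_def by (rule multiplicity_decompose') blast
  have n'0: "n' > 0" using n n' by (intro Nat.gr0I) auto
  have cop: "coprime p d" if "d dvd n'" for d
    using p n'(2) that dvd_trans prime_imp_coprime by blast
  have ord_dvd: "ord d p dvd Carmichael (p ^ i * d)" if "d dvd n'" for d i
  proof -
    have "ord d p dvd Carmichael d"
    proof (cases "d = 1")
      case False
      have "d \<noteq> 0" using that n'0 by auto
      thus ?thesis using False cop[OF that] by (intro ord_dvd_Carmichael) (auto simp: coprime_commute)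
    qed simp
    also have "\<dots> dvd Carmichael (p ^ i * d)" using cop[OF that] by (subst Carmichael_mult_coprime) auto
    finally show ?thesis .
  qed
  \<comment> \<open>The number of factors of order \<open>d\<close> spent by all the blocks
    belonging to \<open>p ^ i * d\<close> with \<open>i \<le> j\<close>.\<close>
  define t where "t d = (\<Sum>i\<le>j. Carmichael (p ^ i * d) div ord d p * c (p ^ i * d))" for d
  have t: "ord d p * t d = (\<Sum>i\<le>j. Carmichael (p ^ i * d) * c (p ^ i * d))" if d: "d dvd n'" for d
    unfolding t_def sum_distrib_left
  proof (intro sum.cong refl)
    fix i
    show "ord d p * (Carmichael (p ^ i * d) div ord d p * c (p ^ i * d)) = Carmichael (p ^ i * d) * c (p ^ i * d)"
      using ord_dvd[OF d, of i] by (metis dvd_mult_div_cancel mult.assoc)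
  qed
  have "t d * ord d p \<le> p ^ j * totient d" if d: "d dvd n'" for d
  proof -
    have "t d * ord d p = (\<Sum>i\<le>j. Carmichael (p ^ i * d) * c (p ^ i * d))"
      using t[OF d] by (simp add: mult.commute)
    also have "\<dots> \<le> (\<Sum>i\<le>j. totient (p ^ i * d))"
    proof (rule sum_mono)
      fix i assume "i \<in> {..j}"
      hence "p ^ i * d dvd n" unfolding n'(1) using d by (intro mult_dvd_mono le_imp_power_dvd) auto
      thus "Carmichael (p ^ i * d) * c (p ^ i * d) \<le> totient (p ^ i * d)"
        using c by (simp add: mult.commute)
    qed
    also have "\<dots> = (\<Sum>i\<le>j. totient (p ^ i)) * totient d"
      unfolding sum_distrib_right using cop[OF d] by (intro sum.cong totient_mult_coprime refl) auto
    \<comment> \<open>This factor matches the multiplicity \<open>p ^ j\<close> of each irreducible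
      factor of \<open>X ^ n - 1\<close>, so the supply is just sufficient.\<close>
    also have "(\<Sum>i\<le>j. totient (p ^ i)) = p ^ j"
      using sum_divisors_prime_power[OF p, of 1 totient j] totient_divisor_sum[of "p ^ j"] prime_gt_1_nat[OF p] by simp
    finally show ?thesis .
  qed
  then obtain f where f: "f \<in> carrier (Fp_poly_ring p)"
    "f divides\<^bsub>Fp_poly_ring p\<^esub> (F.X_pow_m1 n' [^]\<^bsub>Fp_poly_ring p\<^esub> (p ^ j))"
    "Polynomials.degree f = (\<Sum>d | d dvd n'. ord d p * t d)"
    using F.divisor_power_X_pow_m1_exists[OF n'0 n'(2), of t "p ^ j"] by blast
  have "(\<Sum>d | d dvd n'. ord d p * t d) = (\<Sum>d | d dvd n'. \<Sum>i\<le>j. Carmichael (p ^ i * d) * c (p ^ i * d))"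
    using t by (intro sum.cong) auto
  also have "\<dots> = (\<Sum>d | d dvd n. Carmichael d * c d)"
    unfolding n'(1) by (rule sum_divisors_prime_power[OF p n'(2) n'0, symmetric])
  finally have "Polynomials.degree f = (\<Sum>d | d dvd n. Carmichael d * c d)" using f(3) by simp
  moreover have "f pdivides\<^bsub>residue_ring (int p)\<^esub> X_pow_minus_1 p n"
    using f(2) F.X_pow_m1_frobenius[of j n'] unfolding n'(1)[symmetric]
    unfolding X_pow_minus_1_def F.X_pow_m1_def pdivides_def by simp
  ultimately show ?thesis using f(1) by blast
qed

theorem theorem3p1:
  fixes n :: nat
  assumes "n > 0"
  shows "lambda_practical n \<longleftrightarrow>
    (\<forall>m::int. 1 \<le> m \<and> m \<le> int n \<longrightarrow>
      (\<exists>c :: nat \<Rightarrow> int.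
         (\<forall>d. d dvd n \<longrightarrow>
            0 \<le> c d \<and> real_of_int (c d) \<le> real (totient d) / real (Carmichael d)) \<and>
         m = (\<Sum>d | d dvd n. int (Carmichael d) * c d)))"
proof (intro iffI allI impI)
  fix m :: int
  assume practical: "lambda_practical n" and m: "1 \<le> m \<and> m \<le> int n"
  obtain a where a: "coprime a n" "\<And>d. d dvd n \<Longrightarrow> ord d a = Carmichael d"
    using simultaneous_Carmichael_root[OF assms] by blast
  \<comment> \<open>A single prime tests all divisors of \<open>n\<close>, as the congruence modulo
    \<open>n\<close> descends to every \<open>d\<close>.\<close>
  obtain p where p: "Factorial_Ring.prime p" "[p = a] (mod n)"
    using dirichlet_primes_infinite[OF assms a(1)] not_finite_existsD by blast
  have "coprime p n" using cong_imp_coprime[OF cong_sym[OF p(2)] a(1)] .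
  hence pn: "\<not> p dvd n" using p(1) coprime_absorb_left[of p n] by auto
  have "ord d p = Carmichael d" if "d dvd n" for d
    using ord_cong[OF cong_dvd_modulus_nat[OF p(2) that]] a(2)[OF that] by simp
  moreover have "p_practical p n" using practical p(1) unfolding lambda_practical_def by blast
  moreover have "nat m \<in> {1..n}" using m by auto
  ultimately obtain c where c: "\<forall>d. d dvd n \<longrightarrow> c d * Carmichael d \<le> totient d"
      "nat m = (\<Sum>d | d dvd n. Carmichael d * c d)"
    using p_practical_imp_sum[OF p(1) assms pn] by blast
  have "m = (\<Sum>d | d dvd n. int (Carmichael d) * int (c d))"
    using arg_cong[OF c(2), of int] m by simp
  thus "\<exists>c :: nat \<Rightarrow> int. (\<forall>d. d dvd n \<longrightarrow>
            0 \<le> c d \<and> real_of_int (c d) \<le> real (totient d) / real (Carmichael d)) \<and>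
         m = (\<Sum>d | d dvd n. int (Carmichael d) * c d)"
    using c(1) unfolding le_divide_Carmichael_iff[symmetric] by (intro exI[of _ "\<lambda>d. int (c d)"]) simp
next
  assume sums: "\<forall>m::int. 1 \<le> m \<and> m \<le> int n \<longrightarrow>
      (\<exists>c :: nat \<Rightarrow> int.
         (\<forall>d. d dvd n \<longrightarrow>
            0 \<le> c d \<and> real_of_int (c d) \<le> real (totient d) / real (Carmichael d)) \<and>
         m = (\<Sum>d | d dvd n. int (Carmichael d) * c d))"
  show "lambda_practical n"
    unfolding lambda_practical_def p_practical_def
  proof (intro allI impI ballI)
    fix p m :: nat assume p: "Factorial_Ring.prime p" and m: "m \<in> {1..n}"
    have "1 \<le> int m \<and> int m \<le> int n" using m by auto
    then obtain c :: "nat \<Rightarrow> int" where c: "\<And>d. d dvd n \<Longrightarrow> 0 \<le> c d"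
      "\<And>d. d dvd n \<Longrightarrow> real_of_int (c d) \<le> real (totient d) / real (Carmichael d)"
      "int m = (\<Sum>d | d dvd n. int (Carmichael d) * c d)"
      using sums by blast
    have bound: "nat (c d) * Carmichael d \<le> totient d" if "d dvd n" for d
      using c(1,2)[OF that] unfolding le_divide_Carmichael_iff[symmetric] by simp
    have "int m = int (\<Sum>d | d dvd n. Carmichael d * nat (c d))"
      unfolding c(3) of_nat_sum using c(1) by (intro sum.cong) auto
    hence "m = (\<Sum>d | d dvd n. Carmichael d * nat (c d))" unfolding of_nat_eq_iff .
    thus "\<exists>f\<in>carrier (Fp_poly_ring p). f pdivides\<^bsub>residue_ring (int p)\<^esub> X_pow_minus_1 p n \<and>
        Polynomials.degree f = m"
      using sum_imp_p_divisor[OF p assms bound] by blast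
  qed
qed

end
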